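(* Let $M$ be a countable transitive model of $\mathsf{ZFC}$ and $\Gamma$ a countably infinite group in $M$. Identify $2^\omega$ with $2^\Gamma$ via a fixed bijection $\Gamma\to\omega$ in $M$. Then the set $\mathcal{R}$ of $M$-generic random reals is a $\Gamma$-invariant conull Borel subset of the free part $(2)^\Gamma$ of the Bernoulli shift action of $\Gamma$, and $F(\Gamma,2)\upharpoonright\mathcal{R}\subseteq\ \equiv^\mathbb{B}_M$.
   Context: $\mathbb{B}$ is the partial order, computed in $M$, of all Borel subsets of $2^\omega$ of positive measure, ordered by inclusion; $\mathcal{R}$ is the set of $x$ such that $\{B^M\in\mathbb{B}:x\in B\}$ is $M$-generic (where $B^M$, $B$ are the interpretations in $M$, $\mathbf{V}$ of a Borel code in $M$), and $x\equiv^\mathbb{B}_M y$ iff $M[x]=M[y]$. The Bernoulli shift of $\Gamma$ on $2^\Gamma$ is $(\gamma\cdot x)(\delta)=x(\gamma^{-1}\delta)$; its free part is $(2)^\Gamma=\{x\in2^\Gamma:\forall\gamma\neq1\ (\gamma\cdot x\neq x)\}$, and $F(\Gamma,2)$ is the orbit equivalence relation of the shift restricted to $(2)^\Gamma$. Conull refers to the product measure on $2^\Gamma$. *)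

theory Defs
  imports
    "HOL-Analysis.Analysis"
    "HOL-Algebra.Group"
    "HOL-Library.Countable_Set_Type"
begin

section \<open>Hereditarily countable sets\<close>

text \<open>The least fixed point of the countable-powerset functor: this type is a copy of the set HC of
  all hereditarily countable sets. Every countable transitive set is a subset (and an element) of
  HC, so nothing is lost by looking for countable transitive models here.\<close>

datatype hc = HC (celts: "hc cset")

definition elts :: "hc \<Rightarrow> hc set" where
  "elts a = rcset (celts a)"

text \<open>The set with elements \<open>A\<close>; only meaningful for countable \<open>A\<close>.\<close>

definition hset :: "hc set \<Rightarrow> hc" where
  "hset A = HC (acset A)"

lemma elts_hset: "countable A \<Longrightarrow> elts (hset A) = A"
  by (simp add: elts_def hset_def)

lemma countable_elts: "countable (elts a)"
  by (simp add: elts_def)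

lemma hset_elts: "hset (elts a) = a"
  by (simp add: elts_def hset_def)

lemma hc_ext: "elts a = elts b \<Longrightarrow> a = b"
  by (metis hset_elts)

definition mem_rel :: "(hc \<times> hc) set" where
  "mem_rel = {(a, b). a \<in> elts b}"

lemma wf_mem_rel: "wf mem_rel"
proof (rule wfUNIVI)
  fix P :: "hc \<Rightarrow> bool" and x
  assume *: "\<forall>x. (\<forall>y. (y, x) \<in> mem_rel \<longrightarrow> P y) \<longrightarrow> P x"
  show "P x"
  proof (induction x)
    case (HC C)
    then show ?case
      using *[rule_format, of "HC C"] by (auto simp: mem_rel_def elts_def)
  qed
qed

definition kpair :: "hc \<Rightarrow> hc \<Rightarrow> hc" where
  "kpair a b = hset {hset {a}, hset {a, b}}"

lemma elts_kpair: "elts (kpair a b) = {hset {a}, hset {a, b}}"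
  by (simp add: kpair_def elts_hset)

lemma kpair_inject: "kpair a b = kpair c d \<longleftrightarrow> a = c \<and> b = d"
proof
  assume "kpair a b = kpair c d"
  then have eq: "{hset {a}, hset {a, b}} = {hset {c}, hset {c, d}}"
    by (metis elts_kpair)
  have inj: "hset A = hset B \<longleftrightarrow> A = B" if "finite A" "finite B" for A B
    using that by (metis countable_finite elts_hset)
  from eq show "a = c \<and> b = d"
    by (auto simp: doubleton_eq_iff inj)
qed simp

lemma fst_kpair_trancl: "kpair a b \<in> elts t \<Longrightarrow> (a, t) \<in> mem_rel\<^sup>+"
proof -
  assume "kpair a b \<in> elts t"
  then have "(kpair a b, t) \<in> mem_rel" by (simp add: mem_rel_def)
  moreover have "(hset {a}, kpair a b) \<in> mem_rel" by (simp add: mem_rel_def elts_kpair)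
  moreover have "(a, hset {a}) \<in> mem_rel" by (simp add: mem_rel_def elts_hset)
  ultimately show ?thesis by (meson r_into_trancl trancl_trans)
qed

primrec num :: "nat \<Rightarrow> hc" where
  "num 0 = hset {}"
| "num (Suc n) = hset (insert (num n) (elts (num n)))"


section \<open>Countable transitive models of ZFC\<close>

text \<open>Formulas of the language of set theory, with de Bruijn indices.\<close>

datatype fm = Mem nat nat | Eq nat nat | Neg fm | Conj fm fm | Forall fm

primrec sat :: "hc set \<Rightarrow> (nat \<Rightarrow> hc) \<Rightarrow> fm \<Rightarrow> bool" where
  "sat M e (Mem i j) \<longleftrightarrow> e i \<in> elts (e j)"
| "sat M e (Eq i j) \<longleftrightarrow> e i = e j"
| "sat M e (Neg p) \<longleftrightarrow> \<not> sat M e p"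
| "sat M e (Conj p q) \<longleftrightarrow> sat M e p \<and> sat M e q"
| "sat M e (Forall p) \<longleftrightarrow> (\<forall>a\<in>M. sat M (case_nat a e) p)"

text \<open>Each single axiom is written as its relativisation to \<open>M\<close>, that is, as what its satisfaction
  in \<open>(M, \<in>)\<close> unfolds to. The two schemes range over all formulas \<open>p\<close> and all parameters in \<open>M\<close>
  (supplied by the assignment \<open>e\<close>).\<close>

definition models_ZFC :: "hc set \<Rightarrow> bool" where
  "models_ZFC M \<longleftrightarrow>
    \<comment> \<open>extensionality\<close>
    (\<forall>a\<in>M. \<forall>b\<in>M. (\<forall>x\<in>M. x \<in> elts a \<longleftrightarrow> x \<in> elts b) \<longrightarrow> a = b) \<and>
    \<comment> \<open>foundation\<close>
    (\<forall>a\<in>M. (\<exists>x\<in>M. x \<in> elts a) \<longrightarrow>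
      (\<exists>x\<in>M. x \<in> elts a \<and> (\<forall>y\<in>M. \<not> (y \<in> elts x \<and> y \<in> elts a)))) \<and>
    \<comment> \<open>pairing\<close>
    (\<forall>a\<in>M. \<forall>b\<in>M. \<exists>c\<in>M. \<forall>x\<in>M. x \<in> elts c \<longleftrightarrow> x = a \<or> x = b) \<and>
    \<comment> \<open>union\<close>
    (\<forall>a\<in>M. \<exists>u\<in>M. \<forall>x\<in>M. x \<in> elts u \<longleftrightarrow> (\<exists>y\<in>M. y \<in> elts a \<and> x \<in> elts y)) \<and>
    \<comment> \<open>power set\<close>
    (\<forall>a\<in>M. \<exists>p\<in>M. \<forall>x\<in>M. x \<in> elts p \<longleftrightarrow> (\<forall>z\<in>M. z \<in> elts x \<longrightarrow> z \<in> elts a)) \<and>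
    \<comment> \<open>infinity\<close>
    (\<exists>w\<in>M. (\<exists>z\<in>M. z \<in> elts w \<and> (\<forall>u\<in>M. u \<notin> elts z)) \<and>
      (\<forall>y\<in>M. y \<in> elts w \<longrightarrow>
        (\<exists>s\<in>M. s \<in> elts w \<and> (\<forall>u\<in>M. u \<in> elts s \<longleftrightarrow> u \<in> elts y \<or> u = y)))) \<and>
    \<comment> \<open>separation\<close>
    (\<forall>p e. range e \<subseteq> M \<longrightarrow>
      (\<forall>a\<in>M. \<exists>b\<in>M. \<forall>x\<in>M. x \<in> elts b \<longleftrightarrow> x \<in> elts a \<and> sat M (case_nat x e) p)) \<and>
    \<comment> \<open>replacement\<close>
    (\<forall>p e. range e \<subseteq> M \<longrightarrow>
      (\<forall>a\<in>M. (\<forall>x\<in>M. x \<in> elts a \<longrightarrow> (\<exists>!y. y \<in> M \<and> sat M (case_nat x (case_nat y e)) p)) \<longrightarrow>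
        (\<exists>b\<in>M. \<forall>x\<in>M. x \<in> elts a \<longrightarrow>
          (\<exists>y\<in>M. y \<in> elts b \<and> sat M (case_nat x (case_nat y e)) p)))) \<and>
    \<comment> \<open>choice: a family of nonempty pairwise disjoint sets has a transversal\<close>
    (\<forall>a\<in>M.
      (\<forall>x\<in>M. x \<in> elts a \<longrightarrow> (\<exists>z\<in>M. z \<in> elts x)) \<and>
      (\<forall>x\<in>M. \<forall>y\<in>M. x \<in> elts a \<and> y \<in> elts a \<and> x \<noteq> y \<longrightarrow>
        (\<forall>z\<in>M. \<not> (z \<in> elts x \<and> z \<in> elts y))) \<longrightarrow>
      (\<exists>c\<in>M. \<forall>x\<in>M. x \<in> elts a \<longrightarrow> (\<exists>!z. z \<in> M \<and> z \<in> elts x \<and> z \<in> elts c)))"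

definition ctm_ZFC :: "hc set \<Rightarrow> bool" where
  "ctm_ZFC M \<longleftrightarrow> countable M \<and> (\<forall>a\<in>M. elts a \<subseteq> M) \<and> models_ZFC M"

text \<open>The set \<open>A\<close> is an element of \<open>M\<close>.\<close>

definition in_model :: "hc set \<Rightarrow> hc set \<Rightarrow> bool" where
  "in_model M A \<longleftrightarrow> (\<exists>a\<in>M. elts a = A)"


section \<open>Reals, sets of reals, Borel sets and measure, computed in a model\<close>

text \<open>Elements of \<open>2\<^sup>\<omega>\<close> are functions \<open>nat \<Rightarrow> bool\<close>; the codes below are their graphs.\<close>

definition num_of_bool :: "bool \<Rightarrow> hc" where
  "num_of_bool b = num (if b then 1 else 0)"

definition real_code :: "(nat \<Rightarrow> bool) \<Rightarrow> hc" where
  "real_code x = hset {kpair (num n) (num_of_bool (x n)) | n. True}"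

definition string_code :: "bool list \<Rightarrow> hc" where
  "string_code s = hset {kpair (num i) (num_of_bool (s ! i)) | i. i < length s}"

text \<open>Used for countable \<open>X\<close> only.\<close>

definition set_code :: "(nat \<Rightarrow> bool) set \<Rightarrow> hc" where
  "set_code X = hset (real_code ` X)"

text \<open>\<open>2\<^sup>\<omega>\<close> as computed in \<open>M\<close>.\<close>

definition cantor :: "hc set \<Rightarrow> (nat \<Rightarrow> bool) set" where
  "cantor M = {x. real_code x \<in> M}"

definition sets_in :: "hc set \<Rightarrow> (nat \<Rightarrow> bool) set set" where
  "sets_in M = {X. in_model M (real_code ` X)}"

definition open_in :: "hc set \<Rightarrow> (nat \<Rightarrow> bool) set \<Rightarrow> bool" where
  "open_in M U \<longleftrightarrow> U \<in> sets_in M \<and>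
    (\<forall>x\<in>U. \<exists>n. \<forall>y\<in>cantor M. (\<forall>i<n. y i = x i) \<longrightarrow> y \<in> U)"

definition sigma_algebra_in :: "hc set \<Rightarrow> (nat \<Rightarrow> bool) set set \<Rightarrow> bool" where
  "sigma_algebra_in M S \<longleftrightarrow>
    S \<subseteq> sets_in M \<and> in_model M (set_code ` S) \<and>
    {} \<in> S \<and> (\<forall>X\<in>S. cantor M - X \<in> S) \<and>
    (\<forall>f :: nat \<Rightarrow> (nat \<Rightarrow> bool) set.
      range f \<subseteq> S \<and> in_model M {kpair (num n) (set_code (f n)) | n. True} \<longrightarrow> (\<Union>n. f n) \<in> S)"

text \<open>The Borel sets of \<open>M\<close>: the relativisation to \<open>M\<close> of ``belongs to every \<open>\<sigma>\<close>-algebra containing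
  the open sets''.\<close>

definition borel_in :: "hc set \<Rightarrow> (nat \<Rightarrow> bool) set set" where
  "borel_in M = {X \<in> sets_in M.
    \<forall>S. sigma_algebra_in M S \<and> (\<forall>U. open_in M U \<longrightarrow> U \<in> S) \<longrightarrow> X \<in> S}"

definition cylinder :: "bool list \<Rightarrow> (nat \<Rightarrow> bool) set" where
  "cylinder s = {x. \<forall>i<length s. x i = s ! i}"

text \<open>The coin-tossing measure of a Borel set as computed in \<open>M\<close>, by Caratheodory's construction: the
  infimum over the covers by cylinders that belong to \<open>M\<close>. It is a real number of \<open>M\<close> and the same
  infimum whether computed in \<open>M\<close> or outside.\<close>

definition measure_in :: "hc set \<Rightarrow> (nat \<Rightarrow> bool) set \<Rightarrow> ennreal" where
  "measure_in M X = Inf {(\<Sum>n. ennreal ((1 / 2) ^ length (s n))) | s :: nat \<Rightarrow> bool list.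
     in_model M {kpair (num n) (string_code (s n)) | n. True} \<and> X \<subseteq> (\<Union>n. cylinder (s n))}"


section \<open>Random forcing, generic filters and generic extensions\<close>

text \<open>The order on this poset is inclusion, i.e. \<open>elts p \<subseteq> elts q\<close>.\<close>

definition random_poset :: "hc set \<Rightarrow> hc set" where
  "random_poset M = set_code ` {X \<in> borel_in M. 0 < measure_in M X}"

definition dense_in_poset :: "hc set \<Rightarrow> hc set \<Rightarrow> bool" where
  "dense_in_poset P D \<longleftrightarrow> D \<subseteq> P \<and> (\<forall>p\<in>P. \<exists>d\<in>D. elts d \<subseteq> elts p)"

text \<open>\<open>G\<close> is an \<open>M\<close>-generic filter on the poset \<open>(P, \<subseteq>)\<close>.\<close>

definition generic_filter :: "hc set \<Rightarrow> hc set \<Rightarrow> hc set \<Rightarrow> bool" where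
  "generic_filter M P G \<longleftrightarrow>
    G \<subseteq> P \<and> G \<noteq> {} \<and>
    (\<forall>p\<in>G. \<forall>q\<in>P. elts p \<subseteq> elts q \<longrightarrow> q \<in> G) \<and>
    (\<forall>p\<in>G. \<forall>q\<in>G. \<exists>r\<in>G. elts r \<subseteq> elts p \<and> elts r \<subseteq> elts q) \<and>
    (\<forall>D. in_model M D \<and> dense_in_poset P D \<longrightarrow> D \<inter> G \<noteq> {})"

text \<open>Borel codes, as well-founded trees. \<open>interp W c\<close> evaluates the code \<open>c\<close> taking \<open>W\<close> to be the set of
  all reals, so that \<open>interp UNIV c\<close> and \<open>interp (cantor M) c\<close> are the interpretations in the universe
  and in \<open>M\<close>.\<close>

datatype bcode = BCyl "bool list" | BCompl bcode | BUnion "nat \<Rightarrow> bcode"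

primrec interp :: "(nat \<Rightarrow> bool) set \<Rightarrow> bcode \<Rightarrow> (nat \<Rightarrow> bool) set" where
  "interp W (BCyl s) = W \<inter> cylinder s"
| "interp W (BCompl c) = W - interp W c"
| "interp W (BUnion f) = (\<Union>n. interp W (f n))"

primrec bcode_code :: "bcode \<Rightarrow> hc" where
  "bcode_code (BCyl s) = kpair (num 0) (string_code s)"
| "bcode_code (BCompl c) = kpair (num 1) (bcode_code c)"
| "bcode_code (BUnion f) = kpair (num 2) (hset (range (\<lambda>n. kpair (num n) (bcode_code (f n)))))"

definition borel_codes :: "hc set \<Rightarrow> bcode set" where
  "borel_codes M = {c. bcode_code c \<in> M}"

definition random_filter :: "hc set \<Rightarrow> (nat \<Rightarrow> bool) \<Rightarrow> hc set" where
  "random_filter M x = {set_code (interp (cantor M) c) | c.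
     c \<in> borel_codes M \<and> set_code (interp (cantor M) c) \<in> random_poset M \<and> x \<in> interp UNIV c}"

definition random_reals :: "hc set \<Rightarrow> (nat \<Rightarrow> bool) set" where
  "random_reals M = {x. generic_filter M (random_poset M) (random_filter M x)}"

inductive forcing_name :: "hc set \<Rightarrow> hc \<Rightarrow> bool" for P :: "hc set" where
  "(\<And>z. z \<in> elts t \<Longrightarrow> \<exists>s p. z = kpair s p \<and> forcing_name P s \<and> p \<in> P) \<Longrightarrow> forcing_name P t"

function val :: "hc set \<Rightarrow> hc \<Rightarrow> hc" where
  "val G t = hset (val G ` {s. \<exists>p\<in>G. kpair s p \<in> elts t})"
  by pat_completeness auto
termination
  by (relation "inv_image (mem_rel\<^sup>+) snd")
     (auto simp: wf_mem_rel wf_trancl intro: fst_kpair_trancl)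

declare val.simps [simp del]

text \<open>The generic extension \<open>M[G]\<close> and, for random \<open>x\<close>, \<open>M[x] = M[G\<^sub>x]\<close>.\<close>

definition generic_ext :: "hc set \<Rightarrow> hc set \<Rightarrow> hc set \<Rightarrow> hc set" where
  "generic_ext M P G = {val G t | t. t \<in> M \<and> forcing_name P t}"

definition random_ext :: "hc set \<Rightarrow> (nat \<Rightarrow> bool) \<Rightarrow> hc set" where
  "random_ext M x = generic_ext M (random_poset M) (random_filter M x)"

definition random_equiv :: "hc set \<Rightarrow> ((nat \<Rightarrow> bool) \<times> (nat \<Rightarrow> bool)) set" where
  "random_equiv M =
    {(x, y). x \<in> random_reals M \<and> y \<in> random_reals M \<and> random_ext M x = random_ext M y}"


section \<open>Groups in the model and the Bernoulli shift\<close>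

definition group_in :: "hc set \<Rightarrow> hc monoid \<Rightarrow> bool" where
  "group_in M \<Gamma> \<longleftrightarrow> group \<Gamma> \<and> in_model M (carrier \<Gamma>) \<and>
    in_model M {kpair (kpair a b) (a \<otimes>\<^bsub>\<Gamma>\<^esub> b) | a b. a \<in> carrier \<Gamma> \<and> b \<in> carrier \<Gamma>}"

definition enumeration_in :: "hc set \<Rightarrow> hc monoid \<Rightarrow> (hc \<Rightarrow> nat) \<Rightarrow> bool" where
  "enumeration_in M \<Gamma> e \<longleftrightarrow> bij_betw e (carrier \<Gamma>) UNIV \<and>
    in_model M {kpair a (num (e a)) | a. a \<in> carrier \<Gamma>}"

definition countably_infinite_group_in :: "hc set \<Rightarrow> hc monoid \<Rightarrow> bool" where
  "countably_infinite_group_in M \<Gamma> \<longleftrightarrow> group_in M \<Gamma> \<and> (\<exists>e. enumeration_in M \<Gamma> e)"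

text \<open>\<open>2\<^sup>\<Gamma>\<close>, its Borel sets and its product measure.\<close>

definition shift_space :: "hc monoid \<Rightarrow> (hc \<Rightarrow> bool) set" where
  "shift_space \<Gamma> = carrier \<Gamma> \<rightarrow>\<^sub>E UNIV"

definition shift_borel :: "hc monoid \<Rightarrow> (hc \<Rightarrow> bool) set set" where
  "shift_borel \<Gamma> = sigma_sets (shift_space \<Gamma>)
    {U. openin (product_topology (\<lambda>_. discrete_topology UNIV) (carrier \<Gamma>)) U}"

definition shift_measure :: "hc monoid \<Rightarrow> (hc \<Rightarrow> bool) measure" where
  "shift_measure \<Gamma> =
    PiM (carrier \<Gamma>) (\<lambda>_. density (count_space (UNIV :: bool set)) (\<lambda>_. 1 / 2))"

definition shift :: "hc monoid \<Rightarrow> hc \<Rightarrow> (hc \<Rightarrow> bool) \<Rightarrow> (hc \<Rightarrow> bool)" where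
  "shift \<Gamma> g x = (\<lambda>d\<in>carrier \<Gamma>. x (m_inv \<Gamma> g \<otimes>\<^bsub>\<Gamma>\<^esub> d))"

definition free_part :: "hc monoid \<Rightarrow> (hc \<Rightarrow> bool) set" where
  "free_part \<Gamma> = {x \<in> shift_space \<Gamma>. \<forall>g\<in>carrier \<Gamma>. g \<noteq> \<one>\<^bsub>\<Gamma>\<^esub> \<longrightarrow> shift \<Gamma> g x \<noteq> x}"

definition shift_orbit_equiv :: "hc monoid \<Rightarrow> ((hc \<Rightarrow> bool) \<times> (hc \<Rightarrow> bool)) set" where
  "shift_orbit_equiv \<Gamma> =
    {(x, y). x \<in> free_part \<Gamma> \<and> y \<in> free_part \<Gamma> \<and> (\<exists>g\<in>carrier \<Gamma>. y = shift \<Gamma> g x)}"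

text \<open>The identification of \<open>2\<^sup>\<omega>\<close> with \<open>2\<^sup>\<Gamma>\<close> along \<open>e : \<Gamma> \<rightarrow> \<omega>\<close>.\<close>

definition transfer_real :: "hc monoid \<Rightarrow> (hc \<Rightarrow> nat) \<Rightarrow> (nat \<Rightarrow> bool) \<Rightarrow> (hc \<Rightarrow> bool)" where
  "transfer_real \<Gamma> e x = (\<lambda>g\<in>carrier \<Gamma>. x (e g))"

definition random_reals_on :: "hc set \<Rightarrow> hc monoid \<Rightarrow> (hc \<Rightarrow> nat) \<Rightarrow> (hc \<Rightarrow> bool) set" where
  "random_reals_on M \<Gamma> e = transfer_real \<Gamma> e ` random_reals M"

definition random_equiv_on ::
    "hc set \<Rightarrow> hc monoid \<Rightarrow> (hc \<Rightarrow> nat) \<Rightarrow> ((hc \<Rightarrow> bool) \<times> (hc \<Rightarrow> bool)) set" where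
  "random_equiv_on M \<Gamma> e = map_prod (transfer_real \<Gamma> e) (transfer_real \<Gamma> e) ` random_equiv M"

end

theory Submission
  imports Defs "HOL-Probability.Infinite_Product_Measure"
begin

text \<open>Every definition over \<open>M\<close> may use all elements of \<open>M\<close> as parameters, and closure of the
  definable functions under recursion brings the values of Borel codes, the measure and the maps
  induced by permutations of \<open>\<omega>\<close> into \<open>M\<close>. Approximation by clopen sets shows that the measure in \<open>M\<close>
  of the value of a code agrees with the measure of its interpretation in the universe. Hence each
  of the countably many dense sets of \<open>M\<close> is met by almost every real: among the countable unions,
  formed in \<open>M\<close>, of members of a dense set there is one whose complement is null. So almost every
  real is random.

  The filter of a random real decides every Borel set of \<open>M\<close>, so a permutation of \<open>\<omega>\<close> in \<open>M\<close>, which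
  acts on the random poset by automorphisms, maps random reals to random reals, and applying it to
  the conditions occurring in a name shows that it does not change the extension. If the permutation
  has no fixed points, there are arbitrarily large finite sets \<open>I\<close> disjoint from their images; the
  reals constant along the pairs \<open>i, \<phi> i\<close> for \<open>i \<in> I\<close> have measure \<open>2\<^sup>-\<^sup>|\<^sup>I\<^sup>|\<close>, so no random real is fixed.\<close>

section \<open>Definability over the model\<close>

text \<open>The syntax of formulas enters only in the basic closure rules of \<open>dfp\<close> and
  \<open>dft\<close>. Afterwards definability is a property of HOL predicates and functions on
  assignments, and that a set lies in M is read off from the HOL term describing it; quantifiers
  over numbers, strings, reals or sequences become quantifiers over M through total decoding
  functions. Real numbers are not coded in M. Comparisons of measures are expressed through the
  covers that belong to M and through partial sums scaled to integers. The main obstacle is that M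
  sees only the interpretation of a code in \<open>cantor M\<close>: two codes with the same
  interpretation there may contain different reals outside. What survives the passage is
  approximation. An inclusion that holds between interpretations in M holds outside up to a null
  set, since the difference of the codes has measure 0 on both sides. As M has countably many codes,
  almost every real avoids all of these null sets.\<close>

primrec rename :: "(nat \<Rightarrow> nat) \<Rightarrow> fm \<Rightarrow> fm" where
  "rename f (Mem i j) = Mem (f i) (f j)"
| "rename f (Eq i j) = Eq (f i) (f j)"
| "rename f (Neg p) = Neg (rename f p)"
| "rename f (Conj p q) = Conj (rename f p) (rename f q)"
| "rename f (Forall p) = Forall (rename (case_nat 0 (\<lambda>i. Suc (f i))) p)"

lemma sat_rename: "sat M e (rename f p) \<longleftrightarrow> sat M (\<lambda>i. e (f i)) p"
proof (induction p arbitrary: e f)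
  case (Forall p)
  have "(\<lambda>i. case_nat a e (case_nat 0 (\<lambda>i. Suc (f i)) i)) = case_nat a (\<lambda>i. e (f i))" for a
    by (auto split: nat.splits)
  then show ?case using Forall by simp
qed auto

lemma range_case_nat: "a \<in> M \<Longrightarrow> range e \<subseteq> M \<Longrightarrow> range (case_nat a e) \<subseteq> M"
  by (auto simp: image_subset_iff split: nat.splits)

lemma case_nat_eta: "case_nat (e 0) (\<lambda>i. e (Suc i)) = e"
  by (auto split: nat.splits)

lemma hset_eqI: "countable A \<Longrightarrow> elts a = A \<Longrightarrow> a = hset A"
  by (metis hset_elts)

lemma hset_inject: "countable A \<Longrightarrow> countable B \<Longrightarrow> hset A = hset B \<longleftrightarrow> A = B"
  by (metis elts_hset)

definition hempty :: hc where "hempty = hset {}"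

lemma elts_hempty [simp]: "elts hempty = {}"
  by (simp add: hempty_def elts_hset)

lemma elts_not_refl: "a \<notin> elts a"
  using wf_mem_rel by (auto simp: mem_rel_def dest: wf_not_refl)

lemma elts_asym: "a \<in> elts b \<Longrightarrow> b \<notin> elts a"
  using wf_mem_rel by (auto simp: mem_rel_def dest: wf_asym)

lemma hc_induct: "(\<And>x. (\<And>y. y \<in> elts x \<Longrightarrow> P y) \<Longrightarrow> P x) \<Longrightarrow> P x"
  using wf_induct[OF wf_mem_rel, of P x] by (auto simp: mem_rel_def)

text \<open>Collects the closure rules of definability. They decompose a goal along the HOL term it
  speaks of; a bound variable becomes variable 0 of the assignment and the surrounding ones move up
  by one.\<close>

named_theorems dfi

locale ctm =
  fixes M :: "hc set"
  assumes ctm: "ctm_ZFC M"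
begin

section \<open>The axioms as closure properties of the model\<close>

lemma trans_M: "a \<in> M \<Longrightarrow> x \<in> elts a \<Longrightarrow> x \<in> M"
  using ctm by (auto simp: ctm_ZFC_def)

lemma countable_M: "countable M"
  using ctm by (auto simp: ctm_ZFC_def)

lemma zfc: "models_ZFC M"
  using ctm by (simp add: ctm_ZFC_def)

lemma M_nonempty: "M \<noteq> {}"
  using zfc[unfolded models_ZFC_def, THEN conjunct2, THEN conjunct2, THEN conjunct2,
      THEN conjunct2, THEN conjunct2, THEN conjunct1] by (elim bexE) auto

lemma countable_in_M: "A \<subseteq> M \<Longrightarrow> countable A"
  using countable_M countable_subset by blast

text \<open>By transitivity all elements of \<open>c\<close> lie in M, so the relativised axiom
  determines \<open>elts c\<close> exactly. Union, power set and separation become closure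
  properties of M in the same way.\<close>

lemma pairing_M: "a \<in> M \<Longrightarrow> b \<in> M \<Longrightarrow> hset {a, b} \<in> M"
proof -
  assume ab: "a \<in> M" "b \<in> M"
  then obtain c where c: "c \<in> M" "\<forall>x\<in>M. x \<in> elts c \<longleftrightarrow> x = a \<or> x = b"
    using zfc[unfolded models_ZFC_def, THEN conjunct2, THEN conjunct2, THEN conjunct1, rule_format, OF ab] by blast
  then have "elts c = {a, b}" using ab trans_M by blast
  then show ?thesis using c by (metis hset_elts)
qed

lemma Union_M: "a \<in> M \<Longrightarrow> hset (\<Union>x\<in>elts a. elts x) \<in> M"
proof -
  assume a: "a \<in> M"
  then obtain c where c: "c \<in> M" "\<forall>x\<in>M. x \<in> elts c \<longleftrightarrow> (\<exists>y\<in>M. y \<in> elts a \<and> x \<in> elts y)"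
    using zfc[unfolded models_ZFC_def, THEN conjunct2, THEN conjunct2, THEN conjunct2, THEN conjunct1, rule_format, OF a] by blast
  then have "elts c = (\<Union>x\<in>elts a. elts x)" using a trans_M by blast
  then show ?thesis using c by (metis hset_elts)
qed

lemma Pow_M: "a \<in> M \<Longrightarrow> hset {x \<in> M. elts x \<subseteq> elts a} \<in> M"
proof -
  assume a: "a \<in> M"
  then obtain c where c: "c \<in> M" "\<forall>x\<in>M. x \<in> elts c \<longleftrightarrow> (\<forall>z\<in>M. z \<in> elts x \<longrightarrow> z \<in> elts a)"
    using zfc[unfolded models_ZFC_def, THEN conjunct2, THEN conjunct2, THEN conjunct2, THEN conjunct2, THEN conjunct1, rule_format, OF a] by blast
  then have "elts c = {x \<in> M. elts x \<subseteq> elts a}" using a trans_M by blast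
  then show ?thesis using c by (metis hset_elts)
qed

lemma separation_M:
  assumes e: "range e \<subseteq> M" and a: "a \<in> M"
  shows "hset {x \<in> elts a. sat M (case_nat x e) p} \<in> M"
proof -
  note sep = zfc[unfolded models_ZFC_def, THEN conjunct2, THEN conjunct2, THEN conjunct2,
      THEN conjunct2, THEN conjunct2, THEN conjunct2, THEN conjunct1]
  have "\<exists>b\<in>M. \<forall>x\<in>M. x \<in> elts b \<longleftrightarrow> x \<in> elts a \<and> sat M (case_nat x e) p"
    by (rule sep[THEN spec, of p, THEN spec, of e, THEN mp, OF e, THEN bspec, OF a])
  then obtain c where c: "c \<in> M" "\<forall>x\<in>M. x \<in> elts c \<longleftrightarrow> x \<in> elts a \<and> sat M (case_nat x e) p" ..
  then have "elts c = {x \<in> elts a. sat M (case_nat x e) p}" using trans_M[OF a] trans_M[OF c(1)] by auto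
  then show ?thesis using c by (metis hset_elts)
qed

lemma replacement_M:
  assumes e: "range e \<subseteq> M" and a: "a \<in> M"
    and ex: "\<And>x. x \<in> elts a \<Longrightarrow> \<exists>!y. y \<in> M \<and> sat M (case_nat x (case_nat y e)) p"
  shows "\<exists>b\<in>M. \<forall>x\<in>elts a. \<exists>y\<in>elts b. sat M (case_nat x (case_nat y e)) p"
proof -
  note rep = zfc[unfolded models_ZFC_def, THEN conjunct2, THEN conjunct2, THEN conjunct2,
      THEN conjunct2, THEN conjunct2, THEN conjunct2, THEN conjunct2, THEN conjunct1]
  have "\<exists>b\<in>M. \<forall>x\<in>M. x \<in> elts a \<longrightarrow>
      (\<exists>y\<in>M. y \<in> elts b \<and> sat M (case_nat x (case_nat y e)) p)"
    by (rule rep[THEN spec, of p, THEN spec, of e, THEN mp, OF e, THEN bspec, OF a, THEN mp])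
      (intro ballI impI ex)
  then show ?thesis using trans_M[OF a] by meson
qed

text \<open>Since \<open>M\<close> is countable, all its elements can be supplied as parameters at once: the odd
  variables of a formula are reserved for an enumeration of \<open>M\<close>.\<close>

definition mix :: "(nat \<Rightarrow> hc) \<Rightarrow> nat \<Rightarrow> hc" where
  "mix e i = (if even i then e (i div 2) else from_nat_into M (i div 2))"

text \<open>The formula has to agree with the HOL predicate only at assignments into M. Parameters
  of the predicate are absorbed in the odd variables.\<close>

definition dfp :: "((nat \<Rightarrow> hc) \<Rightarrow> bool) \<Rightarrow> bool" where
  "dfp P \<longleftrightarrow> (\<exists>p. \<forall>e. range e \<subseteq> M \<longrightarrow> (sat M (mix e) p \<longleftrightarrow> P e))"

text \<open>A function is definable through its graph, with the value pushed in front of the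
  arguments. In this form an existential quantifier substitutes the function into a predicate, see
  \<open>dfp_subst\<close>.\<close>

definition dft :: "((nat \<Rightarrow> hc) \<Rightarrow> hc) \<Rightarrow> bool" where
  "dft t \<longleftrightarrow> (\<forall>e. range e \<subseteq> M \<longrightarrow> t e \<in> M) \<and> dfp (\<lambda>e. e 0 = t (\<lambda>i. e (Suc i)))"

lemma range_mix: "range e \<subseteq> M \<Longrightarrow> range (mix e) \<subseteq> M"
  using from_nat_into[OF M_nonempty] by (auto simp: mix_def)

text \<open>Pushing a value onto \<open>e\<close> shifts the even variables of \<open>mix e\<close>
  by two and leaves the odd ones in place, whereas the quantifier of \<open>fm\<close> shifts every
  variable by one. \<open>unmix\<close> translates between the two.\<close>

definition unmix :: "nat \<Rightarrow> nat" where
  "unmix k = (if k = 0 then 0 else if even k then k - 1 else k + 1)"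

lemma mix_case_nat: "mix (case_nat a e) k = case_nat a (mix e) (unmix k)"
proof -
  have "k = 0 \<or> (\<exists>j. k = 2 * Suc j) \<or> (\<exists>j. k = Suc (2 * j))" by presburger
  then consider "k = 0" | j where "k = 2 * Suc j" | j where "k = Suc (2 * j)"
    by blast
  then show ?thesis
    by cases (auto simp: mix_def unmix_def)
qed

lemma sat_mix_case_nat:
  "sat M (mix (case_nat a e)) p \<longleftrightarrow> sat M (case_nat a (mix e)) (rename unmix p)"
proof -
  have "mix (case_nat a e) = (\<lambda>k. case_nat a (mix e) (unmix k))"
    by (rule ext) (rule mix_case_nat)
  then show ?thesis by (simp add: sat_rename)
qed

lemma dfp_cong: "(\<And>e. range e \<subseteq> M \<Longrightarrow> P e = Q e) \<Longrightarrow> dfp P = dfp Q"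
  unfolding dfp_def by (intro ex_cong1) auto

lemma dfp_mem_var: "dfp (\<lambda>e. e i \<in> elts (e j))"
  unfolding dfp_def by (rule exI[of _ "Mem (2*i) (2*j)"]) (simp add: mix_def)

lemma dfp_eq_var: "dfp (\<lambda>e. e i = e j)"
  unfolding dfp_def by (rule exI[of _ "Eq (2*i) (2*j)"]) (simp add: mix_def)

lemma dfp_eq_const: "a \<in> M \<Longrightarrow> dfp (\<lambda>e. e i = a)"
proof -
  assume "a \<in> M"
  then have "from_nat_into M (to_nat_on M a) = a" using countable_M by simp
  then show ?thesis
    unfolding dfp_def
    by (intro exI[of _ "Eq (2*i) (Suc (2*(to_nat_on M a)))"]) (simp add: mix_def)
qed

lemma dfp_not [dfi]: "dfp P \<Longrightarrow> dfp (\<lambda>e. \<not> P e)"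
proof -
  assume "dfp P"
  then obtain p where p: "\<And>e. range e \<subseteq> M \<Longrightarrow> sat M (mix e) p \<longleftrightarrow> P e"
    by (auto simp: dfp_def)
  show ?thesis unfolding dfp_def by (rule exI[of _ "Neg p"]) (simp add: p)
qed

lemma dfp_conj [dfi]: "dfp P \<Longrightarrow> dfp Q \<Longrightarrow> dfp (\<lambda>e. P e \<and> Q e)"
proof -
  assume "dfp P" "dfp Q"
  then obtain p q where "\<And>e. range e \<subseteq> M \<Longrightarrow> sat M (mix e) p \<longleftrightarrow> P e"
    "\<And>e. range e \<subseteq> M \<Longrightarrow> sat M (mix e) q \<longleftrightarrow> Q e"
    by (auto simp: dfp_def)
  then show ?thesis unfolding dfp_def by (intro exI[of _ "Conj p q"]) simp
qed

lemma dfp_disj [dfi]: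
  assumes "dfp P" "dfp Q" shows "dfp (\<lambda>e. P e \<or> Q e)"
proof -
  have "dfp (\<lambda>e. \<not> (\<not> P e \<and> \<not> Q e))"
    by (intro dfp_not dfp_conj assms)
  then show ?thesis by (simp only: de_Morgan_conj not_not)
qed

lemma dfp_imp [dfi]:
  assumes "dfp P" "dfp Q" shows "dfp (\<lambda>e. P e \<longrightarrow> Q e)"
proof -
  have "dfp (\<lambda>e. \<not> P e \<or> Q e)"
    by (intro dfp_not dfp_disj assms)
  then show ?thesis by (simp only: imp_conv_disj)
qed

lemma dfp_iff [dfi]:
  assumes "dfp P" "dfp Q" shows "dfp (\<lambda>e. P e \<longleftrightarrow> Q e)"
proof -
  have "dfp (\<lambda>e. (P e \<longrightarrow> Q e) \<and> (Q e \<longrightarrow> P e))"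
    by (intro dfp_imp dfp_conj assms)
  then show ?thesis
    by (rule dfp_cong[THEN iffD1, rotated]) blast
qed

lemma dfp_True [dfi]: "dfp (\<lambda>e. True)"
proof -
  have "dfp (\<lambda>e. e 0 = e 0)" by (rule dfp_eq_var)
  then show ?thesis by simp
qed

lemma dfp_False [dfi]: "dfp (\<lambda>e. False)"
  using dfp_not[OF dfp_True] by simp

lemma dfp_all [dfi]:
  assumes "dfp (\<lambda>e. P (e 0) (\<lambda>i. e (Suc i)))"
  shows "dfp (\<lambda>e. \<forall>a\<in>M. P a e)"
proof -
  obtain p where p: "\<And>e. range e \<subseteq> M \<Longrightarrow> sat M (mix e) p \<longleftrightarrow> P (e 0) (\<lambda>i. e (Suc i))"
    using assms by (auto simp: dfp_def)
  have "sat M (mix e) (Forall (rename unmix p)) \<longleftrightarrow> (\<forall>a\<in>M. P a e)" if "range e \<subseteq> M" for e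
    using p[of "case_nat _ e"] range_case_nat[OF _ that] by (simp flip: sat_mix_case_nat)
  then show ?thesis unfolding dfp_def by blast
qed

lemma dfp_ex [dfi]:
  assumes "dfp (\<lambda>e. P (e 0) (\<lambda>i. e (Suc i)))"
  shows "dfp (\<lambda>e. \<exists>a\<in>M. P a e)"
proof -
  have "dfp (\<lambda>e. \<not> (\<forall>a\<in>M. \<not> P a e))"
    by (intro dfp_not dfp_all assms)
  then show ?thesis by simp
qed

lemma dfp_rename: "dfp P \<Longrightarrow> dfp (\<lambda>e. P (\<lambda>i. e (f i)))"
proof -
  assume "dfp P"
  then obtain p where p: "\<And>e. range e \<subseteq> M \<Longrightarrow> sat M (mix e) p \<longleftrightarrow> P e"
    by (auto simp: dfp_def)
  define g where "g k = (if even k then 2 * f (k div 2) else k)" for k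
  have "mix (\<lambda>i. e (f i)) = (\<lambda>k. mix e (g k))" for e
    by (auto simp: mix_def g_def)
  then have "sat M (mix e) (rename g p) \<longleftrightarrow> P (\<lambda>i. e (f i))" if "range e \<subseteq> M" for e
    using p[of "\<lambda>i. e (f i)"] that by (simp add: sat_rename image_subset_iff)
  then show ?thesis unfolding dfp_def by blast
qed

lemma dfp_subst:
  assumes "dfp P" "dft t"
  shows "dfp (\<lambda>e. P (case_nat (t e) e))"
proof -
  have "dfp (\<lambda>e. e 0 = t (\<lambda>i. e (Suc i)) \<and> P (case_nat (e 0) (\<lambda>i. e (Suc i))))"
    using assms by (auto simp: dft_def case_nat_eta intro: dfp_conj)
  then have "dfp (\<lambda>e. \<exists>y\<in>M. y = t e \<and> P (case_nat y e))"
    by (rule dfp_ex)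
  then show ?thesis
    by (rule dfp_cong[THEN iffD1, rotated]) (use assms(2) in \<open>auto simp: dft_def\<close>)
qed

lemma dft_M: "dft t \<Longrightarrow> range e \<subseteq> M \<Longrightarrow> t e \<in> M"
  by (simp add: dft_def)

lemma dft_rename: "dft t \<Longrightarrow> dft (\<lambda>e. t (\<lambda>i. e (f i)))"
  unfolding dft_def
proof (intro conjI allI impI; elim conjE)
  assume "dfp (\<lambda>e. e 0 = t (\<lambda>i. e (Suc i)))"
  from dfp_rename[OF this, of "case_nat 0 (\<lambda>i. Suc (f i))"]
  show "dfp (\<lambda>e. e 0 = t (\<lambda>i. e (Suc (f i))))" by simp
qed (auto simp: image_subset_iff)

lemma dft_shift: "dft t \<Longrightarrow> dft (\<lambda>e. t (\<lambda>i. e (Suc i)))"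
  by (rule dft_rename)

lemma dfp_shift: "dfp t \<Longrightarrow> dfp (\<lambda>e. t (\<lambda>i. e (Suc i)))"
  by (rule dfp_rename)

lemma dfp_sub1:
  assumes "dfp (\<lambda>e. Q (e 0))" "dft s"
  shows "dfp (\<lambda>e. Q (s e))"
  using dfp_subst[OF assms] by simp

lemma dfp_sub2:
  assumes "dfp (\<lambda>e. Q (e 0) (e 1))" "dft s" "dft t"
  shows "dfp (\<lambda>e. Q (s e) (t e))"
proof -
  have "dfp (\<lambda>e. Q (e 1) (e 0))"
    using dfp_rename[OF assms(1), of "\<lambda>i. if i = 0 then 1 else 0"] by simp
  from dfp_subst[OF this dft_shift[OF assms(3)]]
  have "dfp (\<lambda>e. Q (e 0) (t (\<lambda>i. e (Suc i))))" by simp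
  from dfp_subst[OF this assms(2)] show ?thesis by simp
qed

lemma dfp_sub3:
  assumes "dfp (\<lambda>e. Q (e 0) (e 1) (e 2))" "dft s" "dft t" "dft u"
  shows "dfp (\<lambda>e. Q (s e) (t e) (u e))"
proof -
  have "dfp (\<lambda>e. Q (e 1) (e 2) (e 0))"
    using dfp_rename[OF assms(1), of "\<lambda>i. if i = 0 then 1 else if i = 1 then 2 else 0"] by simp
  from dfp_subst[OF this dft_rename[OF assms(4), of "\<lambda>i. i + 2"]]
  have "dfp (\<lambda>e. Q (e 0) (e 1) (u (\<lambda>i. e (Suc (Suc i)))))" by simp
  then have "dfp (\<lambda>e. Q (e 1) (e 0) (u (\<lambda>i. e (Suc (Suc i)))))"
    using dfp_rename[of "\<lambda>e. Q (e 0) (e 1) (u (\<lambda>i. e (Suc (Suc i))))"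
        "\<lambda>i. if i = 0 then 1 else if i = 1 then 0 else i"] by simp
  from dfp_subst[OF this dft_shift[OF assms(3)]]
  have "dfp (\<lambda>e. Q (e 0) (t (\<lambda>i. e (Suc i))) (u (\<lambda>i. e (Suc i))))" by simp
  from dfp_subst[OF this assms(2)] show ?thesis by simp
qed

lemma dft_var [dfi]: "dft (\<lambda>e. e i)"
  unfolding dft_def by (auto intro: dfp_eq_var)

lemma dft_const [dfi]: "a \<in> M \<Longrightarrow> dft (\<lambda>e. a)"
  unfolding dft_def by (auto intro: dfp_eq_const)

lemma dfp_mem [dfi]: "dft s \<Longrightarrow> dft t \<Longrightarrow> dfp (\<lambda>e. s e \<in> elts (t e))"
  by (rule dfp_sub2[where Q="\<lambda>x y. x \<in> elts y", OF dfp_mem_var])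

lemma dfp_eq [dfi]: "dft s \<Longrightarrow> dft t \<Longrightarrow> dfp (\<lambda>e. s e = t e)"
  by (rule dfp_sub2[where Q="(=)", OF dfp_eq_var])

lemma dft_sub1:
  assumes "dft (\<lambda>e. F (e 0))" "dft s"
  shows "dft (\<lambda>e. F (s e))"
proof -
  have "dfp (\<lambda>e. e 0 = F (e 1))" using assms(1) by (simp add: dft_def)
  from dfp_sub2[OF this dft_var dft_shift[OF assms(2)]]
  have "dfp (\<lambda>e. e 0 = F (s (\<lambda>i. e (Suc i))))" .
  moreover have "F (s e) \<in> M" if "range e \<subseteq> M" for e
    using dft_M[OF assms(1), of "\<lambda>_. s e"] dft_M[OF assms(2) that] by auto
  ultimately show ?thesis by (simp add: dft_def)
qed

lemma dft_sub2:
  assumes "dft (\<lambda>e. F (e 0) (e 1))" "dft s" "dft t"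
  shows "dft (\<lambda>e. F (s e) (t e))"
proof -
  have "dfp (\<lambda>e. e 0 = F (e 1) (e 2))" using assms(1) by (simp add: dft_def numeral_2_eq_2)
  from dfp_sub3[OF this dft_var dft_shift[OF assms(2)] dft_shift[OF assms(3)]]
  have "dfp (\<lambda>e. e 0 = F (s (\<lambda>i. e (Suc i))) (t (\<lambda>i. e (Suc i))))" .
  moreover have "F (s e) (t e) \<in> M" if "range e \<subseteq> M" for e
    using dft_M[OF assms(1), of "case_nat (s e) (\<lambda>_. t e)"] dft_M[OF assms(2) that]
      dft_M[OF assms(3) that] by (auto simp: image_subset_iff split: nat.splits)
  ultimately show ?thesis by (simp add: dft_def)
qed

lemma dfp_ball [dfi]:
  assumes "dft t" "dfp (\<lambda>e. P (e 0) (\<lambda>i. e (Suc i)))"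
  shows "dfp (\<lambda>e. \<forall>a\<in>elts (t e). P a e)"
proof -
  have "dfp (\<lambda>e. \<forall>a\<in>M. a \<in> elts (t e) \<longrightarrow> P a e)"
    by (intro dfp_all dfp_imp dfp_mem dft_var dft_shift assms)
  then show ?thesis
    by (rule dfp_cong[THEN iffD1, rotated]) (use trans_M dft_M[OF assms(1)] in blast)
qed

lemma dfp_bex [dfi]:
  assumes "dft t" "dfp (\<lambda>e. P (e 0) (\<lambda>i. e (Suc i)))"
  shows "dfp (\<lambda>e. \<exists>a\<in>elts (t e). P a e)"
proof -
  have "dfp (\<lambda>e. \<not> (\<forall>a\<in>elts (t e). \<not> P a e))"
    by (intro dfp_not dfp_ball assms)
  then show ?thesis by simp
qed

lemma dfp_subset [dfi]: "dft s \<Longrightarrow> dft t \<Longrightarrow> dfp (\<lambda>e. elts (s e) \<subseteq> elts (t e))"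
  unfolding subset_iff Ball_def[symmetric] by (intro dfi dft_shift)

text \<open>By extensionality and transitivity, a function into \<open>M\<close> is definable as soon as
  membership in its values is.\<close>

lemma dft_ext:
  assumes "\<And>e. range e \<subseteq> M \<Longrightarrow> t e \<in> M" "dfp (\<lambda>e. e 0 \<in> elts (t (\<lambda>i. e (Suc i))))"
  shows "dft t"
proof -
  have "dfp (\<lambda>e. case_nat (e 0) (\<lambda>i. e (Suc (Suc i))) 0
      \<in> elts (t (\<lambda>i. case_nat (e 0) (\<lambda>i. e (Suc (Suc i))) (Suc i))))"
    using dfp_rename[OF assms(2), of "case_nat 0 (\<lambda>i. Suc (Suc i))"] by simp
  then have "dfp (\<lambda>e. e 0 \<in> elts (t (\<lambda>i. e (Suc (Suc i)))))" by simp
  then have "dfp (\<lambda>e. \<forall>x\<in>M. x \<in> elts (e 0) \<longleftrightarrow> x \<in> elts (t (\<lambda>i. e (Suc i))))"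
    by (intro dfp_all dfp_iff dfp_mem_var)
  then have "dfp (\<lambda>e. e 0 = t (\<lambda>i. e (Suc i)))"
  proof (rule dfp_cong[THEN iffD1, rotated])
    fix e :: "nat \<Rightarrow> hc" assume e: "range e \<subseteq> M"
    then have "e 0 \<in> M" "t (\<lambda>i. e (Suc i)) \<in> M"
      using assms(1)[of "\<lambda>i. e (Suc i)"] by (auto simp: image_subset_iff)
    then have "(\<forall>x\<in>M. x \<in> elts (e 0) \<longleftrightarrow> x \<in> elts (t (\<lambda>i. e (Suc i)))) \<longleftrightarrow>
        elts (e 0) = elts (t (\<lambda>i. e (Suc i)))"
      using trans_M by blast
    then show "(\<forall>x\<in>M. x \<in> elts (e 0) \<longleftrightarrow> x \<in> elts (t (\<lambda>i. e (Suc i)))) \<longleftrightarrow> e 0 = t (\<lambda>i. e (Suc i))"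
      using hc_ext by metis
  qed
  then show ?thesis using assms(1) by (simp add: dft_def)
qed

lemma dft_hset:
  assumes "\<And>e. range e \<subseteq> M \<Longrightarrow> hset (A e) \<in> M" "\<And>e. range e \<subseteq> M \<Longrightarrow> countable (A e)"
    "dfp (\<lambda>e. e 0 \<in> A (\<lambda>i. e (Suc i)))"
  shows "dft (\<lambda>e. hset (A e))"
proof (rule dft_ext)
  show "dfp (\<lambda>e. e 0 \<in> elts (hset (A (\<lambda>i. e (Suc i)))))"
  proof (rule dfp_cong[THEN iffD1, OF _ assms(3)])
    fix e :: "nat \<Rightarrow> hc" assume "range e \<subseteq> M"
    then have "range (\<lambda>i. e (Suc i)) \<subseteq> M" by auto
    then show "(e 0 \<in> A (\<lambda>i. e (Suc i))) = (e 0 \<in> elts (hset (A (\<lambda>i. e (Suc i)))))"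
      using assms(2) by (simp add: elts_hset)
  qed
qed (use assms in auto)

section \<open>Definable set operations\<close>

lemma dft_Collect [dfi]:
  assumes t: "dft t" and P: "dfp (\<lambda>e. P (e 0) (\<lambda>i. e (Suc i)))"
  shows "dft (\<lambda>e. hset {x \<in> elts (t e). P x e})"
proof (rule dft_hset)
  fix e :: "nat \<Rightarrow> hc" assume e: "range e \<subseteq> M"
  obtain p where p: "\<And>e. range e \<subseteq> M \<Longrightarrow> sat M (mix e) p \<longleftrightarrow> P (e 0) (\<lambda>i. e (Suc i))"
    using P by (auto simp: dfp_def)
  have te: "t e \<in> M" using t e by (rule dft_M)
  have "sat M (case_nat x (mix e)) (rename unmix p) \<longleftrightarrow> P x e" if "x \<in> elts (t e)" for x
    using p[of "case_nat x e"] trans_M[OF te that] e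
    by (simp flip: sat_mix_case_nat add: range_case_nat)
  then have "{x \<in> elts (t e). P x e} = {x \<in> elts (t e). sat M (case_nat x (mix e)) (rename unmix p)}"
    by auto
  then show "hset {x \<in> elts (t e). P x e} \<in> M"
    using separation_M[OF range_mix[OF e] te] by simp
  show "countable {x \<in> elts (t e). P x e}" using countable_elts by simp
next
  show "dfp (\<lambda>e. e 0 \<in> {x \<in> elts (t (\<lambda>i. e (Suc i))). P x (\<lambda>i. e (Suc i))})"
    unfolding mem_Collect_eq by (intro dfp_conj dfp_mem dft_var dft_shift t P)
qed

text \<open>The replacement axiom yields only some \<open>b\<close> in M that contains the image;
  separation then cuts the image out of \<open>b\<close>.\<close>

lemma dft_image [dfi]:
  assumes t: "dft t" and F: "dft (\<lambda>e. F (e 0) (\<lambda>i. e (Suc i)))"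
  shows "dft (\<lambda>e. hset ((\<lambda>x. F x e) ` elts (t e)))"
proof (rule dft_hset)
  fix e :: "nat \<Rightarrow> hc" assume e: "range e \<subseteq> M"
  have te: "t e \<in> M" using t e by (rule dft_M)
  have "dfp (\<lambda>e. e 0 = F (e 1) (\<lambda>i. e (Suc (Suc i))))"
    using F by (simp add: dft_def)
  \<comment> \<open>The graph has the value in front of the argument, while the replacement axiom
    has the argument in front, so the first two variables are exchanged.\<close>
  then have "dfp (\<lambda>e. e 1 = F (e 0) (\<lambda>i. e (Suc (Suc i))))"
    using dfp_rename[of "\<lambda>e. e 0 = F (e 1) (\<lambda>i. e (Suc (Suc i)))"
        "\<lambda>i. if i = 0 then 1 else if i = 1 then 0 else i"] by simp
  then obtain p where p: "\<And>e. range e \<subseteq> M \<Longrightarrow>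
      sat M (mix e) p \<longleftrightarrow> e 1 = F (e 0) (\<lambda>i. e (Suc (Suc i)))"
    by (auto simp: dfp_def)
  \<comment> \<open>Two values are pushed onto the assignment, and each has to be moved past
    \<open>mix\<close> by a renaming of its own; the second renaming acts below the outer value and
    fixes variable 0.\<close>
  define q where "q = rename (case_nat 0 (\<lambda>i. Suc (unmix i))) (rename unmix p)"
  have q: "sat M (case_nat x (case_nat y (mix e))) q \<longleftrightarrow> y = F x e" if "x \<in> M" "y \<in> M" for x y
  proof -
    have "mix (case_nat y e) = (\<lambda>k. case_nat y (mix e) (unmix k))"
      by (rule ext) (rule mix_case_nat)
    then have "case_nat x (mix (case_nat y e)) =
        (\<lambda>k. case_nat x (case_nat y (mix e)) (case_nat 0 (\<lambda>i. Suc (unmix i)) k))"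
      by (auto split: nat.splits)
    then show ?thesis
      using p[of "case_nat x (case_nat y e)"] that e
      by (simp add: q_def sat_mix_case_nat range_case_nat sat_rename[of _ _ "case_nat 0 (\<lambda>i. Suc (unmix i))"])
  qed
  have FM: "F x e \<in> M" if "x \<in> M" for x
    using dft_M[OF F range_case_nat[OF that e]] by simp
  have "\<exists>b\<in>M. \<forall>x\<in>elts (t e). \<exists>y\<in>elts b. sat M (case_nat x (case_nat y (mix e))) q"
  proof (rule replacement_M[OF range_mix[OF e] te])
    fix x assume "x \<in> elts (t e)"
    then have "x \<in> M" using trans_M te by blast
    then show "\<exists>!y. y \<in> M \<and> sat M (case_nat x (case_nat y (mix e))) q"
      by (intro ex1I[of _ "F x e"]) (auto simp: q FM)
  qed
  then obtain b where b1: "b \<in> M"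
      "\<forall>x\<in>elts (t e). \<exists>y\<in>elts b. sat M (case_nat x (case_nat y (mix e))) q" ..
  have b: "F x e \<in> elts b" if x: "x \<in> elts (t e)" for x
  proof -
    obtain y where y: "y \<in> elts b" "sat M (case_nat x (case_nat y (mix e))) q"
      using b1(2) x by blast
    then show ?thesis using q[OF trans_M[OF te x] trans_M[OF b1(1) y(1)]] by simp
  qed
  have "dft (\<lambda>e. hset {y \<in> elts (e 0). \<exists>x\<in>elts (e 1). y = F x (\<lambda>i. e (Suc (Suc i)))})"
  proof (intro dft_Collect dfp_bex dft_var)
    show "dfp (\<lambda>e. e (Suc 0) = F (e 0) (\<lambda>i. e (Suc (Suc (Suc (Suc i))))))" 
      using dfp_rename[OF \<open>dfp (\<lambda>e. e 1 = F (e 0) (\<lambda>i. e (Suc (Suc i))))\<close>,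
        of "case_nat 0 (case_nat 1 (\<lambda>i. Suc (Suc (Suc (Suc i)))))"] by simp
  qed
  from dft_M[OF this range_case_nat[OF b1(1) range_case_nat[OF te e]]]
  have "hset {y \<in> elts b. \<exists>x\<in>elts (t e). y = F x e} \<in> M" by simp
  moreover have "{y \<in> elts b. \<exists>x\<in>elts (t e). y = F x e} = (\<lambda>x. F x e) ` elts (t e)"
    using b by auto
  ultimately show "hset ((\<lambda>x. F x e) ` elts (t e)) \<in> M" by simp
  show "countable ((\<lambda>x. F x e) ` elts (t e))" using countable_elts by simp
next
  have "dfp (\<lambda>e. e 0 = F (e 1) (\<lambda>i. e (Suc (Suc i))))"
    using F by (simp add: dft_def)
  then have "dfp (\<lambda>e. e 1 = F (e 0) (\<lambda>i. e (Suc (Suc i))))"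
    using dfp_rename[of "\<lambda>e. e 0 = F (e 1) (\<lambda>i. e (Suc (Suc i)))"
        "\<lambda>i. if i = 0 then 1 else if i = 1 then 0 else i"] by simp
  from dfp_rename[OF this, of "case_nat 0 (case_nat 1 (\<lambda>i. Suc (Suc i)))"]
  have "dfp (\<lambda>e. e 1 = F (e 0) (\<lambda>i. e (Suc (Suc i))))" by simp
  then have "dfp (\<lambda>e. \<exists>x\<in>elts (t (\<lambda>i. e (Suc i))). e 0 = F x (\<lambda>i. e (Suc i)))"
    by (intro dfp_bex dft_shift t) simp
  then show "dfp (\<lambda>e. e 0 \<in> (\<lambda>x. F x (\<lambda>i. e (Suc i))) ` elts (t (\<lambda>i. e (Suc i))))"
    unfolding image_iff .
qed

lemma dft_Union [dfi]:
  assumes t: "dft t"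
  shows "dft (\<lambda>e. hset (\<Union>x\<in>elts (t e). elts x))"
proof (rule dft_hset)
  show "dfp (\<lambda>e. e 0 \<in> (\<Union>x\<in>elts (t (\<lambda>i. e (Suc i))). elts x))"
    unfolding UN_iff by (intro dfi dft_shift t)
qed (use Union_M dft_M[OF t] countable_elts in auto)

lemma dft_UN [dfi]:
  assumes t: "dft t" and F: "dft (\<lambda>e. F (e 0) (\<lambda>i. e (Suc i)))"
  shows "dft (\<lambda>e. hset (\<Union>x\<in>elts (t e). elts (F x e)))"
proof -
  have "dft (\<lambda>e. hset (\<Union>x\<in>elts (hset ((\<lambda>x. F x e) ` elts (t e))). elts x))"
    by (intro dft_Union dft_image assms)
  then show ?thesis by (simp add: elts_hset countable_elts)
qed

lemma dft_Pow [dfi]: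
  assumes t: "dft t"
  shows "dft (\<lambda>e. hset {x \<in> M. elts x \<subseteq> elts (t e)})"
proof (rule dft_hset)
  have "dfp (\<lambda>e. elts (e 0) \<subseteq> elts (t (\<lambda>i. e (Suc i))))"
    by (intro dfi dft_shift t)
  then show "dfp (\<lambda>e. e 0 \<in> {x \<in> M. elts x \<subseteq> elts (t (\<lambda>i. e (Suc i)))})"
    by (rule dfp_cong[THEN iffD1, rotated]) auto
qed (use Pow_M dft_M[OF t] countable_M in auto)

lemma dft_pair [dfi]: "dft s \<Longrightarrow> dft t \<Longrightarrow> dft (\<lambda>e. hset {s e, t e})"
proof (rule dft_hset)
  assume s: "dft s" and t: "dft t"
  show "dfp (\<lambda>e. e 0 \<in> {s (\<lambda>i. e (Suc i)), t (\<lambda>i. e (Suc i))})"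
    unfolding insert_iff empty_iff by (intro dfi dft_shift s t)
qed (use pairing_M dft_M in auto)

lemma dft_singleton [dfi]: "dft s \<Longrightarrow> dft (\<lambda>e. hset {s e})"
  using dft_pair[of s s] by simp

lemma dft_Un [dfi]: "dft s \<Longrightarrow> dft t \<Longrightarrow> dft (\<lambda>e. hset (elts (s e) \<union> elts (t e)))"
  using dft_Union[OF dft_pair[of s t]] by (simp add: elts_hset)

lemma dft_insert [dfi]: "dft s \<Longrightarrow> dft t \<Longrightarrow> dft (\<lambda>e. hset (insert (s e) (elts (t e))))"
  using dft_Un[OF dft_singleton[of s], of t] by (simp add: elts_hset)

lemma dft_Diff [dfi]: "dft s \<Longrightarrow> dft t \<Longrightarrow> dft (\<lambda>e. hset (elts (s e) - elts (t e)))"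
  unfolding set_diff_eq by (intro dfi dft_shift)

lemma dft_kpair [dfi]: "dft s \<Longrightarrow> dft t \<Longrightarrow> dft (\<lambda>e. kpair (s e) (t e))"
  unfolding kpair_def by (intro dfi)

lemma dft_If [dfi]:
  assumes "dfp P" "dft s" "dft t"
  shows "dft (\<lambda>e. if P e then s e else t e)"
  unfolding dft_def
proof
  have "dfp (\<lambda>e. (P (\<lambda>i. e (Suc i)) \<longrightarrow> e 0 = s (\<lambda>i. e (Suc i))) \<and>
     (\<not> P (\<lambda>i. e (Suc i)) \<longrightarrow> e 0 = t (\<lambda>i. e (Suc i))))"
    by (intro dfi dft_shift dfp_shift assms)
  then show "dfp (\<lambda>e. e 0 = (if P (\<lambda>i. e (Suc i)) then s (\<lambda>i. e (Suc i)) else t (\<lambda>i. e (Suc i))))"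
    by (rule dfp_cong[THEN iffD1, rotated]) auto
qed (use assms dft_M in auto)

lemma hempty_M: "hempty \<in> M"
proof -
  obtain a where "a \<in> M" using M_nonempty by blast
  from dft_M[OF dft_Collect[OF dft_var dfp_False], of "\<lambda>_. a"] this
  show ?thesis by (auto simp: hempty_def)
qed

lemma finite_M: "finite A \<Longrightarrow> A \<subseteq> M \<Longrightarrow> hset A \<in> M"
proof (induction A rule: finite_induct)
  case empty
  then show ?case using hempty_M by (simp add: hempty_def)
next
  case (insert x A)
  then have "range (case_nat x (\<lambda>_. hset A)) \<subseteq> M" by (intro range_case_nat) auto
  from dft_M[OF dft_insert[OF dft_var[of 0] dft_var[of 1]] this] insert
  show ?case by (simp add: elts_hset countable_finite)
qed

lemma dft_comp:
  assumes "dft (\<lambda>e. F (e 0))" "a \<in> M"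
  shows "F a \<in> M"
  using dft_M[OF assms(1), of "\<lambda>_. a"] assms(2) by auto

lemma dft_comp2:
  assumes "dft (\<lambda>e. F (e 0) (e (Suc 0)))" "a \<in> M" "b \<in> M"
  shows "F a b \<in> M"
proof -
  have "range (case_nat a (\<lambda>_. b)) \<subseteq> M" using assms by (intro range_case_nat) auto
  from dft_M[OF assms(1) this] show ?thesis by simp
qed

text \<open>Implicit definitions: a function into M is definable once some definable property
  singles out its value. Projections and recursively defined functions enter the calculus through
  this rule.\<close>

lemma dft_unique:
  assumes "dfp (\<lambda>e. P (e 0) (\<lambda>i. e (Suc i)))"
    and "\<And>e. range e \<subseteq> M \<Longrightarrow> t e \<in> M"
    and "\<And>e y. range e \<subseteq> M \<Longrightarrow> y \<in> M \<Longrightarrow> P y e \<longleftrightarrow> y = t e"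
  shows "dft t"
  unfolding dft_def
proof
  show "dfp (\<lambda>e. e 0 = t (\<lambda>i. e (Suc i)))"
  proof (rule dfp_cong[THEN iffD1, OF _ assms(1)])
    fix e :: "nat \<Rightarrow> hc" assume "range e \<subseteq> M"
    then show "P (e 0) (\<lambda>i. e (Suc i)) = (e 0 = t (\<lambda>i. e (Suc i)))"
      by (intro assms(3)) auto
  qed
qed (use assms in auto)

end

section \<open>Numbers, pairs and functions in the model\<close>

declare num.simps [simp del]

lemma elts_num: "elts (num n) = num ` {..<n}"
  by (induction n) (auto simp: num.simps elts_hset countable_finite lessThan_Suc)

lemma num_mem [simp]: "num m \<in> elts (num n) \<longleftrightarrow> m < n"
proof
  assume "num m \<in> elts (num n)"
  show "m < n"
  proof (rule ccontr)
    assume "\<not> m < n"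
    then consider "m = n" | "n < m" by linarith
    then show False
    proof cases
      case 2
      then have "num n \<in> elts (num m)" by (auto simp: elts_num)
      with \<open>num m \<in> elts (num n)\<close> show False using elts_asym by blast
    qed (use \<open>num m \<in> elts (num n)\<close> elts_not_refl in auto)
  qed
qed (auto simp: elts_num)

lemma num_inject [simp]: "num m = num n \<longleftrightarrow> m = n"
proof
  assume eq: "num m = num n"
  show "m = n"
  proof (rule ccontr)
    assume "m \<noteq> n"
    then have "num m \<in> elts (num n) \<or> num n \<in> elts (num m)" unfolding num_mem by linarith
    then show False using eq elts_not_refl by simp
  qed
qed simp

text \<open>A total decoding with a default value: every element of M stands for some number, so a
  HOL quantifier over \<open>nat\<close> amounts to a quantifier over M. The decodings of strings,
  reals and sequences below play the same part.\<close>

definition unnum :: "hc \<Rightarrow> nat" where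
  "unnum y = (if y \<in> range num then inv_into UNIV num y else 0)"

lemma inj_num: "inj num"
  by (auto simp: inj_def)

lemma unnum_num [simp]: "unnum (num n) = n"
  by (simp add: unnum_def inj_num)

definition omega :: hc where "omega = hset (range num)"

lemma elts_omega [simp]: "elts omega = range num"
  by (simp add: omega_def elts_hset)

definition hsuc :: "hc \<Rightarrow> hc" where "hsuc y = hset (insert y (elts y))"

lemma elts_hsuc [simp]: "elts (hsuc y) = insert y (elts y)"
  by (simp add: hsuc_def elts_hset countable_elts)

lemma num_Suc: "num (Suc n) = hsuc (num n)"
  by (simp add: hsuc_def num.simps)

lemma num_0: "num 0 = hempty"
  by (simp add: hempty_def num.simps)

text \<open>The finite ordinals described with quantifiers bounded by \<open>x\<close>, so that
  separation can cut \<open>omega\<close> out of the inductive set provided by the axiom of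
  infinity.\<close>

definition natural :: "hc \<Rightarrow> bool" where
  "natural x \<longleftrightarrow> (\<forall>y\<in>elts x. elts y \<subseteq> elts x) \<and> (x = hempty \<or> (\<exists>y\<in>elts x. x = hsuc y)) \<and>
    (\<forall>z\<in>elts x. z = hempty \<or> (\<exists>y\<in>elts z. z = hsuc y))"

text \<open>Induction on membership. If \<open>x\<close> is the successor of \<open>y\<close>, then
  \<open>y\<close> is natural too: an element of an element of \<open>y\<close> lies in
  \<open>x\<close> and differs from \<open>y\<close>, because membership has no cycles of length
  two.\<close>

lemma natural_iff: "natural x \<longleftrightarrow> x \<in> range num"
proof
  show "natural x \<Longrightarrow> x \<in> range num"
  proof (induction x rule: hc_induct)
    case (1 x)
    show ?case
    proof (cases "x = hempty")
      case False
      then obtain y where y: "y \<in> elts x" "x = hsuc y"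
        using 1(2) by (auto simp: natural_def)
      have "elts z \<subseteq> elts y" if "z \<in> elts y" for z
      proof
        fix u assume u: "u \<in> elts z"
        then have "u \<in> elts x" using that 1(2) y by (auto simp: natural_def)
        moreover have "u \<noteq> y" using u that elts_asym by blast
        ultimately show "u \<in> elts y" using y(2) by simp
      qed
      then have "natural y" using 1(2) y by (auto simp: natural_def)
      then obtain n where "y = num n" using 1(1) y(1) by auto
      then show ?thesis using y(2) num_Suc by (metis rangeI)
    qed (metis num_0 rangeI)
  qed
  have "num k = hempty \<or> (\<exists>y\<in>elts (num k). num k = hsuc y)" for k
    by (cases k) (auto simp: num_0 num_Suc)
  moreover have "elts y \<subseteq> elts (num k)" if "y \<in> elts (num k)" for y k
    using that by (auto simp: elts_num)
  moreover have "y \<in> range num" if "y \<in> elts (num k)" for y k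
    using that by (auto simp: elts_num)
  ultimately show "x \<in> range num \<Longrightarrow> natural x"
    unfolding natural_def by blast
qed

lemma kpair_snd_mem: "hset {a, b} \<in> elts (kpair a b)"
  by (simp add: elts_kpair)

definition hfst :: "hc \<Rightarrow> hc" where
  "hfst z = (if \<exists>a b. z = kpair a b then (THE a. \<exists>b. z = kpair a b) else hempty)"

definition hsnd :: "hc \<Rightarrow> hc" where
  "hsnd z = (if \<exists>a b. z = kpair a b then (THE b. \<exists>a. z = kpair a b) else hempty)"

lemma hfst_kpair [simp]: "hfst (kpair a b) = a"
  by (auto simp: hfst_def kpair_inject)

lemma hsnd_kpair [simp]: "hsnd (kpair a b) = b"
  by (auto simp: hsnd_def kpair_inject)

text \<open>For a functional graph the outer union runs over a single pair and returns its second
  component. Written so, application is composed of operations already known to be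
  definable.\<close>

definition app :: "hc \<Rightarrow> hc \<Rightarrow> hc" where
  "app f x = hset (\<Union>z\<in>elts (hset {z \<in> elts f. z = kpair x (hsnd z)}). elts (hsnd z))"

lemma app_eq:
  assumes "kpair x y \<in> elts f" "\<And>y'. kpair x y' \<in> elts f \<Longrightarrow> y' = y"
  shows "app f x = y"
proof -
  have "{z \<in> elts f. z = kpair x (hsnd z)} = {kpair x y}"
  proof (intro equalityI subsetI)
    fix z assume "z \<in> {z \<in> elts f. z = kpair x (hsnd z)}"
    then have z: "z \<in> elts f" "z = kpair x (hsnd z)" by blast+
    then have "hsnd z = y" using assms(2)[of "hsnd z"] by metis
    then show "z \<in> {kpair x y}" using z(2) by simp
  qed (use assms(1) in simp)
  then show ?thesis by (simp add: app_def elts_hset hset_elts)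
qed

definition seqc :: "(nat \<Rightarrow> hc) \<Rightarrow> hc" where
  "seqc h = hset (range (\<lambda>n. kpair (num n) (h n)))"

lemma elts_seqc: "elts (seqc h) = range (\<lambda>n. kpair (num n) (h n))"
  by (simp add: seqc_def elts_hset)

lemma app_seqc [simp]: "app (seqc h) (num n) = h n"
  by (rule app_eq) (auto simp: elts_seqc kpair_inject)

lemma seqc_inject [simp]: "seqc h = seqc h' \<longleftrightarrow> h = h'"
  by (metis app_seqc ext)

context ctm
begin

lemma dft_hempty [dfi]: "dft (\<lambda>e. hempty)"
  by (intro dft_const hempty_M)

lemma dft_hsuc [dfi]: "dft t \<Longrightarrow> dft (\<lambda>e. hsuc (t e))"
  unfolding hsuc_def by (intro dfi)

lemma num_M [dfi]: "num n \<in> M"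
proof (induction n)
  case (Suc n)
  show ?case unfolding num_Suc by (rule dft_comp[OF dft_hsuc[OF dft_var] Suc])
qed (simp add: num_0 hempty_M)

lemma omega_M [dfi]: "omega \<in> M"
proof -
  obtain w where w: "w \<in> M" and w0: "\<exists>z\<in>M. z \<in> elts w \<and> (\<forall>u\<in>M. u \<notin> elts z)"
    and ws: "\<forall>y\<in>M. y \<in> elts w \<longrightarrow>
        (\<exists>s\<in>M. s \<in> elts w \<and> (\<forall>u\<in>M. u \<in> elts s \<longleftrightarrow> u \<in> elts y \<or> u = y))"
    using zfc[unfolded models_ZFC_def, THEN conjunct2, THEN conjunct2, THEN conjunct2,
      THEN conjunct2, THEN conjunct2, THEN conjunct1] by auto
  have "num n \<in> elts w" for n
  proof (induction n)
    case 0
    obtain z where z: "z \<in> M" "z \<in> elts w" "\<forall>u\<in>M. u \<notin> elts z" using w0 by blast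
    then have "elts z = {}" using trans_M by blast
    then have "z = hempty" using hc_ext elts_hempty by metis
    then show ?case using z by (simp add: num_0)
  next
    case (Suc n)
    then obtain s where s: "s \<in> M" "s \<in> elts w"
      "\<forall>u\<in>M. u \<in> elts s \<longleftrightarrow> u \<in> elts (num n) \<or> u = num n"
      using ws num_M by blast
    then have "elts s = insert (num n) (elts (num n))"
      using trans_M[OF s(1)] trans_M[OF num_M[of n]] num_M[of n] by blast
    then have "s = hsuc (num n)" by (intro hc_ext) simp
    then show ?case using s by (simp add: num_Suc)
  qed
  then have "range num = {x \<in> elts w. natural x}"
    by (auto simp: natural_iff)
  moreover have "dft (\<lambda>e. hset {x \<in> elts (e 0). natural x})"
    unfolding natural_def by (intro dfi)
  ultimately show ?thesis
    using dft_comp[where F = "\<lambda>w. hset {x \<in> elts w. natural x}", OF _ w] by (simp add: omega_def)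
qed

lemma kpair_M [simp]: "kpair a b \<in> M \<longleftrightarrow> a \<in> M \<and> b \<in> M"
proof
  assume ab: "kpair a b \<in> M"
  have "hset {a, b} \<in> M" using trans_M[OF ab kpair_snd_mem] .
  then show "a \<in> M \<and> b \<in> M" using trans_M[of "hset {a, b}"] by (simp add: elts_hset)
next
  assume "a \<in> M \<and> b \<in> M"
  then have "range (case_nat a (\<lambda>_. b)) \<subseteq> M" by (intro range_case_nat) auto
  from dft_M[OF dft_kpair[OF dft_var[of 0] dft_var[of 1]] this]
  show "kpair a b \<in> M" by simp
qed

lemma dft_THE:
  assumes T: "dfp (\<lambda>e. T (e 0) (\<lambda>i. e (Suc i)))"
    and uniq: "\<And>e y y'. T y e \<Longrightarrow> T y' e \<Longrightarrow> y = y'"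
  shows "dft (\<lambda>e. if \<exists>y\<in>M. T y e then THE y. T y e else hempty)"
proof -
  have T0: "dfp (\<lambda>e. T (e 0) (\<lambda>i. e (Suc (Suc i))))"
    using dfp_rename[OF T, of "case_nat 0 (\<lambda>i. Suc (Suc i))"] by (simp only: nat.case)
  have T1: "dfp (\<lambda>e. T (e 0) (\<lambda>i. e (Suc i)) \<or>
      (\<not> (\<exists>y\<in>M. T y (\<lambda>i. e (Suc i))) \<and> e 0 = hempty))"
    by (intro dfp_disj dfp_conj dfp_not dfp_ex dfp_eq dft_hempty dft_var T T0)
  define F where "F e = (if \<exists>y\<in>M. T y e then THE y. T y e else hempty)" for e
  have F1: "F e = y" if "T y e" "y \<in> M" for e y
  proof -
    have "(THE y. T y e) = y" by (rule the_equality[where P = "\<lambda>y. T y e", OF that(1)]) (rule uniq[OF _ that(1)])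
    then show ?thesis using that unfolding F_def by auto
  qed
  have F2: "F e = hempty" if "\<not> (\<exists>y\<in>M. T y e)" for e
    using that unfolding F_def by (rule if_not_P)
  have "dft F"
  proof (rule dft_unique[OF T1])
    fix e :: "nat \<Rightarrow> hc"
    show FM: "F e \<in> M"
      using F1 F2 hempty_M by (cases "\<exists>y\<in>M. T y e") auto
    fix y assume "y \<in> M"
    then show "(T y e \<or> (\<not> (\<exists>y\<in>M. T y e) \<and> y = hempty)) \<longleftrightarrow> y = F e"
      using F1 F2 by (cases "\<exists>y\<in>M. T y e") auto
  qed
  then show ?thesis unfolding F_def .
qed

lemma dfp_ispair: "dft t \<Longrightarrow> dfp (\<lambda>e. \<exists>a b. t e = kpair a b)"
proof -
  assume t: "dft t"
  have "dfp (\<lambda>e. \<exists>a\<in>M. \<exists>b\<in>M. t e = kpair a b)"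
    by (intro dfi dft_shift t)
  then show ?thesis
    by (rule dfp_cong[THEN iffD1, rotated]) (metis dft_M[OF t] kpair_M)
qed

lemma dft_hfst [dfi]: assumes t: "dft t" shows "dft (\<lambda>e. hfst (t e))"
proof (rule dft_unique)
  show "dfp (\<lambda>e. (\<exists>b\<in>M. t (\<lambda>i. e (Suc i)) = kpair (e 0) b) \<or>
    \<not> (\<exists>a b. t (\<lambda>i. e (Suc i)) = kpair a b) \<and> e 0 = hempty)"
    by (intro dfi dfp_ispair dft_shift t)
next
  fix e :: "nat \<Rightarrow> hc" assume "range e \<subseteq> M"
  then have te: "t e \<in> M" using dft_M t by blast
  show "hfst (t e) \<in> M"
  proof (cases "\<exists>a b. t e = kpair a b")
    case True then show ?thesis using te by auto
  qed (simp add: hfst_def hempty_M)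
  fix y assume "y \<in> M"
  show "((\<exists>b\<in>M. t e = kpair y b) \<or> \<not> (\<exists>a b. t e = kpair a b) \<and> y = hempty) = (y = hfst (t e))"
  proof (cases "\<exists>a b. t e = kpair a b")
    case True then show ?thesis using te by (auto simp: kpair_inject)
  qed (auto simp: hfst_def)
qed

lemma dft_hsnd [dfi]: assumes t: "dft t" shows "dft (\<lambda>e. hsnd (t e))"
proof (rule dft_unique)
  show "dfp (\<lambda>e. (\<exists>a\<in>M. t (\<lambda>i. e (Suc i)) = kpair a (e 0)) \<or>
    \<not> (\<exists>a b. t (\<lambda>i. e (Suc i)) = kpair a b) \<and> e 0 = hempty)"
    by (intro dfi dfp_ispair dft_shift t)
next
  fix e :: "nat \<Rightarrow> hc" assume "range e \<subseteq> M"
  then have te: "t e \<in> M" using dft_M t by blast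
  show "hsnd (t e) \<in> M"
  proof (cases "\<exists>a b. t e = kpair a b")
    case True then show ?thesis using te by auto
  qed (simp add: hsnd_def hempty_M)
  fix y assume "y \<in> M"
  show "((\<exists>a\<in>M. t e = kpair a y) \<or> \<not> (\<exists>a b. t e = kpair a b) \<and> y = hempty) = (y = hsnd (t e))"
  proof (cases "\<exists>a b. t e = kpair a b")
    case True then show ?thesis using te by (auto simp: kpair_inject)
  qed (auto simp: hsnd_def)
qed

lemma dft_app [dfi]: "dft s \<Longrightarrow> dft t \<Longrightarrow> dft (\<lambda>e. app (s e) (t e))"
  unfolding app_def by (intro dfi dft_shift)

lemma dft_num_unnum [dfi]: assumes t: "dft t" shows "dft (\<lambda>e. num (unnum (t e)))"
proof -
  have "num (unnum y) = (if y \<in> elts omega then y else num 0)" for y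
    by (cases "y \<in> range num") (auto, simp add: unnum_def)
  then show ?thesis by (simp only:) (intro dfi t)
qed

lemma dfp_ex_nat [dfi]:
  assumes "dfp (\<lambda>e. P (unnum (e 0)) (\<lambda>i. e (Suc i)))"
  shows "dfp (\<lambda>e. \<exists>n. P n e)"
proof -
  have "dfp (\<lambda>e. \<exists>y\<in>M. P (unnum y) e)"
    using assms by (rule dfp_ex)
  then show ?thesis
    by (rule dfp_cong[THEN iffD1, rotated]) (metis num_M unnum_num)
qed

lemma dfp_all_nat [dfi]:
  assumes "dfp (\<lambda>e. P (unnum (e 0)) (\<lambda>i. e (Suc i)))"
  shows "dfp (\<lambda>e. \<forall>n. P n e)"
proof -
  have "dfp (\<lambda>e. \<forall>y\<in>M. P (unnum y) e)"
    using assms by (rule dfp_all)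
  then show ?thesis
    by (rule dfp_cong[THEN iffD1, rotated]) (metis num_M unnum_num)
qed

lemma dfp_less [dfi]:
  "dft (\<lambda>e. num (f e)) \<Longrightarrow> dft (\<lambda>e. num (g e)) \<Longrightarrow> dfp (\<lambda>e. f e < g e)"
  unfolding num_mem[symmetric] by (rule dfp_mem)

lemma dfp_le [dfi]:
  "dft (\<lambda>e. num (f e)) \<Longrightarrow> dft (\<lambda>e. num (g e)) \<Longrightarrow> dfp (\<lambda>e. f e \<le> g e)"
  unfolding not_less[symmetric] by (intro dfi)

lemma dfp_nat_eq [dfi]:
  "dft (\<lambda>e. num (f e)) \<Longrightarrow> dft (\<lambda>e. num (g e)) \<Longrightarrow> dfp (\<lambda>e. f e = g e)"
  unfolding num_inject[symmetric] by (rule dfp_eq)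

lemma dft_num_Suc [dfi]: "dft (\<lambda>e. num (f e)) \<Longrightarrow> dft (\<lambda>e. num (Suc (f e)))"
  unfolding num_Suc by (intro dfi)

text \<open>The value at \<open>f e\<close> is described by the existence of a set \<open>g\<close>
  that holds all values up to \<open>f e\<close>. Such a \<open>g\<close> is finite, so it lies in M
  as soon as the values do.\<close>

lemma dft_rec_nat:
  assumes a: "dft a" and h: "dft (\<lambda>e. h (unnum (e 0)) (e 1) (\<lambda>i. e (Suc (Suc i))))"
    and f: "dft (\<lambda>e. num (f e))"
  shows "dft (\<lambda>e. rec_nat (a e) (\<lambda>n y. h n y e) (f e))"
proof (rule dft_unique)
  have h': "dft (\<lambda>e. h (unnum (e (Suc (Suc 0)))) (e 0) (\<lambda>i. e (Suc (Suc (Suc (Suc (Suc i)))))))"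
    using dft_rename[OF h, of "case_nat 2 (case_nat 0 (\<lambda>i. i + 5))"] by (simp add: numeral_eq_Suc)
  show "dfp (\<lambda>e. \<exists>g\<in>M. (\<forall>y\<in>M. kpair (num 0) y \<in> elts g \<longleftrightarrow> y = a (\<lambda>i. e (Suc i))) \<and>
      (\<forall>k. k < f (\<lambda>i. e (Suc i)) \<longrightarrow> (\<forall>y\<in>M. kpair (num (Suc k)) y \<in> elts g \<longleftrightarrow>
        (\<exists>y'\<in>M. kpair (num k) y' \<in> elts g \<and> y = h k y' (\<lambda>i. e (Suc i))))) \<and>
      kpair (num (f (\<lambda>i. e (Suc i)))) (e 0) \<in> elts g)"
    by (intro dfi h' dft_rename[OF a] dft_rename[OF f])
next
  fix e :: "nat \<Rightarrow> hc" assume e: "range e \<subseteq> M"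
  let ?R = "rec_nat (a e) (\<lambda>n y. h n y e)"
  have hM: "h n y e \<in> M" if "y \<in> M" for n y
    using dft_M[OF h range_case_nat[OF num_M[of n] range_case_nat[OF that e]]] by simp
  have RM: "?R n \<in> M" for n
    by (induction n) (use dft_M[OF a e] hM in auto)
  show "?R (f e) \<in> M" by (rule RM)
  fix z assume z: "z \<in> M"
  show "(\<exists>g\<in>M. (\<forall>y\<in>M. kpair (num 0) y \<in> elts g \<longleftrightarrow> y = a e) \<and>
      (\<forall>k. k < f e \<longrightarrow> (\<forall>y\<in>M. kpair (num (Suc k)) y \<in> elts g \<longleftrightarrow>
        (\<exists>y'\<in>M. kpair (num k) y' \<in> elts g \<and> y = h k y' e))) \<and>
      kpair (num (f e)) z \<in> elts g) \<longleftrightarrow> z = ?R (f e)" (is "?L \<longleftrightarrow> _")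
  proof
    assume ?L
    then obtain g where g: "\<And>y. y\<in>M \<Longrightarrow> kpair (num 0) y \<in> elts g \<longleftrightarrow> y = a e"
      "\<And>k y. k < f e \<Longrightarrow> y \<in> M \<Longrightarrow> kpair (num (Suc k)) y \<in> elts g \<longleftrightarrow>
        (\<exists>y'\<in>M. kpair (num k) y' \<in> elts g \<and> y = h k y' e)"
      "kpair (num (f e)) z \<in> elts g" by blast
    have "k \<le> f e \<Longrightarrow> y \<in> M \<Longrightarrow> kpair (num k) y \<in> elts g \<longleftrightarrow> y = ?R k" for k y
    proof (induction k arbitrary: y)
      case (Suc k)
      then show ?case using g(2)[of k y] RM[of k] by auto
    qed (simp add: g)
    then show "z = ?R (f e)" using g(3) z by blast
  next
    assume z: "z = ?R (f e)"
    define g where "g = hset ((\<lambda>k. kpair (num k) (?R k)) ` {..f e})"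
    have g: "elts g = (\<lambda>k. kpair (num k) (?R k)) ` {..f e}"
      by (simp add: g_def elts_hset countable_finite)
    show ?L
    proof (rule bexI[of _ g])
      show "g \<in> M" unfolding g_def by (rule finite_M) (auto simp: RM num_M)
    qed (auto simp: g z kpair_inject image_iff RM)
  qed
qed

lemma transversal:
  assumes "a \<in> M" "\<And>x. x \<in> elts a \<Longrightarrow> elts x \<noteq> {}"
    "\<And>x y z. x \<in> elts a \<Longrightarrow> y \<in> elts a \<Longrightarrow> z \<in> elts x \<Longrightarrow> z \<in> elts y \<Longrightarrow> x = y"
  shows "\<exists>c\<in>M. \<forall>x\<in>elts a. \<exists>!z. z \<in> elts x \<and> z \<in> elts c"
proof -
  note AC = zfc[unfolded models_ZFC_def, THEN conjunct2, THEN conjunct2, THEN conjunct2,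
      THEN conjunct2, THEN conjunct2, THEN conjunct2, THEN conjunct2, THEN conjunct2]
  have "\<exists>c\<in>M. \<forall>x\<in>M. x \<in> elts a \<longrightarrow> (\<exists>!z. z \<in> M \<and> z \<in> elts x \<and> z \<in> elts c)"
  proof (rule AC[THEN bspec, OF assms(1), THEN mp], intro conjI ballI impI)
    fix x assume "x \<in> M" "x \<in> elts a"
    then show "\<exists>z\<in>M. z \<in> elts x" using assms(2)[of x] trans_M[of x] by blast
  next
    fix x y z assume "x \<in> elts a \<and> y \<in> elts a \<and> x \<noteq> y"
    then show "\<not> (z \<in> elts x \<and> z \<in> elts y)" using assms(3)[of x y z] by blast
  qed
  then obtain c where c: "c \<in> M"
    "\<forall>x\<in>M. x \<in> elts a \<longrightarrow> (\<exists>!z. z \<in> M \<and> z \<in> elts x \<and> z \<in> elts c)" ..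
  have "\<exists>!z. z \<in> elts x \<and> z \<in> elts c" if x: "x \<in> elts a" for x
  proof -
    have xM: "x \<in> M" by (rule trans_M[OF assms(1) x])
    have eq: "(z \<in> M \<and> z \<in> elts x \<and> z \<in> elts c) = (z \<in> elts x \<and> z \<in> elts c)" for z
      using trans_M[OF xM, of z] by blast
    show ?thesis by (rule c(2)[rule_format, OF xM x, unfolded eq])
  qed
  then show ?thesis using c(1) by (intro bexI[of _ c] ballI)
qed

lemma seqcD:
  assumes "seqc h \<in> M" "dft (\<lambda>e. num (f e))"
  shows "dft (\<lambda>e. h (f e))"
proof -
  have "dft (\<lambda>e. app (seqc h) (num (f e)))" by (intro dfi assms)
  then show ?thesis by simp
qed

lemma seqc_M: "seqc h \<in> M \<Longrightarrow> h n \<in> M"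
  using seqcD[of h "\<lambda>_. n", OF _ dft_const[OF num_M]] dft_M[of "\<lambda>_. h n" "\<lambda>_. num 0"] num_M by auto

lemma dft_seqc [dfi]:
  assumes "dft (\<lambda>e. h (unnum (e 0)) (\<lambda>i. e (Suc i)))"
  shows "dft (\<lambda>e. seqc (\<lambda>n. h n e))"
proof -
  have "dft (\<lambda>e. hset ((\<lambda>x. kpair x (h (unnum x) e)) ` elts omega))"
    by (intro dfi assms)
  then show ?thesis by (simp add: seqc_def image_image)
qed

lemma seqcI: "dft (\<lambda>e. h (unnum (e 0))) \<Longrightarrow> seqc h \<in> M"
  using dft_M[OF dft_seqc[of "\<lambda>n e. h n"], of "\<lambda>_. num 0"] num_M by auto

end

section \<open>Well-founded recursion, collection and choice in the model\<close>

lemma wf_elts: "wf {(y, x). y \<in> elts x}"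
proof -
  have "{(y, x). y \<in> elts x} = mem_rel" by (auto simp: mem_rel_def)
  then show ?thesis using wf_mem_rel by (rule ssubst)
qed

text \<open>Here \<open>V\<close> is a function of HOL that satisfies a recursion along
  \<open>d\<close>; the aim is that it maps M into M definably. Its restrictions are not known in
  advance to be elements of M, so the recursion is first approximated by sets that are.\<close>

locale wf_rec = ctm +
  fixes d :: "hc \<Rightarrow> hc" and H :: "hc \<Rightarrow> hc \<Rightarrow> hc" and V :: "hc \<Rightarrow> hc"
  assumes wf: "wf {(y, x). y \<in> elts (d x)}"
    and V: "\<And>x. V x = H x (hset ((\<lambda>y. kpair y (V y)) ` elts (d x)))"
    and d: "dft (\<lambda>e. d (e 0))"
    and H: "dft (\<lambda>e. H (e 0) (e 1))"
begin

abbreviation graph_on :: "hc \<Rightarrow> hc" where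
  "graph_on x \<equiv> hset ((\<lambda>y. kpair y (V y)) ` elts (d x))"

lemma elts_graph_on: "elts (graph_on x) = (\<lambda>y. kpair y (V y)) ` elts (d x)"
  by (simp add: elts_hset countable_elts)

text \<open>A set of justified pairs: each one is computed by \<open>H\<close> from earlier pairs
  that cover all of \<open>d x\<close>. That only correct values can occur is a consequence,
  \<open>approx_dest\<close>.\<close>

definition approx :: "hc \<Rightarrow> bool" where
  "approx f \<longleftrightarrow> (\<forall>z\<in>elts f. \<exists>x\<in>M. \<exists>g\<in>M. elts g \<subseteq> elts f \<and>
     (\<forall>w\<in>elts g. \<exists>y\<in>elts (d x). \<exists>u\<in>M. w = kpair y u) \<and>
     (\<forall>y\<in>elts (d x). \<exists>u\<in>M. kpair y u \<in> elts g) \<and> z = kpair x (H x g))"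

text \<open>Minimality makes the approximation unique, hence available to a definable description.
  It will be the restriction of \<open>V\<close> to the closure of \<open>x\<close> under
  \<open>d\<close>.\<close>

definition least_approx :: "hc \<Rightarrow> hc \<Rightarrow> bool" where
  "least_approx x f \<longleftrightarrow> f \<in> M \<and> approx f \<and> (\<exists>u\<in>M. kpair x u \<in> elts f) \<and>
     (\<forall>f'\<in>M. approx f' \<and> (\<exists>u\<in>M. kpair x u \<in> elts f') \<longrightarrow> elts f \<subseteq> elts f')"

lemma d' [dfi]: "dft t \<Longrightarrow> dft (\<lambda>e. d (t e))"
  by (rule dft_sub1[OF d])

lemma H' [dfi]: "dft s \<Longrightarrow> dft t \<Longrightarrow> dft (\<lambda>e. H (s e) (t e))"
  by (rule dft_sub2[OF H])

lemma dfp_approx [dfi]: "dft t \<Longrightarrow> dfp (\<lambda>e. approx (t e))"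
proof (rule dfp_sub1)
  show "dfp (\<lambda>e. approx (e 0))"
    unfolding approx_def by (intro dfi)
qed

lemma dfp_least_approx [dfi]: "dft s \<Longrightarrow> dft t \<Longrightarrow> dfp (\<lambda>e. least_approx (s e) (t e))"
proof (rule dfp_sub2[where Q = least_approx])
  show "dfp (\<lambda>e. least_approx (e 0) (e 1))"
  proof -
    have "dfp (\<lambda>e. approx (e (Suc 0)) \<and> (\<exists>u\<in>M. kpair (e 0) u \<in> elts (e (Suc 0))) \<and>
       (\<forall>f'\<in>M. approx f' \<and> (\<exists>u\<in>M. kpair (e 0) u \<in> elts f') \<longrightarrow> elts (e (Suc 0)) \<subseteq> elts f'))"
      by (intro dfi)
    then show ?thesis
      by (rule dfp_cong[THEN iffD1, rotated]) (auto simp: least_approx_def)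
  qed
qed

text \<open>Induction along \<open>d\<close>: the pairs in \<open>g\<close> carry correct values,
  and since \<open>g\<close> covers \<open>d x\<close> it is the true graph of \<open>V\<close>
  there, from which \<open>H\<close> computes \<open>V x\<close>.\<close>

lemma approx_dest:
  assumes "f \<in> M" "approx f" "kpair x y \<in> elts f"
  shows "y = V x \<and> elts (graph_on x) \<subseteq> elts f"
  using assms(3)
proof (induction x arbitrary: y rule: wf_induct_rule[OF wf])
  case (1 x)
  obtain g where g: "elts g \<subseteq> elts f" "\<forall>w\<in>elts g. \<exists>y\<in>elts (d x). \<exists>u\<in>M. w = kpair y u"
    "\<forall>y\<in>elts (d x). \<exists>u\<in>M. kpair y u \<in> elts g" "y = H x g"
    using assms(2)[unfolded approx_def, rule_format, OF 1(2)] unfolding kpair_inject by blast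
  have "w = V v" if "v \<in> elts (d x)" "kpair v w \<in> elts g" for v w
    using 1(1)[of v w] that g(1) by blast
  then have "elts g \<subseteq> elts (graph_on x)" "elts (graph_on x) \<subseteq> elts g"
  proof -
    assume *: "\<And>v w. v \<in> elts (d x) \<Longrightarrow> kpair v w \<in> elts g \<Longrightarrow> w = V v"
    show "elts g \<subseteq> elts (graph_on x)"
    proof
      fix w assume w: "w \<in> elts g"
      then obtain y u where y: "y \<in> elts (d x)" "w = kpair y u" using g(2) by blast
      then have "u = V y" using * w by blast
      then show "w \<in> elts (graph_on x)" using y unfolding elts_graph_on by blast
    qed
    show "elts (graph_on x) \<subseteq> elts g"
    proof
      fix w assume "w \<in> elts (graph_on x)"
      then obtain y where y: "y \<in> elts (d x)" "w = kpair y (V y)" unfolding elts_graph_on by blast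
      then obtain u where "kpair y u \<in> elts g" using g(3) by blast
      then show "w \<in> elts g" using y *[of y u] by blast
    qed
  qed
  then have "g = graph_on x" by (intro hc_ext equalityI)
  with g(4) have "y = V x" by (simp only: V[of x, symmetric])
  then show ?case using g(1) \<open>g = graph_on x\<close> by blast
qed

definition clo :: "hc \<Rightarrow> hc set" where
  "clo x = {y. (y, x) \<in> {(y, x). y \<in> elts (d x)}\<^sup>*}"

lemma clo_unfold: "clo x = insert x (\<Union>y\<in>elts (d x). clo y)"
  unfolding clo_def by (auto elim: rtranclE intro: rtrancl.rtrancl_into_rtrancl)

lemma clo_d: "y \<in> clo x \<Longrightarrow> elts (d y) \<subseteq> clo x"
  unfolding clo_def by (auto intro: converse_rtrancl_into_rtrancl)

lemma countable_clo: "countable (clo x)"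
proof (induction x rule: wf_induct_rule[OF wf])
  case (1 x)
  then show ?case by (subst clo_unfold) (auto simp: countable_elts)
qed

definition full :: "hc \<Rightarrow> hc" where
  "full x = hset ((\<lambda>y. kpair y (V y)) ` clo x)"

lemma elts_full: "elts (full x) = (\<lambda>y. kpair y (V y)) ` clo x"
  by (simp add: full_def elts_hset countable_clo)

lemma approx_full: "x \<in> M \<Longrightarrow> full x \<in> M \<Longrightarrow> approx (full x)"
  unfolding approx_def
proof
  fix z assume x: "x \<in> M" and f: "full x \<in> M" and z: "z \<in> elts (full x)"
  then obtain y where y: "y \<in> clo x" "z = kpair y (V y)" by (auto simp: elts_full)
  have zM: "z \<in> M" using trans_M[OF f z] .
  then have yM: "y \<in> M" using y by simp
  have "dft (\<lambda>e. hset {z \<in> elts (e 0). \<exists>v\<in>elts (d (e (Suc 0))). \<exists>u\<in>M. z = kpair v u})"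
    by (intro dfi)
  then have "hset {z \<in> elts (full x). \<exists>v\<in>elts (d y). \<exists>u\<in>M. z = kpair v u} \<in> M"
    by (rule dft_comp2[OF _ f yM])
  moreover have "{z \<in> elts (full x). \<exists>v\<in>elts (d y). \<exists>u\<in>M. z = kpair v u} = elts (graph_on y)"
    unfolding elts_graph_on elts_full
  proof (intro equalityI subsetI)
    fix z assume "z \<in> (\<lambda>y. kpair y (V y)) ` elts (d y)"
    then obtain v where v: "v \<in> elts (d y)" "z = kpair v (V v)" by blast
    then have vc: "v \<in> clo x" using clo_d[OF y(1)] by blast
    then have "kpair v (V v) \<in> elts (full x)" unfolding elts_full by blast
    then have "V v \<in> M" using trans_M[OF f] kpair_M by blast
    then show "z \<in> {z \<in> (\<lambda>y. kpair y (V y)) ` clo x. \<exists>v\<in>elts (d y). \<exists>u\<in>M. z = kpair v u}"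
      using v vc by blast
  qed (auto simp: kpair_inject)
  ultimately have G: "graph_on y \<in> M" by (simp only: hset_elts)
  have G1: "elts (graph_on y) \<subseteq> elts (full x)"
    using clo_d[OF y(1)] unfolding elts_graph_on elts_full by blast
  have "V v \<in> M" if "v \<in> elts (d y)" for v
  proof -
    have "kpair v (V v) \<in> elts (graph_on y)" using that unfolding elts_graph_on by blast
    then show ?thesis using trans_M[OF G] kpair_M by blast
  qed
  then have G2: "\<forall>w\<in>elts (graph_on y). \<exists>v\<in>elts (d y). \<exists>u\<in>M. w = kpair v u"
    "\<forall>v\<in>elts (d y). \<exists>u\<in>M. kpair v u \<in> elts (graph_on y)"
    unfolding elts_graph_on by blast+
  have "z = kpair y (H y (graph_on y))" unfolding y(2) by (simp only: V[of y, symmetric])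
  then show "\<exists>x'\<in>M. \<exists>g\<in>M. elts g \<subseteq> elts (full x) \<and>
     (\<forall>w\<in>elts g. \<exists>y\<in>elts (d x'). \<exists>u\<in>M. w = kpair y u) \<and>
     (\<forall>y\<in>elts (d x'). \<exists>u\<in>M. kpair y u \<in> elts g) \<and> z = kpair x' (H x' g)"
    by (intro bexI[of _ y] bexI[of _ "graph_on y"] conjI G1 G2 yM G)
qed

lemma least_approx_full:
  assumes x: "x \<in> M" and f: "full x \<in> M"
  shows "least_approx x (full x)"
  unfolding least_approx_def
proof (intro conjI ballI impI)
  have x0: "kpair x (V x) \<in> elts (full x)"
    by (auto simp: elts_full clo_def)
  then have "V x \<in> M" using trans_M[OF f x0] by simp
  with x0 show "\<exists>u\<in>M. kpair x u \<in> elts (full x)" by blast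
next
  fix f' assume f': "f' \<in> M" "approx f' \<and> (\<exists>u\<in>M. kpair x u \<in> elts f')"
  then obtain u where u: "kpair x u \<in> elts f'" and ap: "approx f'" by blast
  have "kpair y (V y) \<in> elts f'" if "(y, x) \<in> {(y, x). y \<in> elts (d x)}\<^sup>*" for y
    using that
  proof (induction rule: converse_rtrancl_induct)
    case base
    then show ?case using approx_dest[OF f'(1) ap u] u by simp
  next
    case (step y z)
    then have "elts (graph_on z) \<subseteq> elts f'" using approx_dest[OF f'(1) ap] by blast
    then show ?case using step(1) by (auto simp: elts_graph_on)
  qed
  then show "elts (full x) \<subseteq> elts f'" by (auto simp: elts_full clo_def)
qed (use approx_full assms in blast)+

definition tot :: "hc \<Rightarrow> hc" where
  "tot x = (if \<exists>f\<in>M. least_approx x f then (THE f. least_approx x f) else hempty)"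

lemma least_approx_unique: "least_approx x f \<Longrightarrow> least_approx x f' \<Longrightarrow> f = f'"
  by (intro hc_ext subset_antisym) (auto simp: least_approx_def)

lemma tot_eq: "f \<in> M \<Longrightarrow> least_approx x f \<Longrightarrow> tot x = f"
proof -
  assume f: "f \<in> M" "least_approx x f"
  have "(THE f. least_approx x f) = f"
    by (rule the_equality[where P = "least_approx x", OF f(2)]) (rule least_approx_unique[OF _ f(2)])
  moreover have "\<exists>f\<in>M. least_approx x f" using f by blast
  ultimately show ?thesis unfolding tot_def by (simp only: if_True)
qed

lemma dft_tot: "dft (\<lambda>e. tot (e 0))"
  unfolding tot_def
proof (rule dft_THE)
  show "dfp (\<lambda>e. least_approx (e (Suc 0)) (e 0))" by (intro dfi)
qed (rule least_approx_unique)

text \<open>Induction along \<open>d\<close>. The graphs belonging to the elements of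
  \<open>d x\<close> are united by replacement, which yields the graph of \<open>V\<close> on
  \<open>d x\<close> as an element of M; applying \<open>H\<close> once more adds
  \<open>x\<close>.\<close>

lemma full_M: "x \<in> M \<Longrightarrow> full x \<in> M \<and> V x \<in> M"
proof (induction x rule: wf_induct_rule[OF wf])
  case (1 x)
  have dx: "d x \<in> M" using dft_comp[OF d 1(2)] .
  \<comment> \<open>Replacement needs a definable function. \<open>full\<close> is not known to be
    one at this point, but \<open>tot\<close> is, and the induction hypothesis makes them agree on
    \<open>d x\<close>.\<close>
  have IH: "tot y = full y" if "y \<in> elts (d x)" for y
    using 1(1)[of y] that trans_M[OF dx that] least_approx_full tot_eq by blast
  define f' where "f' = hset (\<Union>y\<in>elts (d x). elts (tot y))"
  have "dft (\<lambda>e. hset (\<Union>y\<in>elts (e 0). elts (tot y)))"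
    by (intro dfi dft_sub1[OF dft_tot])
  then have f'M: "f' \<in> M" unfolding f'_def
    by (rule dft_comp[where F = "\<lambda>a. hset (\<Union>y\<in>elts a. elts (tot y))", OF _ dx])
  have f': "elts f' = (\<Union>y\<in>elts (d x). elts (full y))"
    using IH by (simp add: f'_def elts_hset countable_elts)
  have VM: "V y \<in> M" if "y \<in> elts (d x)" for y
    using 1(1)[of y] that trans_M[OF dx that] by blast
  have "dft (\<lambda>e. hset {z \<in> elts (e 0). \<exists>v\<in>elts (e (Suc 0)). \<exists>u\<in>M. z = kpair v u})"
    by (intro dfi)
  then have "hset {z \<in> elts f'. \<exists>v\<in>elts (d x). \<exists>u\<in>M. z = kpair v u} \<in> M"
    by (rule dft_comp2[OF _ f'M dx])
  moreover have "{z \<in> elts f'. \<exists>v\<in>elts (d x). \<exists>u\<in>M. z = kpair v u} = elts (graph_on x)"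
  proof (intro equalityI subsetI)
    fix z assume "z \<in> elts (graph_on x)"
    then obtain v where v: "v \<in> elts (d x)" "z = kpair v (V v)" by (auto simp: elts_graph_on)
    moreover have "v \<in> clo v" unfolding clo_def by blast
    ultimately show "z \<in> {z \<in> elts f'. \<exists>v\<in>elts (d x). \<exists>u\<in>M. z = kpair v u}"
      using VM unfolding f' elts_full by blast
  qed (auto simp: f' elts_full elts_graph_on kpair_inject)
  ultimately have G: "graph_on x \<in> M" by (simp add: hset_elts)
  have VxM: "V x \<in> M"
    by (subst V, rule dft_comp2[OF H[unfolded One_nat_def] 1(2) G])
  have "full x = hset (insert (kpair x (V x)) (elts f'))"
    unfolding full_def by (subst clo_unfold) (simp add: f' elts_full image_UN)
  also have "\<dots> \<in> M"
    by (rule dft_comp2[where F = "\<lambda>a b. hset (insert a (elts b))", OF dft_insert[OF dft_var dft_var]])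
      (use f'M VxM 1(2) in simp_all)
  finally show ?case using VxM by simp
qed

text \<open>The graph of \<open>V\<close> is read off from \<open>tot\<close>, which on M coincides
  with \<open>full\<close>.\<close>

lemma dft_rec: "dft s \<Longrightarrow> dft (\<lambda>e. V (s e))"
proof (rule dft_sub1[where F = V])
  have *: "tot x = full x" if "x \<in> M" for x
    using full_M[OF that] least_approx_full[OF that] tot_eq by blast
  have "dfp (\<lambda>e. kpair (e 1) (e 0) \<in> elts (tot (e 1)))"
    by (intro dfi dft_sub1[OF dft_tot])
  then have "dfp (\<lambda>e. kpair (e (Suc 0)) (e 0) \<in> elts (tot (e (Suc 0))))" by simp
  then show "dft (\<lambda>e. V (e 0))"
  proof (rule dft_unique[where P = "\<lambda>y e. kpair (e 0) y \<in> elts (tot (e 0))"])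
    fix e :: "nat \<Rightarrow> hc" and y assume e: "range e \<subseteq> M"
    then have e0: "e 0 \<in> M" by auto
    then show "V (e 0) \<in> M" using full_M by blast
    show "kpair (e 0) y \<in> elts (tot (e 0)) \<longleftrightarrow> y = V (e 0)"
      unfolding *[OF e0] elts_full by (auto simp: kpair_inject clo_def)
  qed
qed

end

context ctm
begin

text \<open>The levels of the cumulative hierarchy of \<open>M\<close>, indexed by sets instead of ordinals.\<close>

function lvl :: "hc \<Rightarrow> hc" where
  "lvl x = hset (\<Union>y\<in>elts x. {u \<in> M. elts u \<subseteq> elts (lvl y)})"
  by pat_completeness auto
termination
  by (relation mem_rel) (rule wf_mem_rel, simp add: mem_rel_def)

declare lvl.simps [simp del]

lemma elts_lvl: "elts (lvl x) = (\<Union>y\<in>elts x. {u \<in> M. elts u \<subseteq> elts (lvl y)})"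
  by (subst lvl.simps) (auto intro!: elts_hset countable_in_M)

lemma dft_lvl [dfi]: "dft s \<Longrightarrow> dft (\<lambda>e. lvl (s e))"
proof -
  interpret wf_rec M "\<lambda>x. x" "\<lambda>x g. hset (\<Union>w\<in>elts g. elts (hset {u \<in> M. elts u \<subseteq> elts (hsnd w)}))" lvl
  proof
    show "wf {(y, x). y \<in> elts x}" by (rule wf_elts)
    fix x
    show "lvl x = hset (\<Union>w\<in>elts (hset ((\<lambda>y. kpair y (lvl y)) ` elts x)).
        elts (hset {u \<in> M. elts u \<subseteq> elts (hsnd w)}))"
      by (subst lvl.simps) (simp add: elts_hset countable_elts countable_in_M)
  qed (intro dfi)+
  show "dft s \<Longrightarrow> dft (\<lambda>e. lvl (s e))" by (rule dft_rec)
qed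

text \<open>This takes the place of the linear order of ranks. The second alternative passes to an
  element of the index \<open>a\<close>, so an index that is minimal for membership gives a least
  level.\<close>

lemma lvl_linear: "elts (lvl a) \<subseteq> elts (lvl b) \<or> (\<exists>c\<in>elts a. elts (lvl b) \<subseteq> elts (lvl c))"
proof (induction a arbitrary: b rule: hc_induct)
  case (1 a)
  show ?case
  proof (rule ccontr)
    assume neg: "\<not> ?case"
    then obtain x where x: "x \<in> elts (lvl a)" "x \<notin> elts (lvl b)" by blast
    then obtain c where c: "c \<in> elts a" "x \<in> M" "elts x \<subseteq> elts (lvl c)" by (auto simp: elts_lvl[of a])
    then obtain y where y: "y \<in> elts (lvl b)" "y \<notin> elts (lvl c)" using neg by blast
    then obtain b' where b': "b' \<in> elts b" "y \<in> M" "elts y \<subseteq> elts (lvl b')" by (auto simp: elts_lvl[of b])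
    have "\<not> elts (lvl c) \<subseteq> elts (lvl b')" using x c b' by (auto simp: elts_lvl[of b])
    then obtain c' where c': "c' \<in> elts c" "elts (lvl b') \<subseteq> elts (lvl c')" using 1[OF c(1), of b'] by blast
    then have "y \<in> elts (lvl c)" using b' by (auto simp: elts_lvl[of c])
    then show False using y by simp
  qed
qed

lemma subset_lvl: "x \<in> M \<Longrightarrow> elts x \<subseteq> elts (lvl x)"
proof (induction x rule: hc_induct)
  case (1 x)
  show ?case
  proof
    fix y assume y: "y \<in> elts x"
    then have "y \<in> M" using trans_M 1(2) by blast
    then show "y \<in> elts (lvl x)" using y 1(1) unfolding elts_lvl[of x] by blast
  qed
qed

text \<open>Scott's trick: a relation need not be functional, but the least level that contains a
  witness is a function of \<open>x\<close>, and replacement applies to it.\<close>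

lemma collection:
  assumes P: "dfp (\<lambda>e. P (e 0) (e 1))" and a: "a \<in> M"
    and ex: "\<And>x. x \<in> elts a \<Longrightarrow> \<exists>y\<in>M. P x y"
  shows "\<exists>b\<in>M. \<forall>x\<in>elts a. \<exists>y\<in>elts b. P x y"
proof -
  have P' [dfi]: "dft s \<Longrightarrow> dft t \<Longrightarrow> dfp (\<lambda>e. P (s e) (t e))" for s t
    by (rule dfp_sub2[OF P])
  define T where "T x L \<longleftrightarrow> (\<exists>w\<in>M. L = lvl w) \<and> (\<exists>y\<in>elts L. P x y) \<and>
    (\<forall>w\<in>M. (\<exists>y\<in>elts (lvl w). P x y) \<longrightarrow> elts L \<subseteq> elts (lvl w))" for x L
  have uniq: "L = L'" if "T x L" "T x L'" for x L L'
    by (rule hc_ext, rule subset_antisym) (use that in \<open>unfold T_def, blast\<close>)+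
  define F where "F x = (if \<exists>L\<in>M. T x L then (THE L. T x L) else hempty)" for x
  have F_eq: "F x = L" if "L \<in> M" "T x L" for x L
  proof -
    have "(THE L. T x L) = L" by (rule the_equality[where P = "T x", OF that(2)]) (rule uniq[OF _ that(2)])
    moreover have "\<exists>L\<in>M. T x L" using that by blast
    ultimately show ?thesis unfolding F_def by (simp only: if_True)
  qed
  have "dft (\<lambda>e. F (e 0))"
    unfolding F_def
  proof (rule dft_THE)
    show "dfp (\<lambda>e. T (e (Suc 0)) (e 0))" unfolding T_def by (intro dfi)
  qed (rule uniq)
  then have "dft (\<lambda>e. hset (\<Union>x\<in>elts (e 0). elts (F x)))"
    by (intro dft_UN dft_var)
  then have b: "hset (\<Union>x\<in>elts a. elts (F x)) \<in> M"
    by (rule dft_comp[where F = "\<lambda>a. hset (\<Union>x\<in>elts a. elts (F x))", OF _ a])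
  have "\<exists>y\<in>elts (F x). P x y" if x: "x \<in> elts a" for x
  proof -
    obtain y where y: "y \<in> M" "P x y" using ex[OF x] by blast
    \<comment> \<open>A set is included in its own level, so the index \<open>hset {y}\<close> shows
      that some level contains a witness; a membership-minimal index of this kind gives the least
      such level.\<close>
    have sM: "hset {y} \<in> M" using finite_M[of "{y}"] y by simp
    have "y \<in> elts (lvl (hset {y}))" using subset_lvl[OF sM] by (simp add: elts_hset)
    then have "hset {y} \<in> {w \<in> M. \<exists>y\<in>elts (lvl w). P x y}" using sM y by blast
    from wfE_min[OF wf_mem_rel this] obtain w
      where w: "w \<in> {w \<in> M. \<exists>y\<in>elts (lvl w). P x y}"
        and m: "\<And>w'. (w', w) \<in> mem_rel \<Longrightarrow> w' \<notin> {w \<in> M. \<exists>y\<in>elts (lvl w). P x y}"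
      by blast
    have w: "w \<in> M" "\<exists>y\<in>elts (lvl w). P x y" using w by blast+
    have min: "\<not> (\<exists>y\<in>elts (lvl w'). P x y)" if "w' \<in> elts w" for w'
      using m[of w'] that trans_M[OF w(1) that] unfolding mem_rel_def by blast
    have "T x (lvl w)"
      unfolding T_def
    proof (intro conjI ballI impI)
      fix w' assume w': "w' \<in> M" "\<exists>y\<in>elts (lvl w'). P x y"
      show "elts (lvl w) \<subseteq> elts (lvl w')"
        using lvl_linear[of w w'] min w'(2) by blast
    qed (use w in auto)
    moreover have "lvl w \<in> M" by (rule dft_comp[where F = lvl, OF dft_lvl[OF dft_var] w(1)])
    ultimately have "F x = lvl w" by (intro F_eq)
    then show ?thesis using w(2) by (simp only:)
  qed
  moreover have "elts (hset (\<Union>x\<in>elts a. elts (F x))) = (\<Union>x\<in>elts a. elts (F x))"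
    by (intro elts_hset) (auto simp: countable_elts)
  ultimately have "\<forall>x\<in>elts a. \<exists>y\<in>elts (hset (\<Union>x\<in>elts a. elts (F x))). P x y"
    by (simp only:) blast
  then show ?thesis using b by blast
qed

text \<open>Countable choice inside M for a definable relation. Collection bounds the witnesses by a
  set \<open>b\<close>, and a transversal of the sets of tagged witnesses is, after restriction, the
  graph of a choice sequence.\<close>

lemma model_choice:
  fixes P :: "nat \<Rightarrow> hc \<Rightarrow> bool"
  assumes P: "dfp (\<lambda>e. P (unnum (e 0)) (e 1))" and ex: "\<And>n. \<exists>y\<in>M. P n y"
  shows "\<exists>h. (\<forall>n. P n (h n)) \<and> seqc h \<in> M"
proof -
  have P' [dfi]: "dft s \<Longrightarrow> dft t \<Longrightarrow> dfp (\<lambda>e. P (unnum (s e)) (t e))" for s t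
    by (rule dfp_sub2[OF P])
  obtain b where b: "b \<in> M" "\<And>n. \<exists>y\<in>elts b. P n y"
    using collection[OF P omega_M] ex by (auto simp: unnum_num)
  \<comment> \<open>Tagging every witness with its index makes the sets for different indices
    disjoint, as the axiom of choice requires.\<close>
  define A where "A x = hset ((\<lambda>y. kpair x y) ` elts (hset {y \<in> elts b. P (unnum x) y}))" for x
  have dA: "dft (\<lambda>e. A (e 0))" unfolding A_def by (intro dfi b)
  have eA: "elts (A x) = {kpair x y | y. y \<in> elts b \<and> P (unnum x) y}" for x
    unfolding A_def by (auto simp: elts_hset countable_elts)
  have "dft (\<lambda>e. hset (A ` elts omega))" by (intro dft_image dA dft_const omega_M)
  then have aM: "hset (A ` elts omega) \<in> M"
    using dft_M[of "\<lambda>_. hset (A ` elts omega)" "\<lambda>_. omega"] omega_M by auto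
  have ea: "elts (hset (A ` elts omega)) = A ` elts omega"
    by (simp add: elts_hset)
  have "\<exists>c\<in>M. \<forall>x\<in>elts (hset (A ` elts omega)). \<exists>!z. z \<in> elts x \<and> z \<in> elts c"
  proof (rule transversal[OF aM], unfold ea)
    fix x assume "x \<in> A ` elts omega"
    then obtain n where "x = A (num n)" by auto
    then show "elts x \<noteq> {}" using b(2)[of n] by (auto simp: eA)
  next
    fix x y z assume "x \<in> A ` elts omega" "y \<in> A ` elts omega" "z \<in> elts x" "z \<in> elts y"
    then show "x = y" by (auto simp: eA kpair_inject)
  qed
  then obtain c where c: "c \<in> M" "\<And>n. \<exists>!z. z \<in> elts (A (num n)) \<and> z \<in> elts c"
    unfolding ea by auto
  have Q: "\<exists>!y. y \<in> elts b \<and> P n y \<and> kpair (num n) y \<in> elts c" for n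
  proof -
    obtain z where z: "z \<in> elts (A (num n))" "z \<in> elts c"
      "\<And>z'. z' \<in> elts (A (num n)) \<and> z' \<in> elts c \<Longrightarrow> z' = z"
      using c(2)[of n] by (elim ex1E) blast
    then obtain y where y: "z = kpair (num n) y" "y \<in> elts b" "P n y"
      unfolding eA unnum_num by blast
    show ?thesis
    proof (rule ex1I[of _ y])
      fix y' assume "y' \<in> elts b \<and> P n y' \<and> kpair (num n) y' \<in> elts c"
      then have "kpair (num n) y' = z" 
        unfolding eA unnum_num by (intro z(3)[unfolded eA unnum_num]) blast
      then show "y' = y" unfolding y(1) kpair_inject by blast
    qed (use y z(2) in blast)
  qed
  define h where "h n = (THE y. y \<in> elts b \<and> P n y \<and> kpair (num n) y \<in> elts c)" for n
  have h: "h n \<in> elts b \<and> P n (h n) \<and> kpair (num n) (h n) \<in> elts c" for n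
    unfolding h_def by (rule theI'[OF Q])
  have hu: "y = h n" if "y \<in> elts b \<and> P n y \<and> kpair (num n) y \<in> elts c" for n y
    unfolding h_def by (rule the1_equality[OF Q that, symmetric])
  have "{z \<in> elts c. \<exists>x\<in>elts omega. \<exists>y\<in>elts b. z = kpair x y \<and> P (unnum x) y} =
      range (\<lambda>n. kpair (num n) (h n))"
  proof (intro equalityI subsetI)
    fix z assume "z \<in> {z \<in> elts c. \<exists>x\<in>elts omega. \<exists>y\<in>elts b. z = kpair x y \<and> P (unnum x) y}"
    then obtain n y where *: "z \<in> elts c" "y \<in> elts b" "z = kpair (num n) y" "P n y" by auto
    then have "y = h n" using hu[of y n] by blast
    then show "z \<in> range (\<lambda>n. kpair (num n) (h n))" using *(3) by blast
  next
    fix z assume "z \<in> range (\<lambda>n. kpair (num n) (h n))"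
    then obtain n where n: "z = kpair (num n) (h n)" by blast
    then show "z \<in> {z \<in> elts c. \<exists>x\<in>elts omega. \<exists>y\<in>elts b. z = kpair x y \<and> P (unnum x) y}"
      using h[of n] by (auto intro!: bexI[of _ "h n"])
  qed
  then have "seqc h = hset {z \<in> elts c. \<exists>x\<in>elts omega. \<exists>y\<in>elts b. z = kpair x y \<and> P (unnum x) y}"
    by (simp only: seqc_def)
  also have "\<dots> \<in> M"
  proof -
    have "dft (\<lambda>e. hset {z \<in> elts (e 0). \<exists>x\<in>elts omega. \<exists>y\<in>elts b. z = kpair x y \<and> P (unnum x) y})"
      by (intro dfi b)
    from dft_comp[OF this c(1)] show ?thesis .
  qed
  finally show ?thesis using h by blast
qed

end

section \<open>Reals and sequences in the model\<close>

lemma num_of_bool_inject [simp]: "num_of_bool b = num_of_bool c \<longleftrightarrow> b = c"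
  by (auto simp: num_of_bool_def)

lemma elts_string_code:
  "elts (string_code s) = (\<lambda>i. kpair (num i) (num_of_bool (s ! i))) ` {..<length s}"
proof -
  have "{kpair (num i) (num_of_bool (s ! i)) | i. i < length s} =
      (\<lambda>i. kpair (num i) (num_of_bool (s ! i))) ` {..<length s}" by auto
  then show ?thesis unfolding string_code_def by (simp add: elts_hset countable_finite)
qed

lemma kpair_string_code:
  "kpair (num i) (num_of_bool b) \<in> elts (string_code s) \<longleftrightarrow> i < length s \<and> s ! i = b"
  by (auto simp: elts_string_code kpair_inject)

lemma string_code_subset:
  "elts (string_code s) \<subseteq> elts (string_code t) \<longleftrightarrow>
    length s \<le> length t \<and> (\<forall>i<length s. s ! i = t ! i)"
proof
  assume sub: "elts (string_code s) \<subseteq> elts (string_code t)"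
  have *: "i < length t \<and> t ! i = s ! i" if "i < length s" for i
    using sub that kpair_string_code[of i "s ! i" s] kpair_string_code[of i "s ! i" t] by auto
  have "length s \<le> length t"
    using *[of "length t"] by (cases "length t < length s") auto
  then show "length s \<le> length t \<and> (\<forall>i<length s. s ! i = t ! i)"
    using * by simp
qed (auto simp: elts_string_code)

lemma string_code_inject [simp]: "string_code s = string_code t \<longleftrightarrow> s = t"
proof
  assume eq: "string_code s = string_code t"
  have "elts (string_code s) \<subseteq> elts (string_code t)" "elts (string_code t) \<subseteq> elts (string_code s)"
    unfolding eq by (rule subset_refl)+
  then show "s = t" unfolding string_code_subset
    by (intro nth_equalityI) (blast intro: le_antisym)+
qed simp

lemma real_code_seqc: "real_code x = seqc (\<lambda>n. num_of_bool (x n))"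
  unfolding real_code_def seqc_def by (rule arg_cong[where f = hset]) auto

lemma kpair_real_code [simp]:
  "kpair (num n) (num_of_bool b) \<in> elts (real_code x) \<longleftrightarrow> x n = b"
  by (auto simp: real_code_seqc elts_seqc kpair_inject)

lemma real_code_inject [simp]: "real_code x = real_code y \<longleftrightarrow> x = y"
  by (auto simp: real_code_seqc fun_eq_iff)

lemma cylinder_iff: "x \<in> cylinder s \<longleftrightarrow> elts (string_code s) \<subseteq> elts (real_code x)"
  by (auto simp: cylinder_def elts_string_code image_subset_iff)

definition unstring :: "hc \<Rightarrow> bool list" where
  "unstring y = (if y \<in> range string_code then inv_into UNIV string_code y else [])"

lemma unstring_string_code [simp]: "unstring (string_code s) = s"
  by (simp add: unstring_def inj_def)

definition unreal :: "hc \<Rightarrow> nat \<Rightarrow> bool" where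
  "unreal y = (\<lambda>n. kpair (num n) (num_of_bool True) \<in> elts y)"

lemma unreal_real_code [simp]: "unreal (real_code x) = x"
  by (simp add: unreal_def)

definition unset :: "hc \<Rightarrow> (nat \<Rightarrow> bool) set" where
  "unset y = {x. real_code x \<in> elts y}"

lemma elts_set_code: "countable X \<Longrightarrow> elts (set_code X) = real_code ` X"
  by (simp add: set_code_def elts_hset)

lemma unset_set_code [simp]: "countable X \<Longrightarrow> unset (set_code X) = X"
  by (auto simp: unset_def elts_set_code)

definition unseq :: "hc \<Rightarrow> nat \<Rightarrow> bool list" where
  "unseq y = (\<lambda>n. unstring (app y (num n)))"

definition unsets :: "hc \<Rightarrow> nat \<Rightarrow> (nat \<Rightarrow> bool) set" where
  "unsets y = (\<lambda>n. unset (app y (num n)))"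

abbreviation strings_code :: "(nat \<Rightarrow> bool list) \<Rightarrow> hc" where
  "strings_code s \<equiv> seqc (\<lambda>n. string_code (s n))"

abbreviation sets_code :: "(nat \<Rightarrow> (nat \<Rightarrow> bool) set) \<Rightarrow> hc" where
  "sets_code f \<equiv> seqc (\<lambda>n. set_code (f n))"

lemma unseq_strings_code [simp]: "unseq (strings_code s) = s"
  by (simp add: unseq_def)

lemma prod_encode_alt: "prod_encode (i, j) = triangle (i + j) + i"
  by (simp add: prod_encode_def)

context ctm
begin

lemma dft_numeral [dfi]: "dft (\<lambda>e. num 1)"
  by (intro dft_const num_M)+

lemma dft_add [dfi]:
  assumes "dft (\<lambda>e. num (f e))" "dft (\<lambda>e. num (g e))"
  shows "dft (\<lambda>e. num (f e + g e))"
proof -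
  have "num (a + b) = rec_nat (num a) (\<lambda>n y. hsuc y) b" for a b
    by (induction b) (simp_all add: num_Suc)
  then show ?thesis by (simp only:) (intro dft_rec_nat dfi assms)
qed

lemma dft_minus [dfi]:
  assumes "dft (\<lambda>e. num (f e))" "dft (\<lambda>e. num (g e))"
  shows "dft (\<lambda>e. num (f e - g e))"
proof -
  have pred: "num (a - 1) = rec_nat (num 0) (\<lambda>n y. num n) a" for a
    by (cases a) simp_all
  have "num (a - b) = rec_nat (num a) (\<lambda>n y. num (unnum y - 1)) b" for a b
  proof (induction b)
    case (Suc b)
    then show ?case by (simp only: old.nat.rec Suc[symmetric]) simp
  qed simp
  then show ?thesis by (simp only: pred) (intro dft_rec_nat dfi assms)
qed

lemma dft_pow2 [dfi]:
  assumes "dft (\<lambda>e. num (f e))"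
  shows "dft (\<lambda>e. num (2 ^ f e))"
proof -
  have "num (2 ^ b) = rec_nat (num 1) (\<lambda>n y. num (unnum y + unnum y)) b" for b
  proof (induction b)
    case (Suc b)
    then show ?case by (simp only: old.nat.rec Suc[symmetric]) simp
  qed simp
  then show ?thesis by (simp only:) (intro dft_rec_nat dfi assms)
qed

lemma dft_triangle [dfi]:
  assumes "dft (\<lambda>e. num (f e))"
  shows "dft (\<lambda>e. num (triangle (f e)))"
proof -
  have "num (triangle b) = rec_nat (num 0) (\<lambda>n y. num (unnum y + Suc n)) b" for b
  proof (induction b)
    case (Suc b)
    then show ?case by (simp only: old.nat.rec Suc[symmetric]) simp
  qed simp
  then show ?thesis by (simp only:) (intro dft_rec_nat dfi assms)
qed

lemma dft_prod_encode [dfi]: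
  "dft (\<lambda>e. num (f e)) \<Longrightarrow> dft (\<lambda>e. num (g e)) \<Longrightarrow> dft (\<lambda>e. num (prod_encode (f e, g e)))"
  unfolding prod_encode_alt by (intro dfi)

text \<open>A numeral is the set of the smaller ones, so each component of the decoded pair can be
  separated from \<open>omega\<close> with the help of the encoding, whose definability is already
  known.\<close>

lemma dft_prod_decode [dfi]:
  assumes "dft (\<lambda>e. num (f e))"
  shows "dft (\<lambda>e. num (fst (prod_decode (f e))))" "dft (\<lambda>e. num (snd (prod_decode (f e))))"
proof -
  have 1: "num (fst (prod_decode k)) = hset {x \<in> elts omega. \<exists>i j. prod_encode (i, j) = k \<and> unnum x < i}" for k
  proof (rule hset_eqI)
    obtain i j where "prod_decode k = (i, j)" by fastforce
    then have "k = prod_encode (i, j)" by (metis prod_decode_inverse)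
    then show "elts (num (fst (prod_decode k))) = {x \<in> elts omega. \<exists>i j. prod_encode (i, j) = k \<and> unnum x < i}"
      by (auto simp: elts_num)
  qed simp
  show "dft (\<lambda>e. num (fst (prod_decode (f e))))" unfolding 1
    by (intro dfi dft_rename[OF assms])
  have 2: "num (snd (prod_decode k)) = hset {x \<in> elts omega. \<exists>i j. prod_encode (i, j) = k \<and> unnum x < j}" for k
  proof (rule hset_eqI)
    obtain i j where "prod_decode k = (i, j)" by fastforce
    then have "k = prod_encode (i, j)" by (metis prod_decode_inverse)
    then show "elts (num (snd (prod_decode k))) = {x \<in> elts omega. \<exists>i j. prod_encode (i, j) = k \<and> unnum x < j}"
      by (auto simp: elts_num)
  qed simp
  show "dft (\<lambda>e. num (snd (prod_decode (f e))))" unfolding 2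
    by (intro dfi dft_rename[OF assms])
qed

lemma dft_num_of_bool [dfi]: "dfp P \<Longrightarrow> dft (\<lambda>e. num_of_bool (P e))"
proof -
  assume P: "dfp P"
  have "num_of_bool b = (if b then num 1 else num 0)" for b by (simp add: num_of_bool_def)
  then show ?thesis by (simp only:) (intro dfi P)
qed

definition bits :: hc where
  "bits = hset (\<Union>x\<in>elts omega. elts (hset {kpair x (num_of_bool False), kpair x (num_of_bool True)}))"

lemma elts_bits: "elts bits = {kpair (num n) (num_of_bool b) | n b. True}"
proof -
  have "elts bits = (\<Union>x\<in>elts omega. {kpair x (num_of_bool False), kpair x (num_of_bool True)})"
    unfolding bits_def by (simp add: elts_hset countable_finite)
  also have "\<dots> = {kpair (num n) (num_of_bool b) | n b. True}"
    by auto (metis (full_types))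
  finally show ?thesis .
qed

lemma bits_M [dfi]: "bits \<in> M"
proof -
  have "dft (\<lambda>e. bits)" unfolding bits_def by (intro dfi)
  from dft_M[OF this, of "\<lambda>_. hempty"] show ?thesis using hempty_M by auto
qed

text \<open>The finite strings as those subsets of \<open>bits\<close> in M that are functions on an
  initial segment: one bit at each place below \<open>n\<close> and none from \<open>n\<close>
  on.\<close>

definition strs :: hc where
  "strs = hset {z \<in> elts (hset {z \<in> M. elts z \<subseteq> elts bits}). \<exists>n.
     (\<forall>i. i < n \<longrightarrow> (kpair (num i) (num_of_bool True) \<in> elts z \<longleftrightarrow> \<not> kpair (num i) (num_of_bool False) \<in> elts z)) \<and>
     (\<forall>i. (kpair (num i) (num_of_bool True) \<in> elts z \<or> kpair (num i) (num_of_bool False) \<in> elts z) \<longrightarrow> i < n)}"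

lemma string_code_M [dfi]: "string_code s \<in> M"
proof -
  have "string_code s = hset (elts (string_code s))" by (simp only: hset_elts)
  also have "\<dots> \<in> M" unfolding elts_string_code num_of_bool_def by (rule finite_M) (auto intro: num_M)
  finally show ?thesis .
qed

lemma elts_strs: "elts strs = range string_code"
proof -
  have 1: "elts (hset {z \<in> M. elts z \<subseteq> elts bits}) = {z \<in> M. elts z \<subseteq> elts bits}"
    by (intro elts_hset countable_in_M) auto
  have "elts strs = {z \<in> M. elts z \<subseteq> elts bits \<and> (\<exists>n.
     (\<forall>i. i < n \<longrightarrow> (kpair (num i) (num_of_bool True) \<in> elts z \<longleftrightarrow> \<not> kpair (num i) (num_of_bool False) \<in> elts z)) \<and>
     (\<forall>i. (kpair (num i) (num_of_bool True) \<in> elts z \<or> kpair (num i) (num_of_bool False) \<in> elts z) \<longrightarrow> i < n))}"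
    unfolding strs_def 1 by (subst elts_hset) (auto intro!: countable_in_M)
  also have "\<dots> = range string_code"
  proof (intro equalityI subsetI)
    fix z assume "z \<in> {z \<in> M. elts z \<subseteq> elts bits \<and> (\<exists>n.
     (\<forall>i. i < n \<longrightarrow> (kpair (num i) (num_of_bool True) \<in> elts z \<longleftrightarrow> \<not> kpair (num i) (num_of_bool False) \<in> elts z)) \<and>
     (\<forall>i. (kpair (num i) (num_of_bool True) \<in> elts z \<or> kpair (num i) (num_of_bool False) \<in> elts z) \<longrightarrow> i < n))}"
    then obtain n where z: "elts z \<subseteq> elts bits"
      "\<And>i. i < n \<Longrightarrow> kpair (num i) (num_of_bool True) \<in> elts z \<longleftrightarrow> \<not> kpair (num i) (num_of_bool False) \<in> elts z"
      "\<And>i. kpair (num i) (num_of_bool True) \<in> elts z \<or> kpair (num i) (num_of_bool False) \<in> elts z \<Longrightarrow> i < n"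
      by blast
    define s where "s = map (unreal z) [0..<n]"
    have "kpair (num i) (num_of_bool b) \<in> elts z \<longleftrightarrow> kpair (num i) (num_of_bool b) \<in> elts (string_code s)" for i b
      unfolding kpair_string_code s_def using z(2)[of i] z(3)[of i]
      by (cases b) (auto simp: unreal_def)
    moreover have "elts (string_code s) \<subseteq> elts bits" unfolding elts_bits elts_string_code by blast
    ultimately have "elts z = elts (string_code s)" using z(1) unfolding elts_bits by blast
    then show "z \<in> range string_code" using hc_ext by blast
  next
    fix z assume "z \<in> range string_code"
    then obtain s where z: "z = string_code s" by blast
    have "elts z \<subseteq> elts bits" unfolding elts_bits elts_string_code z by blast
    then show "z \<in> {z \<in> M. elts z \<subseteq> elts bits \<and> (\<exists>n.
     (\<forall>i. i < n \<longrightarrow> (kpair (num i) (num_of_bool True) \<in> elts z \<longleftrightarrow> \<not> kpair (num i) (num_of_bool False) \<in> elts z)) \<and>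
     (\<forall>i. (kpair (num i) (num_of_bool True) \<in> elts z \<or> kpair (num i) (num_of_bool False) \<in> elts z) \<longrightarrow> i < n))}"
      unfolding z by (auto simp: kpair_string_code string_code_M intro!: exI[of _ "length s"])
  qed
  finally show ?thesis .
qed

lemma strs_M [dfi]: "strs \<in> M"
proof -
  have "dft (\<lambda>e. strs)" unfolding strs_def by (intro dfi)
  from dft_M[OF this, of "\<lambda>_. hempty"] show ?thesis using hempty_M by auto
qed

lemma dft_string_unstring [dfi]:
  assumes t: "dft t" shows "dft (\<lambda>e. string_code (unstring (t e)))"
proof -
  have "string_code (unstring y) = (if y \<in> elts strs then y else string_code [])" for y
    by (cases "y \<in> range string_code") (auto simp: elts_strs, simp add: unstring_def)
  then show ?thesis by (simp only:) (intro dfi t)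
qed

lemma dfp_all_string [dfi]:
  assumes "dfp (\<lambda>e. P (unstring (e 0)) (\<lambda>i. e (Suc i)))"
  shows "dfp (\<lambda>e. \<forall>s. P s e)"
proof -
  have "dfp (\<lambda>e. \<forall>y\<in>M. P (unstring y) e)"
    using assms by (rule dfp_all)
  then show ?thesis
    by (rule dfp_cong[THEN iffD1, rotated]) (metis string_code_M unstring_string_code)
qed

lemma dft_length [dfi]:
  assumes "dft (\<lambda>e. string_code (s e))"
  shows "dft (\<lambda>e. num (length (s e)))"
proof -
  have "num (length s) = hset {x \<in> elts omega. \<exists>y\<in>M. kpair x y \<in> elts (string_code s)}" for s
  proof (rule hset_eqI)
    show "elts (num (length s)) = {x \<in> elts omega. \<exists>y\<in>M. kpair x y \<in> elts (string_code s)}"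
      by (auto simp: elts_num elts_string_code kpair_inject num_of_bool_def intro: num_M)
  qed simp
  then show ?thesis by (simp only:) (intro dfi dft_rename[OF assms])
qed

lemma dft_snoc [dfi]:
  assumes "dft (\<lambda>e. string_code (s e))" "dfp b"
  shows "dft (\<lambda>e. string_code (s e @ [b e]))"
proof -
  have "string_code (s @ [b]) =
      hset (insert (kpair (num (length s)) (num_of_bool b)) (elts (string_code s)))" for s b
  proof (rule hset_eqI)
    have "{..<length (s @ [b])} = insert (length s) {..<length s}" by auto
    then show "elts (string_code (s @ [b])) =
        insert (kpair (num (length s)) (num_of_bool b)) (elts (string_code s))"
      unfolding elts_string_code by (auto simp: nth_append)
  qed (simp add: countable_elts)
  then show ?thesis by (simp only:) (intro dfi assms)
qed

lemma dft_replicate [dfi]: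
  assumes "dft (\<lambda>e. num (n e))"
  shows "dft (\<lambda>e. string_code (replicate (n e) False))"
proof -
  have "string_code (replicate n False) = hset ((\<lambda>x. kpair x (num_of_bool False)) ` elts (num n))" for n
    by (rule hset_eqI) (auto simp: elts_string_code elts_num)
  then show ?thesis by (simp only:) (intro dfi assms)
qed

lemma dfp_unreal [dfi]:
  "dft t \<Longrightarrow> dft (\<lambda>e. num (n e)) \<Longrightarrow> dfp (\<lambda>e. unreal (t e) (n e))"
  unfolding unreal_def by (intro dfi)

lemma dft_real_code_unreal [dfi]: "dft t \<Longrightarrow> dft (\<lambda>e. real_code (unreal (t e)))"
  unfolding real_code_seqc by (intro dfi dft_shift)

lemma dfp_cylinder [dfi]:
  "dft (\<lambda>e. real_code (x e)) \<Longrightarrow> dft (\<lambda>e. string_code (s e)) \<Longrightarrow> dfp (\<lambda>e. x e \<in> cylinder (s e))"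
  unfolding cylinder_iff by (intro dfi)

lemma dft_unseq [dfi]:
  "dft t \<Longrightarrow> dft (\<lambda>e. num (n e)) \<Longrightarrow> dft (\<lambda>e. string_code (unseq (t e) (n e)))"
  unfolding unseq_def by (intro dfi)

lemma unreal_M: "y \<in> M \<Longrightarrow> unreal y \<in> cantor M"
  unfolding cantor_def mem_Collect_eq
  by (rule dft_comp[where F = "\<lambda>y. real_code (unreal y)", OF dft_real_code_unreal[OF dft_var]])

lemma unreal_cantor: "x \<in> cantor M \<Longrightarrow> \<exists>y\<in>M. unreal y = x"
  by (auto simp: cantor_def intro!: bexI[of _ "real_code x"])

lemma dfp_all_real [dfi]:
  assumes "dfp (\<lambda>e. P (unreal (e 0)) (\<lambda>i. e (Suc i)))"
  shows "dfp (\<lambda>e. \<forall>x\<in>cantor M. P x e)"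
proof -
  have "dfp (\<lambda>e. \<forall>y\<in>M. P (unreal y) e)"
    using assms by (rule dfp_all)
  then show ?thesis
    by (rule dfp_cong[THEN iffD1, rotated]) (metis unreal_M unreal_cantor)
qed

lemma countable_cantor: "countable (cantor M)"
proof -
  have "inj_on real_code (cantor M)" by (simp add: inj_on_def)
  moreover have "countable (real_code ` cantor M)"
    by (rule countable_in_M) (auto simp: cantor_def)
  ultimately show ?thesis using countable_image_inj_on by blast
qed

lemma countable_sub_cantor: "X \<subseteq> cantor M \<Longrightarrow> countable X"
  using countable_cantor countable_subset by blast

lemma set_code_cantor_M [dfi]: "set_code (cantor M) \<in> M"
proof -
  have "real_code ` cantor M = {z \<in> elts (hset {z \<in> M. elts z \<subseteq> elts bits}). z = real_code (unreal z)}"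
  proof -
    have "elts (hset {z \<in> M. elts z \<subseteq> elts bits}) = {z \<in> M. elts z \<subseteq> elts bits}"
      by (intro elts_hset countable_in_M) auto
    moreover have "elts (real_code x) \<subseteq> elts bits" for x
      by (auto simp: elts_bits real_code_seqc elts_seqc)
    ultimately show ?thesis by (auto simp: cantor_def image_iff)
  qed
  then have "set_code (cantor M) = hset {z \<in> elts (hset {z \<in> M. elts z \<subseteq> elts bits}). z = real_code (unreal z)}"
    by (simp only: set_code_def)
  moreover have "dft (\<lambda>e. hset {z \<in> elts (hset {z \<in> M. elts z \<subseteq> elts bits}). z = real_code (unreal z)})"
    by (intro dfi)
  ultimately show ?thesis using dft_M[of _ "\<lambda>_. hempty"] hempty_M by fastforce
qed

lemma dft_set_code_Collect [dfi]:
  assumes "dfp (\<lambda>e. P (unreal (e 0)) (\<lambda>i. e (Suc i)))"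
  shows "dft (\<lambda>e. set_code {x \<in> cantor M. P x e})"
proof -
  have "set_code {x \<in> cantor M. P x e} = hset {z \<in> elts (set_code (cantor M)). P (unreal z) e}" for e
    unfolding set_code_def[of "{x \<in> cantor M. P x e}"] elts_set_code[OF countable_cantor]
    by (rule arg_cong[where f = hset]) auto
  then show ?thesis by (simp only:) (intro dfi assms)
qed

lemma dfp_mem_set:
  assumes "\<And>e. countable (X e)" "dft (\<lambda>e. real_code (x e))" "dft (\<lambda>e. set_code (X e))"
  shows "dfp (\<lambda>e. x e \<in> X e)"
proof -
  have "x e \<in> X e \<longleftrightarrow> real_code (x e) \<in> elts (set_code (X e))" for e
    using assms(1) by (auto simp: elts_set_code)
  then show ?thesis by (simp only:) (intro dfi assms)
qed

lemma dfp_unset [dfi]: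
  "dft (\<lambda>e. real_code (x e)) \<Longrightarrow> dft t \<Longrightarrow> dfp (\<lambda>e. x e \<in> unset (t e))"
  unfolding unset_def mem_Collect_eq by (rule dfp_mem)

lemma sets_in_iff: "X \<in> sets_in M \<longleftrightarrow> X \<subseteq> cantor M \<and> set_code X \<in> M"
proof
  assume "X \<in> sets_in M"
  then obtain a where a: "a \<in> M" "elts a = real_code ` X"
    unfolding sets_in_def in_model_def by blast
  then have "X \<subseteq> cantor M" using trans_M[OF a(1)] unfolding cantor_def by blast
  moreover have "set_code X = a" using a by (metis set_code_def hset_elts)
  ultimately show "X \<subseteq> cantor M \<and> set_code X \<in> M" using a by blast
next
  assume X: "X \<subseteq> cantor M \<and> set_code X \<in> M"
  then have "elts (set_code X) = real_code ` X" by (intro elts_set_code countable_sub_cantor) blast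
  with X show "X \<in> sets_in M"
    unfolding sets_in_def in_model_def by blast
qed

lemma unset_sub_cantor: "y \<in> M \<Longrightarrow> unset y \<subseteq> cantor M"
  using trans_M unfolding unset_def cantor_def by blast

lemma dft_set_code_unset [dfi]: "dft t \<Longrightarrow> dft (\<lambda>e. set_code (unset (t e)))"
proof -
  assume t: "dft t"
  have "dft (\<lambda>e. set_code {x \<in> cantor M. x \<in> unset (t e)})"
    by (intro dfi dft_shift t)
  moreover have "{x \<in> cantor M. x \<in> unset (t e)} = unset (t e)" if "range e \<subseteq> M" for e
    using unset_sub_cantor dft_M[OF t that] by blast
  ultimately show ?thesis
    unfolding dft_def
    by (elim conjE, intro conjI, simp) (erule dfp_cong[THEN iffD1, rotated], simp add: image_subset_iff)
qed

definition mseqs :: "(nat \<Rightarrow> bool list) set" where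
  "mseqs = {s. strings_code s \<in> M}"

lemma unseq_mseqs: "y \<in> M \<Longrightarrow> unseq y \<in> mseqs"
  unfolding mseqs_def mem_Collect_eq
proof (rule dft_comp[where F = "\<lambda>y. strings_code (unseq y)"])
  show "dft (\<lambda>e. strings_code (unseq (e 0)))" by (intro dfi)
qed

lemma mseqs_unseq: "s \<in> mseqs \<Longrightarrow> \<exists>y\<in>M. unseq y = s"
  by (auto simp: mseqs_def intro!: bexI[of _ "strings_code s"])

lemma mseqsI: "dft (\<lambda>e. string_code (s (unnum (e 0)))) \<Longrightarrow> s \<in> mseqs"
  unfolding mseqs_def mem_Collect_eq by (rule seqcI)

lemma mseqsD: "s \<in> mseqs \<Longrightarrow> dft (\<lambda>e. num (n e)) \<Longrightarrow> dft (\<lambda>e. string_code (s (n e)))"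
  unfolding mseqs_def mem_Collect_eq by (rule seqcD)

lemma dfp_ex_mseq [dfi]:
  assumes "dfp (\<lambda>e. P (unseq (e 0)) (\<lambda>i. e (Suc i)))"
  shows "dfp (\<lambda>e. \<exists>x\<in>mseqs. P x e)"
proof -
  have "dfp (\<lambda>e. \<exists>y\<in>M. P (unseq y) e)"
    using assms by (rule dfp_ex)
  then show ?thesis
    by (rule dfp_cong[THEN iffD1, rotated]) (metis unseq_mseqs mseqs_unseq)
qed

lemma dfp_all_mseq [dfi]:
  assumes "dfp (\<lambda>e. P (unseq (e 0)) (\<lambda>i. e (Suc i)))"
  shows "dfp (\<lambda>e. \<forall>x\<in>mseqs. P x e)"
proof -
  have "dfp (\<lambda>e. \<forall>y\<in>M. P (unseq y) e)"
    using assms by (rule dfp_all)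
  then show ?thesis
    by (rule dfp_cong[THEN iffD1, rotated]) (metis unseq_mseqs mseqs_unseq)
qed

end

section \<open>The measure of the model\<close>

definition coin :: "bool measure" where
  "coin = density (count_space UNIV) (\<lambda>_. 1 / 2)"

definition cantor_measure :: "(nat \<Rightarrow> bool) measure" where
  "cantor_measure = PiM UNIV (\<lambda>_. coin)"

lemma sets_coin [simp]: "sets coin = UNIV" and space_coin [simp]: "space coin = UNIV"
  by (simp_all add: coin_def)

lemma emeasure_coin_singleton: "emeasure coin {b} = ennreal (1 / 2)"
proof -
  have "emeasure coin {b} = 1 / 2"
    by (simp add: coin_def emeasure_density nn_integral_count_space_indicator[symmetric])
  also have "(1 / 2 :: ennreal) = ennreal (1 / 2)"
    by (subst divide_ennreal[symmetric]) auto
  finally show ?thesis .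
qed

lemma prob_space_coin: "prob_space coin"
proof
  have "emeasure coin (space coin) = emeasure coin ({True} \<union> {False})"
    by (rule arg_cong[where f = "emeasure coin"]) auto
  also have "\<dots> = emeasure coin {True} + emeasure coin {False}"
    by (intro plus_emeasure[symmetric]) auto
  also have "\<dots> = ennreal (1 / 2 + 1 / 2)"
    unfolding emeasure_coin_singleton by (subst ennreal_plus) auto
  finally show "emeasure coin (space coin) = 1" by simp
qed

interpretation cm: product_prob_space "\<lambda>_ :: nat. coin" UNIV
  by (intro product_prob_spaceI prob_space_coin)

lemma space_cantor_measure [simp]: "space cantor_measure = UNIV"
  by (simp add: cantor_measure_def space_PiM PiE_UNIV_domain)

lemma prob_space_cantor_measure: "prob_space cantor_measure"
  unfolding cantor_measure_def by (rule cm.P.prob_space_axioms)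

lemma emeasure_cantor_UNIV [simp]: "emeasure cantor_measure UNIV = 1"
  using prob_space.emeasure_space_1[OF prob_space_cantor_measure] by simp

lemma sets_coordinates:
  assumes "finite J" shows "{x. \<forall>i\<in>J. x i = v i} \<in> sets cantor_measure"
proof -
  have "{x. x i = v i} \<in> sets cantor_measure" for i
  proof -
    have "(\<lambda>x. x i) \<in> measurable cantor_measure coin"
      unfolding cantor_measure_def by (rule measurable_component_singleton) simp
    from measurable_sets[OF this, of "{v i}"] show ?thesis
      by (simp add: vimage_def)
  qed
  then have "(\<Inter>i\<in>J. {x. x i = v i}) \<inter> space cantor_measure \<in> sets cantor_measure"
    using assms sets.top[of cantor_measure]
    by (cases "J = {}") (auto intro!: sets.finite_INT simp del: sets.top)
  moreover have "(\<Inter>i\<in>J. {x. x i = v i}) \<inter> space cantor_measure = {x. \<forall>i\<in>J. x i = v i}" by auto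
  ultimately show ?thesis by simp
qed

lemma emeasure_coordinates:
  assumes "finite J"
  shows "emeasure cantor_measure {x. \<forall>i\<in>J. x i = v i} = ennreal ((1 / 2) ^ card J)"
proof -
  have "emeasure (PiM UNIV (\<lambda>_. coin)) {x \<in> space (PiM UNIV (\<lambda>_. coin)). \<forall>i\<in>J. x i \<in> {v i}} =
      (\<Prod>i\<in>J. emeasure coin {v i})"
    by (rule cm.emeasure_PiM_Collect) (use assms in auto)
  also have "\<dots> = ennreal ((1 / 2) ^ card J)"
    unfolding emeasure_coin_singleton prod_constant by (rule ennreal_power) simp
  finally show ?thesis
    by (simp add: cantor_measure_def space_PiM PiE_UNIV_domain)
qed

lemma sets_cylinder [measurable, simp]: "cylinder s \<in> sets cantor_measure"
  using sets_coordinates[of "{..<length s}" "\<lambda>i. s ! i"] by (simp add: cylinder_def Ball_def)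

lemma emeasure_cylinder: "emeasure cantor_measure (cylinder s) = ennreal ((1 / 2) ^ length s)"
  using emeasure_coordinates[of "{..<length s}" "\<lambda>i. s ! i"] by (simp add: cylinder_def Ball_def)

definition weight :: "(nat \<Rightarrow> bool list) \<Rightarrow> ennreal" where
  "weight s = (\<Sum>n. ennreal ((1 / 2) ^ length (s n)))"

lemma emeasure_UN_cylinder_le: "emeasure cantor_measure (\<Union>n. cylinder (s n)) \<le> weight s"
  unfolding weight_def emeasure_cylinder[symmetric]
  by (rule emeasure_subadditive_countably) auto

lemma weight_SUP: "weight s = (SUP N. ennreal (\<Sum>i<N. (1 / 2) ^ length (s i)))"
  unfolding weight_def by (simp add: suminf_eq_SUP sum_ennreal)

lemma weight_geometric: "weight (\<lambda>n. replicate (n + j) b) = ennreal (2 * (1 / 2) ^ j)"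
proof -
  have "(\<lambda>n. (1 / 2 :: real) ^ n * (1 / 2) ^ j) sums (2 * (1 / 2) ^ j)"
    using sums_mult2[OF geometric_sums[of "1 / 2 :: real"]] by simp
  then have "(\<lambda>n. ennreal ((1 / 2) ^ (n + j))) sums ennreal (2 * (1 / 2) ^ j)"
    by (subst sums_ennreal) (simp_all add: power_add)
  then show ?thesis unfolding weight_def by (simp add: sums_iff)
qed

text \<open>The partial sum of the weight multiplied by \<open>2 ^ m\<close>. It is the exact
  multiple, and a natural number, once \<open>m\<close> bounds the lengths that occur; hence it can
  be handled by arithmetic in M.\<close>

fun wsum :: "(nat \<Rightarrow> bool list) \<Rightarrow> nat \<Rightarrow> nat \<Rightarrow> nat" where
  "wsum s 0 m = 0"
| "wsum s (Suc N) m = wsum s N m + 2 ^ (m - length (s N))"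

lemma wsum_real:
  "(\<forall>i<N. length (s i) \<le> m) \<Longrightarrow> real (wsum s N m) = 2 ^ m * (\<Sum>i<N. (1 / 2) ^ length (s i))"
proof (induction N)
  case (Suc N)
  have "length (s N) \<le> m" using Suc.prems by simp
  then have "(2::real) ^ (m - length (s N)) = 2 ^ m * (1 / 2) ^ length (s N)"
    by (simp add: power_diff power_one_over divide_simps)
  then show ?case using Suc by (simp add: algebra_simps)
qed simp

text \<open>\<open>weight s \<le> weight r + 2\<^sup>-\<^sup>j\<close>, up to strictness, phrased with finite partial sums of natural
  numbers so that it is definable in the model.\<close>

definition weight_le :: "(nat \<Rightarrow> bool list) \<Rightarrow> (nat \<Rightarrow> bool list) \<Rightarrow> nat \<Rightarrow> bool" where
  "weight_le s r j \<longleftrightarrow> (\<forall>N. \<exists>N' m. (\<forall>i. i < N \<longrightarrow> length (s i) \<le> m) \<and> (\<forall>i. i < N' \<longrightarrow> length (r i) \<le> m) \<and>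
     j \<le> m \<and> wsum s N m \<le> wsum r N' m + 2 ^ (m - j))"

lemma wsum_le_iff:
  assumes "\<forall>i<N. length (s i) \<le> m" "\<forall>i<N'. length (r i) \<le> m" "j \<le> m"
  shows "wsum s N m \<le> wsum r N' m + 2 ^ (m - j) \<longleftrightarrow>
    (\<Sum>i<N. (1 / 2) ^ length (s i)) \<le> (\<Sum>i<N'. (1 / 2) ^ length (r i)) + (1 / 2 :: real) ^ j"
proof -
  have "(2::real) ^ (m - j) = 2 ^ m * (1 / 2) ^ j"
    using assms(3) by (simp add: power_diff power_one_over divide_simps)
  then have "real (wsum r N' m + 2 ^ (m - j)) = 2 ^ m * ((\<Sum>i<N'. (1 / 2) ^ length (r i)) + (1 / 2) ^ j)"
    using wsum_real[OF assms(2)] by (simp add: algebra_simps)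
  then have "real (wsum s N m) \<le> real (wsum r N' m + 2 ^ (m - j)) \<longleftrightarrow>
    (\<Sum>i<N. (1 / 2) ^ length (s i)) \<le> (\<Sum>i<N'. (1 / 2) ^ length (r i)) + (1 / 2 :: real) ^ j"
    using wsum_real[OF assms(1)] by (simp add: mult_le_cancel_left_pos)
  then show ?thesis by (simp only: of_nat_le_iff)
qed

lemma weight_leD: "weight_le s r j \<Longrightarrow> weight s \<le> weight r + ennreal ((1 / 2) ^ j)"
  unfolding weight_SUP[of s]
proof (rule SUP_least)
  fix N assume "weight_le s r j"
  then obtain N' m where *: "\<forall>i<N. length (s i) \<le> m" "\<forall>i<N'. length (r i) \<le> m" "j \<le> m"
    "wsum s N m \<le> wsum r N' m + 2 ^ (m - j)" unfolding weight_le_def by blast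
  have "ennreal (\<Sum>i<N. (1 / 2) ^ length (s i)) \<le> ennreal ((\<Sum>i<N'. (1 / 2) ^ length (r i)) + (1 / 2) ^ j)"
    using *(4)[unfolded wsum_le_iff[OF *(1-3)]] by (rule ennreal_leI)
  also have "\<dots> = ennreal (\<Sum>i<N'. (1 / 2) ^ length (r i)) + ennreal ((1 / 2) ^ j)"
    by (intro ennreal_plus sum_nonneg) auto
  also have "\<dots> \<le> weight r + ennreal ((1 / 2) ^ j)"
    unfolding weight_SUP by (intro add_right_mono SUP_upper) simp
  finally show "ennreal (\<Sum>i<N. (1 / 2) ^ length (s i)) \<le> weight r + ennreal ((1 / 2) ^ j)" .
qed

text \<open>The strict inequality lets a finite partial sum of \<open>r\<close> already dominate the
  given partial sum of \<open>s\<close>. In the limit strictness is lost, which is why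
  \<open>weight_leD\<close> returns only a weak inequality.\<close>

lemma weight_leI: "weight s < weight r + ennreal ((1 / 2) ^ j) \<Longrightarrow> weight_le s r j"
  unfolding weight_le_def
proof
  fix N assume *: "weight s < weight r + ennreal ((1 / 2) ^ j)"
  have "ennreal (\<Sum>i<N. (1 / 2) ^ length (s i)) \<le> weight s"
    unfolding weight_SUP by (rule SUP_upper) simp
  also note *
  also have "weight r + ennreal ((1 / 2) ^ j) =
      (SUP N'. ennreal (\<Sum>i<N'. (1 / 2) ^ length (r i)) + ennreal ((1 / 2) ^ j))"
    unfolding weight_SUP by (rule ennreal_SUP_add_left[symmetric]) simp
  finally obtain N' where "ennreal (\<Sum>i<N. (1 / 2) ^ length (s i)) <
      ennreal (\<Sum>i<N'. (1 / 2) ^ length (r i)) + ennreal ((1 / 2) ^ j)"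
    unfolding less_SUP_iff by blast
  also have "\<dots> = ennreal ((\<Sum>i<N'. (1 / 2) ^ length (r i)) + (1 / 2) ^ j)"
    by (intro ennreal_plus[symmetric] sum_nonneg) auto
  finally have le: "(\<Sum>i<N. (1 / 2 :: real) ^ length (s i)) \<le> (\<Sum>i<N'. (1 / 2) ^ length (r i)) + (1 / 2) ^ j"
    by (subst (asm) ennreal_less_iff) (auto intro: sum_nonneg less_imp_le)
  \<comment> \<open>Any common bound for the finitely many lengths and \<open>j\<close> would do;
    their sum is one.\<close>
  define m where "m = (\<Sum>i<N. length (s i)) + (\<Sum>i<N'. length (r i)) + j"
  have "\<forall>i<N. length (s i) \<le> m"
    using member_le_sum[of _ "{..<N}" "\<lambda>i. length (s i)"] by (auto simp: m_def intro!: trans_le_add1)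
  moreover have "length (r i) \<le> (\<Sum>i<N'. length (r i))" if "i < N'" for i
    using member_le_sum[of i "{..<N'}" "\<lambda>i. length (r i)"] that by auto
  then have "\<forall>i<N'. length (r i) \<le> m" unfolding m_def by (meson trans_le_add1 trans_le_add2)
  moreover have "j \<le> m" by (simp add: m_def)
  ultimately show "\<exists>N' m. (\<forall>i. i < N \<longrightarrow> length (s i) \<le> m) \<and> (\<forall>i. i < N' \<longrightarrow> length (r i) \<le> m) \<and>
     j \<le> m \<and> wsum s N m \<le> wsum r N' m + 2 ^ (m - j)"
    using wsum_le_iff[of N s m N' r j] le by blast
qed

context ctm
begin

lemma dft_wsum [dfi]:
  assumes "dft t" "dft (\<lambda>e. num (N e))" "dft (\<lambda>e. num (m e))"
  shows "dft (\<lambda>e. num (wsum (unseq (t e)) (N e) (m e)))"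
proof -
  have "num (wsum s N m) = rec_nat (num 0) (\<lambda>n y. num (unnum y + 2 ^ (m - length (s n)))) N" for s N m
  proof (induction N)
    case (Suc N)
    then show ?case by (simp only: old.nat.rec Suc[symmetric]) simp
  qed simp
  then show ?thesis
    by (simp only:) (intro dft_rec_nat dfi dft_rename[OF assms(1)] dft_rename[OF assms(3)] assms)
qed

lemma dfp_weight_le [dfi]:
  assumes "dft t" "dft u" "dft (\<lambda>e. num (j e))"
  shows "dfp (\<lambda>e. weight_le (unseq (t e)) (unseq (u e)) (j e))"
proof -
  have "dfp (\<lambda>e. weight_le (unseq (e 0)) (unseq (e 1)) (unnum (e 2)))"
    unfolding weight_le_def by (intro dfi)
  from dfp_sub3[where Q = "\<lambda>x y z. weight_le (unseq x) (unseq y) (unnum z)", OF this assms]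
  show ?thesis by simp
qed

section \<open>Outer measure through covers in the model\<close>

definition covers :: "(nat \<Rightarrow> bool list) \<Rightarrow> (nat \<Rightarrow> bool) set \<Rightarrow> bool" where
  "covers s X \<longleftrightarrow> (\<forall>x\<in>cantor M. x \<in> X \<longrightarrow> (\<exists>n. x \<in> cylinder (s n)))"

lemma dfp_covers [dfi]:
  assumes "dft t" "dft u"
  shows "dfp (\<lambda>e. covers (unseq (t e)) (unset (u e)))"
proof -
  have "dfp (\<lambda>e. covers (unseq (e 0)) (unset (e 1)))"
    unfolding covers_def by (intro dfi)
  from dfp_sub2[where Q = "\<lambda>x y. covers (unseq x) (unset y)", OF this assms]
  show ?thesis by simp
qed

lemma covers_iff: "X \<subseteq> cantor M \<Longrightarrow> covers s X \<longleftrightarrow> X \<subseteq> (\<Union>n. cylinder (s n))"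
  unfolding covers_def by blast

lemma in_model_seqc: "in_model M {kpair (num n) (h n) | n. True} \<longleftrightarrow> seqc h \<in> M"
proof -
  have "{kpair (num n) (h n) | n. True} = range (\<lambda>n. kpair (num n) (h n))" by auto
  then show ?thesis unfolding in_model_def seqc_def
    by (metis elts_seqc hset_elts seqc_def)
qed

lemma measure_in_eq:
  "measure_in M X = Inf (weight ` {s \<in> mseqs. X \<subseteq> (\<Union>n. cylinder (s n))})"
  unfolding measure_in_def in_model_seqc mseqs_def weight_def
  by (rule arg_cong[where f = Inf]) auto

lemma measure_in_le: "s \<in> mseqs \<Longrightarrow> X \<subseteq> (\<Union>n. cylinder (s n)) \<Longrightarrow> measure_in M X \<le> weight s"
  unfolding measure_in_eq by (rule Inf_lower) blast

lemma measure_in_lessD: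
  "measure_in M X < r \<Longrightarrow> \<exists>s\<in>mseqs. X \<subseteq> (\<Union>n. cylinder (s n)) \<and> weight s < r"
  unfolding measure_in_eq Inf_less_iff by blast

lemma measure_in_geI:
  "(\<And>s. s \<in> mseqs \<Longrightarrow> X \<subseteq> (\<Union>n. cylinder (s n)) \<Longrightarrow> r \<le> weight s) \<Longrightarrow> r \<le> measure_in M X"
  unfolding measure_in_eq by (rule Inf_greatest) blast

lemma measure_in_mono: "X \<subseteq> Y \<Longrightarrow> measure_in M X \<le> measure_in M Y"
  unfolding measure_in_eq by (rule Inf_superset_mono) blast

lemma seqc_update:
  assumes h: "seqc h \<in> M" and a: "a \<in> M"
  shows "seqc (h(k := a)) \<in> M"
proof (rule seqcI)
  have "(h(k := a)) n = (if n = k then a else h n)" for n by simp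
  then show "dft (\<lambda>e. (h(k := a)) (unnum (e 0)))"
    by (simp only:) (intro dfi a num_M seqcD[OF h])
qed

lemma seqc_finite:
  assumes h: "seqc h \<in> M" and a: "\<And>n. n < k \<Longrightarrow> a n \<in> M"
  shows "seqc (\<lambda>n. if n < k then a n else h n) \<in> M"
  using a
proof (induction k)
  case (Suc k)
  have "(\<lambda>n. if n < Suc k then a n else h n) = (\<lambda>n. if n < k then a n else h n)(k := a k)"
    by (auto simp: less_Suc_eq)
  then show ?case using Suc seqc_update by simp
qed (use h in simp)

lemma measure_in_list:
  assumes "X \<subseteq> (\<Union>t\<in>set ts. cylinder t)"
  shows "measure_in M X \<le> ennreal (\<Sum>t\<leftarrow>ts. (1 / 2) ^ length t)"
proof (rule ennreal_le_epsilon)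
  fix \<epsilon> :: real assume "0 < \<epsilon>"
  then obtain j where j: "2 * (1 / 2) ^ j < \<epsilon>"
    using real_arch_pow_inv[of "\<epsilon> / 2" "1 / 2"] by (auto simp: field_simps)
  \<comment> \<open>A cover is an infinite sequence, so the list is continued by strings of lengths
    \<open>n + j\<close>. Their total weight is at most \<open>2 * (1 / 2) ^ j\<close>, which is
    below \<epsilon>.\<close>
  define s where "s n = (if n < length ts then ts ! n else replicate (n + j) False)" for n
  have "seqc (\<lambda>n. string_code (replicate (n + j) False)) \<in> M"
    by (intro seqcI dfi num_M)
  then have "seqc (\<lambda>n. if n < length ts then string_code (ts ! n) else string_code (replicate (n + j) False)) \<in> M"
    by (rule seqc_finite) (rule string_code_M)
  moreover have "string_code (s n) =
      (if n < length ts then string_code (ts ! n) else string_code (replicate (n + j) False))" for n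
    by (simp add: s_def)
  ultimately have "s \<in> mseqs" by (simp add: mseqs_def)
  moreover have "X \<subseteq> (\<Union>n. cylinder (s n))"
  proof
    fix x assume "x \<in> X"
    then obtain t where "t \<in> set ts" "x \<in> cylinder t" using assms by blast
    then obtain n where "n < length ts" "x \<in> cylinder (ts ! n)" by (metis in_set_conv_nth)
    then show "x \<in> (\<Union>n. cylinder (s n))" by (auto simp: s_def intro!: exI[of _ n])
  qed
  ultimately have "measure_in M X \<le> weight s" by (rule measure_in_le)
  also have "weight s \<le> (\<Sum>n. (if n < length ts then ennreal ((1 / 2) ^ length (ts ! n)) else 0) +
      ennreal ((1 / 2) ^ length (replicate (n + j) False)))"
    unfolding weight_def s_def by (intro suminf_le) (auto simp: add_increasing)
  also have "\<dots> = (\<Sum>n. (if n < length ts then ennreal ((1 / 2) ^ length (ts ! n)) else 0)) +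
      weight (\<lambda>n. replicate (n + j) False)"
    unfolding weight_def by (rule suminf_add[symmetric]) auto
  also have "(\<Sum>n. (if n < length ts then ennreal ((1 / 2) ^ length (ts ! n)) else 0)) =
      (\<Sum>n<length ts. ennreal ((1 / 2) ^ length (ts ! n)))"
    by (subst suminf_finite[of "{..<length ts}"]) auto
  also have "\<dots> = ennreal (\<Sum>t\<leftarrow>ts. (1 / 2) ^ length t)"
    by (simp add: sum_ennreal sum_list_sum_nth atLeast0LessThan)
  also have "weight (\<lambda>n. replicate (n + j) False) \<le> ennreal \<epsilon>"
    unfolding weight_geometric using j by (intro ennreal_leI) simp
  finally show "measure_in M X \<le> ennreal (\<Sum>t\<leftarrow>ts. (1 / 2) ^ length t) + ennreal \<epsilon>"
    by (simp add: add_left_mono)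
qed

lemma measure_in_le_1: "measure_in M X \<le> 1"
  using measure_in_list[of X "[[]]"] by (simp add: cylinder_def)

lemma measure_in_empty [simp]: "measure_in M {} = 0"
  using measure_in_list[of "{}" "[]"] by simp

text \<open>Compactness inside the model: a real avoiding the cover is found by always moving to a half
  that is not covered by finitely many of the given cylinders.\<close>

lemma weight_ge_1:
  assumes s: "s \<in> mseqs" and cov: "cantor M \<subseteq> (\<Union>n. cylinder (s n))"
  shows "1 \<le> weight s"
proof -
  let ?pre = "\<lambda>u v. elts (string_code u) \<subseteq> elts (string_code v)"
  \<comment> \<open>The cylinder of \<open>t\<close> is covered by finitely many members of the
    sequence, phrased through strings of one fixed length so that it is a condition about finite
    objects.\<close>
  define Cov where "Cov t \<longleftrightarrow> (\<exists>m. length t \<le> m \<and> (\<forall>v. length v = m \<and> ?pre t v \<longrightarrow> (\<exists>n. ?pre (s n) v)))" for t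
  have split: "Cov t" if C: "Cov (t @ [False])" "Cov (t @ [True])" for t
  proof -
    obtain m0 where m0: "length (t @ [False]) \<le> m0"
      "\<And>v. length v = m0 \<Longrightarrow> ?pre (t @ [False]) v \<Longrightarrow> \<exists>n. ?pre (s n) v"
      using C(1) unfolding Cov_def by blast
    obtain m1 where m1: "length (t @ [True]) \<le> m1"
      "\<And>v. length v = m1 \<Longrightarrow> ?pre (t @ [True]) v \<Longrightarrow> \<exists>n. ?pre (s n) v"
      using C(2) unfolding Cov_def by blast
    define f where "f b = (if b then m1 else m0)" for b
    have f: "length (t @ [b]) \<le> f b"
      "length v = f b \<Longrightarrow> ?pre (t @ [b]) v \<Longrightarrow> \<exists>n. ?pre (s n) v" for b v
      using m0 m1 by (cases b; simp add: f_def)+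
    show ?thesis unfolding Cov_def
    proof (rule exI[of _ "max (f True) (f False)"], intro conjI allI impI)
      show "length t \<le> max (f True) (f False)" using f(1)[of True] by simp
      fix v assume v: "length v = max (f True) (f False) \<and> ?pre t v"
      define b where "b = v ! length t"
      have len: "f b \<le> length v" using v by (cases b) auto
      have lt: "length t < length v" using f(1)[of b] len by simp
      have "?pre (t @ [b]) (take (f b) v)"
        using v f(1)[of b] len lt unfolding string_code_subset
        by (auto simp: nth_append b_def less_Suc_eq)
      then obtain n where "?pre (s n) (take (f b) v)" using f(2)[of "take (f b) v" b] len by auto
      moreover have "?pre (take (f b) v) v" unfolding string_code_subset by auto
      ultimately show "\<exists>n. ?pre (s n) v" by blast
    qed
  qed
  show ?thesis
  proof (cases "Cov []")
    case True
    \<comment> \<open>Strings of length \<open>m\<close> are the same inside and outside M. So the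
      given cylinders cover every real, and subadditivity of the true measure gives the
      bound.\<close>
    then obtain m where m: "\<And>v. length v = m \<Longrightarrow> \<exists>n. ?pre (s n) v"
      unfolding Cov_def by (auto simp: elts_string_code[of "[]"])
    have "x \<in> (\<Union>n. cylinder (s n))" for x
    proof -
      obtain n where "?pre (s n) (map x [0..<m])" using m[of "map x [0..<m]"] by auto
      then have "x \<in> cylinder (s n)" unfolding string_code_subset cylinder_def by auto
      then show ?thesis by blast
    qed
    then have "(\<Union>n. cylinder (s n)) = UNIV" by blast
    then show ?thesis using emeasure_UN_cylinder_le[of s] by simp
  next
    case False
    \<comment> \<open>The branch takes the bit \<open>False\<close> unless that half is finitely
      covered; in that case the other half is not, by \<open>split\<close>.\<close>
    define g where "g = rec_nat [] (\<lambda>_ u. u @ [Cov (u @ [False])])"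
    have g_Suc: "g (Suc n) = g n @ [Cov (g n @ [False])]" for n by (simp add: g_def)
    have g0: "g 0 = []" by (simp add: g_def)
    have nc: "\<not> Cov (g n)" for n
    proof (induction n)
      case (Suc n)
      show ?case
      proof (cases "Cov (g n @ [False])")
        case True
        then show ?thesis using split[of "g n"] Suc by (auto simp: g_Suc)
      qed (simp add: g_Suc)
    qed (simp add: g0 False)
    define x where "x n = Cov (g n @ [False])" for n
    have g_map: "g n = map x [0..<n]" for n
      by (induction n) (simp_all add: g0 g_Suc x_def)
    \<comment> \<open>The branch is definable from \<open>s\<close>, so it is a real of M and the
      assumed cover has to catch it.\<close>
    have "x \<in> cantor M"
    proof -
      have dC: "dfp (\<lambda>e. Cov (u e))" if "dft (\<lambda>e. string_code (u e))" for u
      proof -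
        have "dfp (\<lambda>e. Cov (unstring (e 0)))"
          unfolding Cov_def by (intro dfi mseqsD[OF s])
        from dfp_sub1[where Q = "\<lambda>y. Cov (unstring y)", OF this that] show ?thesis by simp
      qed
      have "string_code (g n) = rec_nat (string_code [])
          (\<lambda>_ y. string_code (unstring y @ [Cov (unstring y @ [False])])) n" for n
      proof (induction n)
        case (Suc n)
        then show ?case by (simp only: old.nat.rec Suc[symmetric] g_Suc unstring_string_code)
      qed (simp add: g0)
      then have dg: "dft (\<lambda>e. string_code (g (unnum (e 0))))"
        by (simp only:) (intro dft_rec_nat dfi dC)
      have "real_code x \<in> M"
        unfolding real_code_seqc by (rule seqcI) (unfold x_def, intro dfi dC dg)
      then show ?thesis by (simp add: cantor_def)
    qed
    then obtain n where n: "x \<in> cylinder (s n)" using cov by blast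
    \<comment> \<open>The prefix of \<open>x\<close> of this length is the string \<open>s n\<close>
      itself, so a single cylinder covers it, against \<open>nc\<close>.\<close>
    have "Cov (g (length (s n)))"
      unfolding Cov_def
    proof (rule exI[of _ "length (s n)"], intro conjI allI impI)
      fix v assume v: "length v = length (s n) \<and> ?pre (g (length (s n))) v"
      then have "?pre (s n) v"
        using n unfolding string_code_subset cylinder_def g_map by auto
      then show "\<exists>n. ?pre (s n) v" by blast
    qed (simp add: g_map)
    then show ?thesis using nc by blast
  qed
qed

lemma measure_in_cantor: "measure_in M (cantor M) = 1"
  by (intro antisym measure_in_le_1 measure_in_geI weight_ge_1)

text \<open>The usual argument with errors \<epsilon> divided by powers of two, except that the
  covers of all the sets must be chosen simultaneously in M. Near-optimality of a cover therefore
  has to be a formula.\<close>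

lemma measure_in_UN_le:
  assumes f: "\<And>n. f n \<subseteq> cantor M" and fM: "sets_code f \<in> M"
  shows "measure_in M (\<Union>n. f n) \<le> (\<Sum>n. measure_in M (f n))"
proof (rule ennreal_le_epsilon)
  fix \<epsilon> :: real assume "0 < \<epsilon>"
  then obtain k where k: "2 * (1 / 2) ^ k < \<epsilon>"
    using real_arch_pow_inv[of "\<epsilon> / 2" "1 / 2"] by (auto simp: field_simps)
  \<comment> \<open>Near-optimality without mention of the infimum: the cover is compared with every
    other cover of \<open>f n\<close> in M, up to the error
    \<open>(1 / 2) ^ (n + k)\<close>.\<close>
  define P where "P n y \<longleftrightarrow> covers (unseq y) (f n) \<and>
    (\<forall>r\<in>mseqs. covers r (f n) \<longrightarrow> weight_le (unseq y) r (n + k))" for n y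
  have f_unset: "f n = unset (set_code (f n))" for n
    using countable_sub_cantor[OF f] by simp
  have df: "dft (\<lambda>e. set_code (f (i e)))" if "dft (\<lambda>e. num (i e))" for i
    using seqcD[OF fM that] .
  have dc: "dfp (\<lambda>e. covers (unseq (t e)) (f (i e)))" if "dft t" "dft (\<lambda>e. num (i e))" for t i
    using dfp_covers[OF that(1) df[OF that(2)]] by (simp only: f_unset[symmetric])
  have "\<exists>h. (\<forall>n. P n (h n)) \<and> seqc h \<in> M"
  proof (rule model_choice)
    show "dfp (\<lambda>e. P (unnum (e 0)) (e 1))"
      unfolding P_def by (intro dfi dc num_M)
    fix n
    have "measure_in M (f n) < measure_in M (f n) + ennreal ((1 / 2) ^ (n + k))"
      using measure_in_le_1[of "f n"]
        ennreal_add_left_cancel_less[of "measure_in M (f n)" 0 "ennreal ((1 / 2) ^ (n + k))"]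
      by (auto simp: top_unique)
    then obtain s where s: "s \<in> mseqs" "f n \<subseteq> (\<Union>n. cylinder (s n))"
      "weight s < measure_in M (f n) + ennreal ((1 / 2) ^ (n + k))"
      using measure_in_lessD by blast
    obtain y where y: "y \<in> M" "unseq y = s" using mseqs_unseq[OF s(1)] by blast
    have "weight_le s r (n + k)" if "r \<in> mseqs" "covers r (f n)" for r
    proof (rule weight_leI)
      have "measure_in M (f n) \<le> weight r"
        using that covers_iff[OF f] by (intro measure_in_le) blast+
      then show "weight s < weight r + ennreal ((1 / 2) ^ (n + k))"
        using s(3) by (meson add_right_mono less_le_trans)
    qed
    then have "P n y" unfolding P_def y(2) using s(2) covers_iff[OF f] by blast
    then show "\<exists>y\<in>M. P n y" using y(1) by blast
  qed
  then obtain h where h: "\<And>n. P n (h n)" "seqc h \<in> M" by blast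
  \<comment> \<open>All covers are merged into one sequence by decoding its index as a pair; its
    weight is the double sum.\<close>
  define u where "u m = unseq (h (fst (prod_decode m))) (snd (prod_decode m))" for m
  have uM: "u \<in> mseqs"
    unfolding u_def by (intro mseqsI dfi seqcD[OF h(2)])
  have cov: "f n \<subseteq> (\<Union>i. cylinder (unseq (h n) i))" for n
    using h(1)[of n] covers_iff[OF f] unfolding P_def by blast
  have "(\<Union>n. f n) \<subseteq> (\<Union>m. cylinder (u m))"
  proof
    fix x assume "x \<in> (\<Union>n. f n)"
    then obtain n i where "x \<in> cylinder (unseq (h n) i)" using cov by blast
    then have "x \<in> cylinder (u (prod_encode (n, i)))" by (simp add: u_def)
    then show "x \<in> (\<Union>m. cylinder (u m))" by blast
  qed
  with uM have "measure_in M (\<Union>n. f n) \<le> weight u" by (rule measure_in_le)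
  also have "weight u = (\<Sum>n. weight (unseq (h n)))"
    unfolding weight_def u_def
    by (rule suminf_ennreal_2dimen[of _ "\<lambda>(n, i). ennreal ((1 / 2) ^ length (unseq (h n) i))",
        simplified case_prod_beta fst_conv snd_conv]) simp
  also have "\<dots> \<le> (\<Sum>n. measure_in M (f n) + ennreal ((1 / 2) ^ length (replicate (n + k) False)))"
  proof (intro suminf_le)
    fix n
    have "weight (unseq (h n)) - ennreal ((1 / 2) ^ (n + k)) \<le> measure_in M (f n)"
    proof (rule measure_in_geI)
      fix r assume "r \<in> mseqs" "f n \<subseteq> (\<Union>i. cylinder (r i))"
      then have "weight_le (unseq (h n)) r (n + k)"
        using h(1)[of n] covers_iff[OF f] unfolding P_def by blast
      then show "weight (unseq (h n)) - ennreal ((1 / 2) ^ (n + k)) \<le> weight r"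
        using weight_leD by (subst ennreal_minus_le_iff) (auto simp: add.commute)
    qed
    then show "weight (unseq (h n)) \<le> measure_in M (f n) + ennreal ((1 / 2) ^ length (replicate (n + k) False))"
      by (subst (asm) ennreal_minus_le_iff) (auto simp: add.commute)
  qed auto
  also have "\<dots> = (\<Sum>n. measure_in M (f n)) + weight (\<lambda>n. replicate (n + k) False)"
    unfolding weight_def by (rule suminf_add[symmetric]) auto
  also have "weight (\<lambda>n. replicate (n + k) False) \<le> ennreal \<epsilon>"
    unfolding weight_geometric using k by (intro ennreal_leI) simp
  finally show "measure_in M (\<Union>n. f n) \<le> (\<Sum>n. measure_in M (f n)) + ennreal \<epsilon>"
    by (simp add: add_left_mono)
qed

end

section \<open>Approximation by clopen sets\<close>

definition clopen :: "(nat \<Rightarrow> bool) set \<Rightarrow> bool" where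
  "clopen K \<longleftrightarrow> (\<exists>m. \<forall>x y. (\<forall>i<m. x i = y i) \<longrightarrow> x \<in> K \<longrightarrow> y \<in> K)"

lemma clopen_Compl: "clopen K \<Longrightarrow> clopen (- K)"
proof -
  assume "clopen K"
  then obtain m where m: "\<And>x y. (\<forall>i<m. x i = y i) \<Longrightarrow> x \<in> K \<Longrightarrow> y \<in> K" unfolding clopen_def by blast
  have "y \<in> - K" if "\<forall>i<m. x i = y i" "x \<in> - K" for x y
  proof
    assume "y \<in> K"
    then have "x \<in> K" by (intro m[of y x]) (use that(1) in simp_all)
    then show False using that(2) by simp
  qed
  then show ?thesis unfolding clopen_def by blast
qed

lemma clopen_Un: "clopen K \<Longrightarrow> clopen L \<Longrightarrow> clopen (K \<union> L)"
proof -
  assume "clopen K" "clopen L"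
  then obtain m n where m: "\<And>x y. (\<forall>i<m. x i = y i) \<Longrightarrow> x \<in> K \<Longrightarrow> y \<in> K"
    and n: "\<And>x y. (\<forall>i<n. x i = y i) \<Longrightarrow> x \<in> L \<Longrightarrow> y \<in> L" unfolding clopen_def by blast
  have "y \<in> K \<union> L" if "\<forall>i<max m n. x i = y i" "x \<in> K \<union> L" for x y
    using that m[of x y] n[of x y] by auto
  then show ?thesis unfolding clopen_def by blast
qed

lemma clopen_coordinates: "finite J \<Longrightarrow> clopen {x. \<forall>i\<in>J. x i = v i}"
  unfolding clopen_def
proof (intro exI allI impI)
  fix x y assume J: "finite J" and *: "\<forall>i<Suc (\<Sum>i\<in>J. i). x i = y i" "x \<in> {x. \<forall>i\<in>J. x i = v i}"
  have "i < Suc (\<Sum>i\<in>J. i)" if "i \<in> J" for i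
    using member_le_sum[OF that, of "\<lambda>i. i"] J by (simp add: le_imp_less_Suc)
  then show "y \<in> {x. \<forall>i\<in>J. x i = v i}" using * by auto
qed

lemma clopen_cylinder: "clopen (cylinder s)"
  using clopen_coordinates[of "{..<length s}" "\<lambda>i. s ! i"] by (simp add: cylinder_def Ball_def)

lemma clopen_decompose:
  assumes "clopen K"
  obtains ts where "K = (\<Union>t\<in>set ts. cylinder t)"
    "emeasure cantor_measure K = ennreal (\<Sum>t\<leftarrow>ts. (1 / 2) ^ length t)"
proof -
  obtain m where m: "\<And>x y. (\<forall>i<m. x i = y i) \<Longrightarrow> x \<in> K \<Longrightarrow> y \<in> K"
    using assms unfolding clopen_def by blast
  define T where "T = {t. length t = m \<and> cylinder t \<subseteq> K}"
  have "T \<subseteq> {t. set t \<subseteq> UNIV \<and> length t = m}" by (auto simp: T_def)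
  then have fin: "finite T" using finite_lists_length_eq[of "UNIV :: bool set" m] finite_subset by auto
  then obtain ts where ts: "set ts = T" "distinct ts" using finite_distinct_list by blast
  have K: "K = (\<Union>t\<in>T. cylinder t)"
  proof (intro equalityI subsetI)
    fix x assume x: "x \<in> K"
    have "cylinder (map x [0..<m]) \<subseteq> K" using m[OF _ x] by (auto simp: cylinder_def)
    moreover have "x \<in> cylinder (map x [0..<m])" by (simp add: cylinder_def)
    ultimately show "x \<in> (\<Union>t\<in>T. cylinder t)" by (auto simp: T_def intro!: exI[of _ "map x [0..<m]"])
  qed (auto simp: T_def)
  have "disjoint_family_on cylinder T"
    unfolding disjoint_family_on_def
  proof (intro ballI impI)
    fix t u assume "t \<in> T" "u \<in> T" "t \<noteq> u"
    then obtain i where "i < m" "t ! i \<noteq> u ! i" using nth_equalityI[of t u] by (auto simp: T_def)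
    then show "cylinder t \<inter> cylinder u = {}" using \<open>t \<in> T\<close> \<open>u \<in> T\<close> by (auto simp: cylinder_def T_def)
  qed
  then have "emeasure cantor_measure K = (\<Sum>t\<in>T. emeasure cantor_measure (cylinder t))"
    unfolding K using fin by (intro sum_emeasure[symmetric]) auto
  also have "\<dots> = ennreal (\<Sum>t\<leftarrow>ts. (1 / 2) ^ length t)"
    unfolding emeasure_cylinder by (simp add: sum_ennreal sum_list_distinct_conv_sum_set ts)
  finally show thesis using K unfolding ts(1)[symmetric] by (intro that)
qed

lemma sets_clopen: "clopen K \<Longrightarrow> K \<in> sets cantor_measure"
proof (erule clopen_decompose)
  fix ts :: "bool list list" assume "K = (\<Union>t\<in>set ts. cylinder t)"
  then show "K \<in> sets cantor_measure" by simp
qed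

lemma sets_sym_diff: "A \<in> sets N \<Longrightarrow> B \<in> sets N \<Longrightarrow> sym_diff A B \<in> sets N"
  by auto

context ctm
begin

text \<open>The sets themselves need not belong to M, so countable subadditivity does not apply to
  them directly. The traces on \<open>cantor M\<close> of near-optimal covers do belong to M and
  take their place.\<close>

lemma measure_in_Un_le:
  assumes "A \<subseteq> cantor M" "B \<subseteq> cantor M"
  shows "measure_in M (A \<union> B) \<le> measure_in M A + measure_in M B"
proof (rule ennreal_le_epsilon)
  fix \<epsilon> :: real assume \<epsilon>: "0 < \<epsilon>"
  have fin: "measure_in M X \<noteq> \<infinity>" for X using measure_in_le_1[of X] by (auto simp: top_unique)
  have lt: "measure_in M X < measure_in M X + ennreal (\<epsilon> / 2)" for X
    using ennreal_add_left_cancel_less[of "measure_in M X" 0 "ennreal (\<epsilon> / 2)"] fin \<epsilon> by simp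
  obtain s where s: "s \<in> mseqs" "A \<subseteq> (\<Union>n. cylinder (s n))" "weight s < measure_in M A + ennreal (\<epsilon> / 2)"
    using measure_in_lessD[OF lt] by blast
  obtain r where r: "r \<in> mseqs" "B \<subseteq> (\<Union>n. cylinder (r n))" "weight r < measure_in M B + ennreal (\<epsilon> / 2)"
    using measure_in_lessD[OF lt] by blast
  define A' where "A' = {x \<in> cantor M. \<exists>n. x \<in> cylinder (s n)}"
  define B' where "B' = {x \<in> cantor M. \<exists>n. x \<in> cylinder (r n)}"
  have "dft (\<lambda>e. set_code A')" "dft (\<lambda>e. set_code B')"
    unfolding A'_def B'_def by (intro dfi mseqsD[OF s(1)] mseqsD[OF r(1)])+
  then have AB: "set_code A' \<in> M" "set_code B' \<in> M"
    using dft_M[of _ "\<lambda>_. hempty"] hempty_M by fastforce+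
  define f where "f n = (if n = 0 then A' else if n = 1 then B' else {})" for n :: nat
  have "seqc (\<lambda>n. set_code {}) \<in> M"
    by (rule seqcI) (simp add: set_code_def hempty_def[symmetric], rule dft_hempty)
  from seqc_update[OF seqc_update[OF this AB(2), of 1] AB(1), of 0]
  have "seqc (((\<lambda>n. set_code {})(1 := set_code B'))(0 := set_code A')) \<in> M" .
  moreover have "((\<lambda>n. set_code {})(1 := set_code B'))(0 := set_code A') = (\<lambda>n. set_code (f n))"
    by (auto simp: f_def)
  ultimately have "sets_code f \<in> M" by simp
  then have "measure_in M (\<Union>n. f n) \<le> (\<Sum>n. measure_in M (f n))"
    by (intro measure_in_UN_le) (auto simp: f_def A'_def B'_def)
  also have "\<dots> = (\<Sum>n\<in>{0, 1}. measure_in M (f n))"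
    by (rule suminf_finite) (auto simp: f_def)
  also have "\<dots> = measure_in M A' + measure_in M B'" by (simp add: f_def)
  also have "\<dots> \<le> weight s + weight r"
    by (intro add_mono measure_in_le s r) (auto simp: A'_def B'_def)
  also have "\<dots> \<le> (measure_in M A + ennreal (\<epsilon> / 2)) + (measure_in M B + ennreal (\<epsilon> / 2))"
    using s(3) r(3) by (intro add_mono) auto
  also have "\<dots> = measure_in M A + measure_in M B + (ennreal (\<epsilon> / 2) + ennreal (\<epsilon> / 2))"
    by (simp add: ac_simps)
  also have "ennreal (\<epsilon> / 2) + ennreal (\<epsilon> / 2) = ennreal \<epsilon>"
    using \<epsilon> by (simp flip: ennreal_plus)
  finally have "measure_in M (\<Union>n. f n) \<le> measure_in M A + measure_in M B + ennreal \<epsilon>" .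
  moreover have "measure_in M (A \<union> B) \<le> measure_in M (\<Union>n. f n)"
  proof (rule measure_in_mono)
    have "A \<subseteq> A'" "B \<subseteq> B'" using assms s(2) r(2) by (auto simp: A'_def B'_def)
    then show "A \<union> B \<subseteq> (\<Union>n. f n)" by (auto simp: f_def intro: exI[of _ 0] exI[of _ 1])
  qed
  ultimately show "measure_in M (A \<union> B) \<le> measure_in M A + measure_in M B + ennreal \<epsilon>"
    by (rule order_trans[rotated])
qed

text \<open>A decomposition into cylinders bounds the measure in M from above, for \<open>K\<close>
  and for its complement. Both upper bounds add up to 1, the measure of \<open>cantor M\<close>, so
  they are attained.\<close>

lemma measure_in_clopen:
  assumes "clopen K"
  shows "measure_in M (K \<inter> cantor M) = emeasure cantor_measure K"
proof (rule antisym)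
  have le: "measure_in M (K \<inter> cantor M) \<le> emeasure cantor_measure K" if "clopen K" for K
    using that
  proof (rule clopen_decompose)
    fix ts assume "K = (\<Union>t\<in>set ts. cylinder t)"
      "emeasure cantor_measure K = ennreal (\<Sum>t\<leftarrow>ts. (1 / 2) ^ length t)"
    then show ?thesis using measure_in_list[of "K \<inter> cantor M" ts] by auto
  qed
  show "measure_in M (K \<inter> cantor M) \<le> emeasure cantor_measure K" using le[OF assms] .
  have "emeasure cantor_measure K + emeasure cantor_measure (- K) = emeasure cantor_measure (K \<union> - K)"
    by (rule plus_emeasure) (auto intro: sets_clopen assms clopen_Compl)
  also have "\<dots> = measure_in M (K \<inter> cantor M \<union> - K \<inter> cantor M)"
    by (simp add: measure_in_cantor flip: Int_Un_distrib2)
  also have "\<dots> \<le> measure_in M (K \<inter> cantor M) + measure_in M (- K \<inter> cantor M)"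
    by (rule measure_in_Un_le) auto
  also have "\<dots> \<le> measure_in M (K \<inter> cantor M) + emeasure cantor_measure (- K)"
    by (intro add_left_mono le clopen_Compl assms)
  finally have *: "emeasure cantor_measure K + emeasure cantor_measure (- K) \<le>
      measure_in M (K \<inter> cantor M) + emeasure cantor_measure (- K)" .
  have "emeasure cantor_measure (- K) \<noteq> \<infinity>"
    using finite_measure.emeasure_finite[OF prob_space.finite_measure[OF prob_space_cantor_measure]] by simp
  then show "emeasure cantor_measure K \<le> measure_in M (K \<inter> cantor M)"
    using * unfolding add.commute[of _ "emeasure cantor_measure (- K)"] ennreal_add_left_cancel_le
    by (auto simp: infinity_ennreal_def)
qed

text \<open>\<open>X\<close> in the model and \<open>Y\<close> outside are approximated by the same clopen sets. This relation
  links the measure computed in the model with the real one and is preserved by the Borel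
  operations, although the inclusion of \<open>X\<close> in \<open>Y\<close> is not expressible in the model.\<close>

definition companion :: "(nat \<Rightarrow> bool) set \<Rightarrow> (nat \<Rightarrow> bool) set \<Rightarrow> bool" where
  "companion X Y \<longleftrightarrow> X \<subseteq> cantor M \<and> Y \<in> sets cantor_measure \<and>
    (\<forall>\<epsilon>>0. \<exists>K. clopen K \<and> measure_in M (sym_diff X (K \<inter> cantor M)) \<le> ennreal \<epsilon> \<and>
      emeasure cantor_measure (sym_diff Y K) \<le> ennreal \<epsilon>)"

text \<open>A common clopen approximation \<open>K\<close> has the same measure on both sides, and
  \<open>X\<close> and \<open>Y\<close> each differ from it by at most \<epsilon>/2.\<close>

lemma companion_measure:
  assumes "companion X Y"
  shows "measure_in M X = emeasure cantor_measure Y"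
proof (rule antisym)
  have X: "X \<subseteq> cantor M" and Y: "Y \<in> sets cantor_measure"
    using assms by (auto simp: companion_def)
  show "measure_in M X \<le> emeasure cantor_measure Y"
  proof (rule ennreal_le_epsilon)
    fix \<epsilon> :: real assume "0 < \<epsilon>"
    then obtain K where K: "clopen K" "measure_in M (sym_diff X (K \<inter> cantor M)) \<le> ennreal (\<epsilon> / 2)"
      "emeasure cantor_measure (sym_diff Y K) \<le> ennreal (\<epsilon> / 2)"
      using assms[unfolded companion_def] by (meson half_gt_zero)
    have "measure_in M X \<le> measure_in M (sym_diff X (K \<inter> cantor M) \<union> K \<inter> cantor M)"
      by (rule measure_in_mono) auto
    also have "\<dots> \<le> measure_in M (sym_diff X (K \<inter> cantor M)) + measure_in M (K \<inter> cantor M)"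
      using X by (intro measure_in_Un_le) auto
    also have "\<dots> \<le> ennreal (\<epsilon> / 2) + emeasure cantor_measure (Y \<union> sym_diff Y K)"
      unfolding measure_in_clopen[OF K(1)]
      by (intro add_mono K emeasure_mono sets.Un sets_sym_diff Y sets_clopen[OF K(1)]) auto
    also have "\<dots> \<le> ennreal (\<epsilon> / 2) + (emeasure cantor_measure Y + emeasure cantor_measure (sym_diff Y K))"
      by (intro add_left_mono emeasure_subadditive sets_sym_diff Y sets_clopen[OF K(1)])
    also have "\<dots> \<le> ennreal (\<epsilon> / 2) + (emeasure cantor_measure Y + ennreal (\<epsilon> / 2))"
      by (intro add_left_mono K)
    also have "\<dots> = emeasure cantor_measure Y + (ennreal (\<epsilon> / 2) + ennreal (\<epsilon> / 2))"
      by (simp add: ac_simps)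
    also have "ennreal (\<epsilon> / 2) + ennreal (\<epsilon> / 2) = ennreal \<epsilon>"
      using \<open>0 < \<epsilon>\<close> by (simp flip: ennreal_plus)
    finally show "measure_in M X \<le> emeasure cantor_measure Y + ennreal \<epsilon>" .
  qed
  show "emeasure cantor_measure Y \<le> measure_in M X"
  proof (rule ennreal_le_epsilon)
    fix \<epsilon> :: real assume "0 < \<epsilon>"
    then obtain K where K: "clopen K" "measure_in M (sym_diff X (K \<inter> cantor M)) \<le> ennreal (\<epsilon> / 2)"
      "emeasure cantor_measure (sym_diff Y K) \<le> ennreal (\<epsilon> / 2)"
      using assms[unfolded companion_def] by (meson half_gt_zero)
    have "emeasure cantor_measure Y \<le> emeasure cantor_measure (sym_diff Y K \<union> K)"
      by (intro emeasure_mono sets.Un sets_sym_diff Y sets_clopen[OF K(1)]) auto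
    also have "\<dots> \<le> emeasure cantor_measure (sym_diff Y K) + emeasure cantor_measure K"
      by (intro emeasure_subadditive sets_sym_diff Y sets_clopen[OF K(1)])
    also have "\<dots> \<le> ennreal (\<epsilon> / 2) + measure_in M (X \<union> sym_diff X (K \<inter> cantor M))"
      unfolding measure_in_clopen[OF K(1), symmetric]
      by (intro add_mono K measure_in_mono) auto
    also have "\<dots> \<le> ennreal (\<epsilon> / 2) + (measure_in M X + measure_in M (sym_diff X (K \<inter> cantor M)))"
      using X by (intro add_left_mono measure_in_Un_le) auto
    also have "\<dots> \<le> ennreal (\<epsilon> / 2) + (measure_in M X + ennreal (\<epsilon> / 2))"
      by (intro add_left_mono K)
    also have "\<dots> = measure_in M X + (ennreal (\<epsilon> / 2) + ennreal (\<epsilon> / 2))"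
      by (simp add: ac_simps)
    also have "ennreal (\<epsilon> / 2) + ennreal (\<epsilon> / 2) = ennreal \<epsilon>"
      using \<open>0 < \<epsilon>\<close> by (simp flip: ennreal_plus)
    finally show "emeasure cantor_measure Y \<le> measure_in M X + ennreal \<epsilon>" .
  qed
qed

lemma companion_clopen: "clopen K \<Longrightarrow> companion (K \<inter> cantor M) K"
  unfolding companion_def by (auto simp: sets_clopen intro!: exI[of _ K])

lemma companion_Diff: "companion X Y \<Longrightarrow> companion (cantor M - X) (UNIV - Y)"
  unfolding companion_def
proof (elim conjE, intro conjI allI impI)
  fix \<epsilon> :: real assume X: "X \<subseteq> cantor M" and "0 < \<epsilon>"
    and "\<forall>\<epsilon>>0. \<exists>K. clopen K \<and> measure_in M (sym_diff X (K \<inter> cantor M)) \<le> ennreal \<epsilon> \<and>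
      emeasure cantor_measure (sym_diff Y K) \<le> ennreal \<epsilon>"
  then obtain K where K: "clopen K" "measure_in M (sym_diff X (K \<inter> cantor M)) \<le> ennreal \<epsilon>"
      "emeasure cantor_measure (sym_diff Y K) \<le> ennreal \<epsilon>" by blast
  have "sym_diff (cantor M - X) (- K \<inter> cantor M) = sym_diff X (K \<inter> cantor M)"
    "sym_diff (UNIV - Y) (- K) = sym_diff Y K"
    using X by auto
  then show "\<exists>K. clopen K \<and> measure_in M (sym_diff (cantor M - X) (K \<inter> cantor M)) \<le> ennreal \<epsilon> \<and>
      emeasure cantor_measure (sym_diff (UNIV - Y) K) \<le> ennreal \<epsilon>"
    using K clopen_Compl by (intro exI[of _ "- K"]) simp
qed (use sets.compl_sets[of Y cantor_measure] in auto)

lemma companion_Un: "companion X Y \<Longrightarrow> companion X' Y' \<Longrightarrow> companion (X \<union> X') (Y \<union> Y')"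
  unfolding companion_def
proof (elim conjE, intro conjI allI impI)
  fix \<epsilon> :: real assume XX: "X \<subseteq> cantor M" "X' \<subseteq> cantor M" "Y \<in> sets cantor_measure"
      "Y' \<in> sets cantor_measure" and e: "0 < \<epsilon>"
    and *: "\<forall>\<epsilon>>0. \<exists>K. clopen K \<and> measure_in M (sym_diff X (K \<inter> cantor M)) \<le> ennreal \<epsilon> \<and>
      emeasure cantor_measure (sym_diff Y K) \<le> ennreal \<epsilon>"
      "\<forall>\<epsilon>>0. \<exists>K. clopen K \<and> measure_in M (sym_diff X' (K \<inter> cantor M)) \<le> ennreal \<epsilon> \<and>
      emeasure cantor_measure (sym_diff Y' K) \<le> ennreal \<epsilon>"
  have e2: "0 < \<epsilon> / 2" using e by simp
  obtain K where K: "clopen K" "measure_in M (sym_diff X (K \<inter> cantor M)) \<le> ennreal (\<epsilon> / 2)"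
      "emeasure cantor_measure (sym_diff Y K) \<le> ennreal (\<epsilon> / 2)" using *(1) e2 by blast
  obtain L where L: "clopen L" "measure_in M (sym_diff X' (L \<inter> cantor M)) \<le> ennreal (\<epsilon> / 2)"
      "emeasure cantor_measure (sym_diff Y' L) \<le> ennreal (\<epsilon> / 2)" using *(2) e2 by blast
  have ee: "ennreal (\<epsilon> / 2) + ennreal (\<epsilon> / 2) = ennreal \<epsilon>"
    using e by (simp flip: ennreal_plus)
  have "measure_in M (sym_diff (X \<union> X') ((K \<union> L) \<inter> cantor M)) \<le>
      measure_in M (sym_diff X (K \<inter> cantor M) \<union> sym_diff X' (L \<inter> cantor M))"
    by (rule measure_in_mono) auto
  also have "\<dots> \<le> measure_in M (sym_diff X (K \<inter> cantor M)) + measure_in M (sym_diff X' (L \<inter> cantor M))"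
    using XX by (intro measure_in_Un_le) auto
  also have "\<dots> \<le> ennreal \<epsilon>" unfolding ee[symmetric] by (intro add_mono K L)
  finally have 1: "measure_in M (sym_diff (X \<union> X') ((K \<union> L) \<inter> cantor M)) \<le> ennreal \<epsilon>" .
  have "emeasure cantor_measure (sym_diff (Y \<union> Y') (K \<union> L)) \<le>
      emeasure cantor_measure (sym_diff Y K \<union> sym_diff Y' L)"
    by (intro emeasure_mono sets.Un sets_sym_diff XX sets_clopen[OF K(1)] sets_clopen[OF L(1)]) auto
  also have "\<dots> \<le> emeasure cantor_measure (sym_diff Y K) + emeasure cantor_measure (sym_diff Y' L)"
    by (intro emeasure_subadditive sets_sym_diff XX sets_clopen[OF K(1)] sets_clopen[OF L(1)])
  also have "\<dots> \<le> ennreal \<epsilon>" unfolding ee[symmetric] by (intro add_mono K L)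
  finally show "\<exists>K. clopen K \<and> measure_in M (sym_diff (X \<union> X') (K \<inter> cantor M)) \<le> ennreal \<epsilon> \<and>
      emeasure cantor_measure (sym_diff (Y \<union> Y') K) \<le> ennreal \<epsilon>"
    using 1 clopen_Un[OF K(1) L(1)] by blast
qed auto

lemma companion_Int: "companion X Y \<Longrightarrow> companion X' Y' \<Longrightarrow> companion (X \<inter> X') (Y \<inter> Y')"
proof -
  assume c: "companion X Y" "companion X' Y'"
  then have "X \<subseteq> cantor M" "X' \<subseteq> cantor M" by (auto simp: companion_def)
  then have "X \<inter> X' = cantor M - ((cantor M - X) \<union> (cantor M - X'))"
    "Y \<inter> Y' = UNIV - ((UNIV - Y) \<union> (UNIV - Y'))" by auto
  then show ?thesis using companion_Diff[OF companion_Un[OF companion_Diff[OF c(1)] companion_Diff[OF c(2)]]]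
    by simp
qed

lemma companion_minus: "companion X Y \<Longrightarrow> companion X' Y' \<Longrightarrow> companion (X - X') (Y - Y')"
proof -
  assume c: "companion X Y" "companion X' Y'"
  then have "X - X' = X \<inter> (cantor M - X')" "Y - Y' = Y \<inter> (UNIV - Y')" by (auto simp: companion_def)
  then show ?thesis using companion_Int[OF c(1) companion_Diff[OF c(2)]] by simp
qed

lemma companion_empty: "companion {} {}"
  using companion_clopen[of "{}"] by (simp add: clopen_def)

lemma companion_UN_finite:
  "(\<And>i. i < n \<Longrightarrow> companion (X i) (Y i)) \<Longrightarrow> companion (\<Union>i<n. X i) (\<Union>i<n. Y i)" for n :: nat
proof (induction n)
  case (Suc n)
  then show ?case using companion_Un[of "X n" "Y n" "\<Union>i<n. X i" "\<Union>i<n. Y i"]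
    by (simp add: lessThan_Suc)
qed (simp add: companion_empty)

lemma sets_codeD:
  assumes "sets_code X \<in> M" "\<And>n. X n \<subseteq> cantor M" "dft (\<lambda>e. real_code (x e))" "dft (\<lambda>e. num (n e))"
  shows "dfp (\<lambda>e. x e \<in> X (n e))"
  by (rule dfp_mem_set[OF _ assms(3) seqcD[OF assms(1,4)]]) (rule countable_sub_cantor[OF assms(2)])

text \<open>Finitely many sets are handled by finite unions; the point is a small tail on both
  sides. Outside, the disjointed sets \<open>Z n\<close> have summable measure. Each
  \<open>E n\<close> is a companion of \<open>Z n\<close> and so has the same measure, which bounds
  the tail in M by countable subadditivity there.\<close>

lemma companion_UN:
  assumes c: "\<And>n. companion (X n) (Y n)" and XM: "sets_code X \<in> M"
  shows "companion (\<Union>n. X n) (\<Union>n. Y n)"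
  unfolding companion_def
proof (intro conjI allI impI)
  have XC: "X n \<subseteq> cantor M" and YS: "Y n \<in> sets cantor_measure" for n
    using c[of n] by (auto simp: companion_def)
  show "(\<Union>n. X n) \<subseteq> cantor M" using XC by blast
  show YU: "(\<Union>n. Y n) \<in> sets cantor_measure" using YS by auto
  fix \<epsilon> :: real assume e: "0 < \<epsilon>"
  have ee: "ennreal (\<epsilon> / 2) + ennreal (\<epsilon> / 2) = ennreal \<epsilon>"
    using e by (simp flip: ennreal_plus)
  define E where "E n = X n - (\<Union>j<n. X j)" for n
  define Z where "Z n = Y n - (\<Union>j<n. Y j)" for n
  have EZ: "companion (E n) (Z n)" for n
    unfolding E_def Z_def by (intro companion_minus companion_UN_finite c)
  have ZS: "Z n \<in> sets cantor_measure" for n using EZ[of n] by (simp add: companion_def)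
  have EC: "E n \<subseteq> cantor M" for n using XC by (auto simp: E_def)
  have EM: "sets_code (\<lambda>n. E (n + N)) \<in> M" for N
  proof (rule seqcI)
    have "E n = {x \<in> cantor M. x \<in> X n \<and> \<not> (\<exists>j. j < n \<and> x \<in> X j)}" for n
      using XC by (auto simp: E_def)
    then show "dft (\<lambda>e. set_code (E (unnum (e 0) + N)))"
      by (simp only:) (intro dfi num_M sets_codeD[OF XM XC])
  qed
  interpret mu: prob_space cantor_measure by (rule prob_space_cantor_measure)
  have "disjoint_family Z"
    unfolding disjoint_family_on_def
  proof (intro ballI impI)
    fix m n :: nat assume "m \<noteq> n"
    then show "Z m \<inter> Z n = {}" unfolding Z_def by (cases "m < n") auto
  qed
  then have "summable (\<lambda>n. measure cantor_measure (Z n))"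
    using mu.finite_measure_UNION[of Z] ZS by (auto simp: sums_iff)
  then have sm: "summable (\<lambda>i. measure cantor_measure (Z (i + N)))" for N
    by (rule summable_ignore_initial_segment)
  obtain N where N: "norm (\<Sum>i. measure cantor_measure (Z (i + N))) < \<epsilon> / 2"
    using suminf_exist_split[of "\<epsilon> / 2" "\<lambda>n. measure cantor_measure (Z n)"] e
      \<open>summable (\<lambda>n. measure cantor_measure (Z n))\<close> by auto
  have tail: "(\<Sum>i. emeasure cantor_measure (Z (i + N))) \<le> ennreal (\<epsilon> / 2)"
  proof -
    have "(\<Sum>i. emeasure cantor_measure (Z (i + N))) = ennreal (\<Sum>i. measure cantor_measure (Z (i + N)))"
      unfolding mu.emeasure_eq_measure by (rule suminf_ennreal2[OF _ sm]) simp
    then show ?thesis using N by (auto intro!: ennreal_leI)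
  qed
  have "companion (\<Union>i<N. X i) (\<Union>i<N. Y i)" by (intro companion_UN_finite c)
  moreover have "0 < \<epsilon> / 2" using e by simp
  ultimately obtain K where K: "clopen K"
    "measure_in M (sym_diff (\<Union>i<N. X i) (K \<inter> cantor M)) \<le> ennreal (\<epsilon> / 2)"
    "emeasure cantor_measure (sym_diff (\<Union>i<N. Y i) K) \<le> ennreal (\<epsilon> / 2)"
    unfolding companion_def by blast
  \<comment> \<open>Consider the least index whose set contains \<open>x\<close>: below
    \<open>N\<close> the point lies in the finite union, otherwise in a member of the disjointed
    tail.\<close>
  have cover: "x \<in> (\<Union>i<N. A i) \<union> (\<Union>i. A (i + N) - (\<Union>j<i + N. A j))" if "x \<in> (\<Union>n. A n)"
    for x and A :: "nat \<Rightarrow> (nat \<Rightarrow> bool) set"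
  proof -
    define n where "n = (LEAST n. x \<in> A n)"
    have n: "x \<in> A n" "\<And>j. j < n \<Longrightarrow> x \<notin> A j"
      unfolding n_def using that by (auto intro: LeastI dest: not_less_Least)
    show ?thesis
    proof (cases "n < N")
      case False
      then have "x \<in> A ((n - N) + N) - (\<Union>j<(n - N) + N. A j)" using n by auto
      then show ?thesis by blast
    qed (use n in blast)
  qed
  have "measure_in M (sym_diff (\<Union>n. X n) (K \<inter> cantor M)) \<le>
      measure_in M (sym_diff (\<Union>i<N. X i) (K \<inter> cantor M) \<union> (\<Union>i. E (i + N)))"
  proof (rule measure_in_mono)
    have "(\<Union>n. X n) \<subseteq> (\<Union>i<N. X i) \<union> (\<Union>i. E (i + N))"
      using cover[of _ X] unfolding E_def by (rule subsetI)
    then show "sym_diff (\<Union>n. X n) (K \<inter> cantor M) \<subseteq>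
        sym_diff (\<Union>i<N. X i) (K \<inter> cantor M) \<union> (\<Union>i. E (i + N))"
      using EC by blast
  qed
  also have "\<dots> \<le> measure_in M (sym_diff (\<Union>i<N. X i) (K \<inter> cantor M)) + measure_in M (\<Union>i. E (i + N))"
    using XC EC by (intro measure_in_Un_le) auto
  also have "measure_in M (\<Union>i. E (i + N)) \<le> (\<Sum>i. measure_in M (E (i + N)))"
    by (rule measure_in_UN_le[OF EC EM])
  also have "\<dots> = (\<Sum>i. emeasure cantor_measure (Z (i + N)))"
    using companion_measure[OF EZ] by simp
  also note tail
  also note K(2)
  finally have 1: "measure_in M (sym_diff (\<Union>n. X n) (K \<inter> cantor M)) \<le> ennreal \<epsilon>"
    unfolding ee by (simp add: add_left_mono add_right_mono)
  have "emeasure cantor_measure (sym_diff (\<Union>n. Y n) K) \<le>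
      emeasure cantor_measure (sym_diff (\<Union>i<N. Y i) K \<union> (\<Union>i. Z (i + N)))"
  proof (rule emeasure_mono)
    have "(\<Union>n. Y n) \<subseteq> (\<Union>i<N. Y i) \<union> (\<Union>i. Z (i + N))"
      using cover[of _ Y] unfolding Z_def by (rule subsetI)
    then show "sym_diff (\<Union>n. Y n) K \<subseteq> sym_diff (\<Union>i<N. Y i) K \<union> (\<Union>i. Z (i + N))"
      by blast
  qed (use ZS YS sets_clopen[OF K(1)] in auto)
  also have "\<dots> \<le> emeasure cantor_measure (sym_diff (\<Union>i<N. Y i) K) + emeasure cantor_measure (\<Union>i. Z (i + N))"
    using ZS YS sets_clopen[OF K(1)] by (intro emeasure_subadditive) auto
  also have "emeasure cantor_measure (\<Union>i. Z (i + N)) \<le> (\<Sum>i. emeasure cantor_measure (Z (i + N)))"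
    using ZS by (intro emeasure_subadditive_countably) auto
  also note tail
  also note K(3)
  finally have 2: "emeasure cantor_measure (sym_diff (\<Union>n. Y n) K) \<le> ennreal \<epsilon>"
    unfolding ee by (simp add: add_left_mono add_right_mono)
  show "\<exists>K. clopen K \<and> measure_in M (sym_diff (\<Union>n. X n) (K \<inter> cantor M)) \<le> ennreal \<epsilon> \<and>
      emeasure cantor_measure (sym_diff (\<Union>n. Y n) K) \<le> ennreal \<epsilon>"
    using 1 2 K(1) by blast
qed

text \<open>Instead of an arithmetic coding of strings, a finite enumeration is chosen in M for each
  length, and the enumerations are merged by the pairing function.\<close>

lemma string_enumeration: "\<exists>u\<in>mseqs. range u = UNIV"
proof -
  have "\<exists>h. (\<forall>n. \<forall>t. length t = n \<longrightarrow> (\<exists>i. unseq (h n) i = t)) \<and> seqc h \<in> M"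
  proof (rule model_choice)
    have "dfp (\<lambda>e. \<forall>t. length t = unnum (e 0) \<longrightarrow>
        (\<exists>i. string_code (unseq (e (Suc 0)) i) = string_code t))"
      by (intro dfi)
    then show "dfp (\<lambda>e. \<forall>t. length t = unnum (e 0) \<longrightarrow> (\<exists>i. unseq (e 1) i = t))" by simp
    fix n
    have "finite {t :: bool list. length t = n}" using finite_lists_length_eq[of "UNIV :: bool set" n] by simp
    then obtain ts where ts: "set ts = {t :: bool list. length t = n}" using finite_list by blast
    have "seqc (\<lambda>n. string_code []) \<in> M" by (intro seqcI dfi)
    then have "seqc (\<lambda>i. if i < length ts then string_code (ts ! i) else string_code []) \<in> M"
      by (rule seqc_finite) (rule string_code_M)
    moreover have "\<exists>i. unseq (seqc (\<lambda>i. if i < length ts then string_code (ts ! i) else string_code [])) i = t"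
      if "length t = n" for t
    proof -
      have "t \<in> set ts" using ts that by simp
      then obtain i where "i < length ts" "ts ! i = t" by (metis in_set_conv_nth)
      then show ?thesis by (intro exI[of _ i]) (simp add: unseq_def)
    qed
    ultimately show "\<exists>y\<in>M. \<forall>t. length t = n \<longrightarrow> (\<exists>i. unseq y i = t)" by blast
  qed
  then obtain h where h: "\<And>t. \<exists>i. unseq (h (length t)) i = t" "seqc h \<in> M" by blast
  define u where "u m = unseq (h (fst (prod_decode m))) (snd (prod_decode m))" for m
  have "u \<in> mseqs" unfolding u_def by (intro mseqsI dfi seqcD[OF h(2)])
  moreover have "t \<in> range u" for t
  proof -
    obtain i where "unseq (h (length t)) i = t" using h(1) by blast
    then have "u (prod_encode (length t, i)) = t" by (simp add: u_def)
    then show ?thesis by (metis rangeI)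
  qed
  ultimately show ?thesis by blast
qed

end

section \<open>Borel codes\<close>

text \<open>Well-founded recursion of HOL brought into the form that \<open>wf_rec\<close> expects:
  the step receives the earlier values as one set, namely their graph on \<open>d x\<close>.\<close>

definition rec_along :: "(hc \<Rightarrow> hc) \<Rightarrow> (hc \<Rightarrow> hc \<Rightarrow> hc) \<Rightarrow> hc \<Rightarrow> hc" where
  "rec_along d H = wfrec {(y, x). y \<in> elts (d x)}
    (\<lambda>f x. H x (hset ((\<lambda>y. kpair y (f y)) ` elts (d x))))"

lemma rec_along:
  assumes "wf {(y, x). y \<in> elts (d x)}"
  shows "rec_along d H x = H x (hset ((\<lambda>y. kpair y (rec_along d H y)) ` elts (d x)))"
proof -
  have "rec_along d H x = H x (hset ((\<lambda>y. kpair y (cut (rec_along d H) {(y, x). y \<in> elts (d x)} x y)) ` elts (d x)))"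
    unfolding rec_along_def by (subst wfrec[OF assms]) (rule refl)
  also have "(\<lambda>y. kpair y (cut (rec_along d H) {(y, x). y \<in> elts (d x)} x y)) ` elts (d x) =
      (\<lambda>y. kpair y (rec_along d H y)) ` elts (d x)"
    by (rule image_cong) (auto simp: cut_apply)
  finally show ?thesis .
qed

lemma app_graph:
  assumes "y \<in> elts a"
  shows "app (hset ((\<lambda>y. kpair y (f y)) ` elts a)) y = f y"
proof -
  have e: "elts (hset ((\<lambda>y. kpair y (f y)) ` elts a)) = (\<lambda>y. kpair y (f y)) ` elts a"
    by (simp add: elts_hset countable_elts)
  show ?thesis
  proof (rule app_eq)
    show "kpair y (f y) \<in> elts (hset ((\<lambda>y. kpair y (f y)) ` elts a))" unfolding e using assms by blast
    fix y' assume "kpair y y' \<in> elts (hset ((\<lambda>y. kpair y (f y)) ` elts a))"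
    then show "y' = f y" unfolding e by (auto simp: kpair_inject)
  qed
qed

lemma mem_relI: "a \<in> elts b \<Longrightarrow> (a, b) \<in> mem_rel"
  by (simp add: mem_rel_def)

lemma snd_kpair_trancl: "(b, kpair a b) \<in> mem_rel\<^sup>+"
proof -
  have "(b, hset {a, b}) \<in> mem_rel" by (simp add: mem_rel_def elts_hset)
  moreover have "(hset {a, b}, kpair a b) \<in> mem_rel" by (simp add: mem_rel_def elts_kpair)
  ultimately show ?thesis by (meson r_into_trancl trancl_trans)
qed

lemma wf_trancl_mem: "(\<And>x y. y \<in> elts (d x) \<Longrightarrow> (y, x) \<in> mem_rel\<^sup>+) \<Longrightarrow> wf {(y, x). y \<in> elts (d x)}"
  by (rule wf_subset[OF wf_trancl[OF wf_mem_rel]]) auto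

text \<open>The default value of \<open>hfst\<close> is the empty set, which is the numeral 0; a
  positive tag can thus only come from a genuine pair.\<close>

lemma hfst_num_eq: "hfst c = num (Suc k) \<Longrightarrow> c = kpair (num (Suc k)) (hsnd c)"
proof -
  assume c: "hfst c = num (Suc k)"
  have "num (Suc k) \<noteq> hempty" unfolding num_0[symmetric] num_inject by simp
  then have "\<exists>a b. c = kpair a b" using c by (rule_tac ccontr) (simp add: hfst_def)
  then show ?thesis using c by auto
qed

definition subcodes :: "hc \<Rightarrow> hc" where
  "subcodes c = (if hfst c = num (Suc 0) then hset {hsnd c}
    else if hfst c = num (Suc (Suc 0)) then
      hset (hsnd ` elts (hset {z \<in> elts (hsnd c). z = kpair (hfst z) (hsnd z)}))
    else hempty)"

lemma wf_subcodes: "wf {(y, x). y \<in> elts (subcodes x)}"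
proof (rule wf_trancl_mem)
  fix x y assume y: "y \<in> elts (subcodes x)"
  consider (1) "hfst x = num (Suc 0)" | (2) "hfst x = num (Suc (Suc 0))"
    using y unfolding subcodes_def by (auto split: if_splits)
  then show "(y, x) \<in> mem_rel\<^sup>+"
  proof cases
    case 1
    then have "x = kpair (num (Suc 0)) (hsnd x)" by (rule hfst_num_eq)
    moreover have "y = hsnd x" using y 1 by (simp add: subcodes_def elts_hset)
    ultimately show ?thesis using snd_kpair_trancl by metis
  next
    case 2
    then have x: "x = kpair (num (Suc (Suc 0))) (hsnd x)" by (rule hfst_num_eq)
    have "y \<in> hsnd ` {z \<in> elts (hsnd x). z = kpair (hfst z) (hsnd z)}"
      using y 2 by (simp add: subcodes_def elts_hset countable_elts num_inject)
    then obtain z where z: "z \<in> elts (hsnd x)" "z = kpair (hfst z) (hsnd z)" "y = hsnd z" by blast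
    have "(y, z) \<in> mem_rel\<^sup>+" unfolding z(3) using z(2) snd_kpair_trancl by metis
    moreover have "(z, hsnd x) \<in> mem_rel\<^sup>+" using z(1) by (intro r_into_trancl mem_relI)
    moreover have "(hsnd x, x) \<in> mem_rel\<^sup>+" using x snd_kpair_trancl by metis
    ultimately show ?thesis by (meson trancl_trans)
  qed
qed

lemma bcode_code_simps:
  "bcode_code (BCyl s) = kpair (num 0) (string_code s)"
  "bcode_code (BCompl c) = kpair (num (Suc 0)) (bcode_code c)"
  "bcode_code (BUnion f) = kpair (num (Suc (Suc 0))) (seqc (\<lambda>n. bcode_code (f n)))"
  by (simp_all add: seqc_def numeral_2_eq_2)

lemma bcode_code_inject: "bcode_code c = bcode_code c' \<Longrightarrow> c = c'"
proof (induction c arbitrary: c')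
  case (BCyl s)
  then show ?case by (cases c') (simp_all only: bcode_code_simps kpair_inject num_inject string_code_inject, simp_all)
next
  case (BCompl c)
  then show ?case by (cases c') (auto simp only: bcode_code_simps kpair_inject num_inject nat.simps)
next
  case (BUnion f)
  show ?case
  proof (cases c')
    case (BUnion g)
    then have "(\<lambda>n. bcode_code (f n)) = (\<lambda>n. bcode_code (g n))"
      using BUnion.prems by (simp only: bcode_code_simps kpair_inject seqc_inject)
    then have "f n = g n" for n using BUnion.IH[of "f n" "g n"] by (metis rangeI)
    then show ?thesis using BUnion by auto
  qed (use BUnion.prems in \<open>auto simp only: bcode_code_simps kpair_inject num_inject nat.simps\<close>)
qed

lemma subcodes_simps:
  "elts (subcodes (bcode_code (BCyl s))) = {}"
  "elts (subcodes (bcode_code (BCompl c))) = {bcode_code c}"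
  "elts (subcodes (kpair (num (Suc (Suc 0))) (seqc h))) = range h"
proof -
  show "elts (subcodes (bcode_code (BCyl s))) = {}"
    by (simp only: bcode_code_simps subcodes_def hfst_kpair num_inject) simp
  show "elts (subcodes (bcode_code (BCompl c))) = {bcode_code c}"
    by (simp only: bcode_code_simps subcodes_def hfst_kpair hsnd_kpair) (simp add: elts_hset)
  have "{z \<in> elts (seqc h). z = kpair (hfst z) (hsnd z)} = elts (seqc h)"
    by (auto simp: elts_seqc)
  then have "hset {z \<in> elts (seqc h). z = kpair (hfst z) (hsnd z)} = seqc h" by (simp only: hset_elts)
  then have "subcodes (kpair (num (Suc (Suc 0))) (seqc h)) = hset (hsnd ` elts (seqc h))"
    by (simp only: subcodes_def hfst_kpair hsnd_kpair num_inject) simp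
  then show "elts (subcodes (kpair (num (Suc (Suc 0))) (seqc h))) = range h"
    by (simp add: elts_hset countable_elts elts_seqc image_image)
qed

context ctm
begin

section \<open>Evaluation of codes inside the model\<close>

lemma interp_sub: "interp (cantor M) c \<subseteq> cantor M"
  by (induction c) auto

lemma countable_interp: "countable (interp (cantor M) c)"
  by (rule countable_sub_cantor[OF interp_sub])

text \<open>The value of a code \<open>c\<close> is a singleton, and it is empty if \<open>c\<close> is not a code.\<close>

definition eval_step :: "hc \<Rightarrow> hc \<Rightarrow> hc" where
  "eval_step c g =
    (if hfst c = num (Suc 0) then
       hset ((\<lambda>X. hset (elts (set_code (cantor M)) - elts X)) ` elts (app g (hsnd c)))
     else if hfst c = num (Suc (Suc 0)) then
       if hsnd c = hset ((\<lambda>x. kpair x (app (hsnd c) x)) ` elts omega) \<and>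
          (\<forall>x\<in>elts omega. app g (app (hsnd c) x) \<noteq> hempty)
       then hset {hset (\<Union>x\<in>elts omega. elts (hset (\<Union>X\<in>elts (app g (app (hsnd c) x)). elts X)))}
       else hempty
     else if hsnd c \<in> elts strs \<and> c = kpair (num 0) (hsnd c) then
       hset {hset {r \<in> elts (set_code (cantor M)). elts (hsnd c) \<subseteq> elts r}}
     else hempty)"

definition code_value :: "hc \<Rightarrow> hc" where
  "code_value = rec_along subcodes eval_step"

lemma code_value: "code_value c = eval_step c (hset ((\<lambda>y. kpair y (code_value y)) ` elts (subcodes c)))"
  unfolding code_value_def by (rule rec_along[OF wf_subcodes])

lemma dft_subcodes: "dft (\<lambda>e. subcodes (e 0))"
  unfolding subcodes_def by (intro dfi)

lemma dft_eval_step: "dft (\<lambda>e. eval_step (e 0) (e 1))"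
  unfolding eval_step_def by (intro dfi)

lemma dft_code_value [dfi]: "dft t \<Longrightarrow> dft (\<lambda>e. code_value (t e))"
proof -
  interpret wf_rec M subcodes eval_step code_value
    by unfold_locales (rule wf_subcodes code_value dft_subcodes dft_eval_step)+
  show "dft t \<Longrightarrow> dft (\<lambda>e. code_value (t e))" by (rule dft_rec)
qed

lemma code_value_bcode: "elts (code_value (bcode_code c)) = {set_code (interp (cantor M) c)}"
proof (induction c)
  case (BCyl s)
  have "{r \<in> elts (set_code (cantor M)). elts (string_code s) \<subseteq> elts r} =
      real_code ` interp (cantor M) (BCyl s)"
    unfolding elts_set_code[OF countable_cantor] by (auto simp: cylinder_iff)
  then have "hset {r \<in> elts (set_code (cantor M)). elts (string_code s) \<subseteq> elts r} =
      set_code (interp (cantor M) (BCyl s))" by (simp only: set_code_def)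
  then have "code_value (bcode_code (BCyl s)) = hset {set_code (interp (cantor M) (BCyl s))}"
    by (subst code_value) (simp only: bcode_code_simps eval_step_def hfst_kpair hsnd_kpair num_inject
        elts_strs rangeI simp_thms if_True if_False nat.simps)
  then show ?case by (simp only: elts_hset countable_finite finite.intros)
next
  case (BCompl c)
  let ?g = "hset ((\<lambda>y. kpair y (code_value y)) ` elts (subcodes (bcode_code (BCompl c))))"
  have g: "app ?g (bcode_code c) = code_value (bcode_code c)"
    by (rule app_graph) (simp only: subcodes_simps singletonI)
  have "elts (set_code (cantor M)) - elts (set_code (interp (cantor M) c)) =
      real_code ` interp (cantor M) (BCompl c)"
    unfolding elts_set_code[OF countable_cantor] elts_set_code[OF countable_interp]
    by (auto simp: image_iff)
  then have eq: "hset (elts (set_code (cantor M)) - elts (set_code (interp (cantor M) c))) =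
      set_code (interp (cantor M) (BCompl c))" by (simp only: set_code_def)
  have "code_value (bcode_code (BCompl c)) =
      hset ((\<lambda>X. hset (elts (set_code (cantor M)) - elts X)) ` elts (app ?g (bcode_code c)))"
    by (subst code_value, subst eval_step_def) (simp only: bcode_code_simps hfst_kpair hsnd_kpair simp_thms if_True)
  also have "\<dots> = hset {set_code (interp (cantor M) (BCompl c))}"
    unfolding g BCompl image_insert image_empty eq ..
  finally show ?case by (simp only: elts_hset countable_finite finite.intros)
next
  case (BUnion f)
  let ?c = "bcode_code (BUnion f)"
  let ?h = "\<lambda>n. bcode_code (f n)"
  let ?g = "hset ((\<lambda>y. kpair y (code_value y)) ` elts (subcodes ?c))"
  have g: "app ?g (app (seqc ?h) (num n)) = code_value (bcode_code (f n))" for n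
    unfolding app_seqc by (rule app_graph) (simp only: bcode_code_simps subcodes_simps, rule rangeI)
  have IH: "elts (code_value (bcode_code (f n))) = {set_code (interp (cantor M) (f n))}" for n
    using BUnion by blast
  have ne: "code_value (bcode_code (f n)) \<noteq> hempty" for n
    using IH[of n] by (metis elts_hempty insert_not_empty)
  have s: "seqc ?h = hset ((\<lambda>x. kpair x (app (seqc ?h) x)) ` elts omega)"
    unfolding seqc_def[of ?h] elts_omega image_image
    by (rule arg_cong[where f = hset]) (simp add: app_seqc[unfolded seqc_def])
  have "elts (hset (\<Union>X\<in>elts (app ?g (app (seqc ?h) (num n))). elts X)) = real_code ` interp (cantor M) (f n)" for n
    unfolding g IH by (simp add: elts_hset elts_set_code countable_interp)
  then have "(\<Union>x\<in>elts omega. elts (hset (\<Union>X\<in>elts (app ?g (app (seqc ?h) x)). elts X))) =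
      real_code ` interp (cantor M) (BUnion f)" by (simp add: image_UN)
  then have eq: "hset (\<Union>x\<in>elts omega. elts (hset (\<Union>X\<in>elts (app ?g (app (seqc ?h) x)). elts X))) =
      set_code (interp (cantor M) (BUnion f))" by (simp only: set_code_def)
  have hc: "hfst ?c = num (Suc (Suc 0))" "hsnd ?c = seqc ?h" by (simp_all only: bcode_code_simps hfst_kpair hsnd_kpair)
  have n12: "num (Suc (Suc 0)) \<noteq> num (Suc 0)" by simp
  have "\<forall>x\<in>elts omega. app ?g (app (seqc ?h) x) \<noteq> hempty"
    using g ne by simp
  with s have P: "seqc ?h = hset ((\<lambda>x. kpair x (app (seqc ?h) x)) ` elts omega) \<and>
    (\<forall>x\<in>elts omega. app ?g (app (seqc ?h) x) \<noteq> hempty)" by (rule conjI)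
  have "code_value ?c = hset {hset (\<Union>x\<in>elts omega. elts (hset (\<Union>X\<in>elts (app ?g (app (seqc ?h) x)). elts X)))}"
    by (subst code_value) (simp only: eval_step_def hc n12 if_False if_True if_P[OF P] simp_thms)
  then show ?case unfolding eq by (simp only: elts_hset countable_finite finite.intros)
qed

text \<open>A nonempty value certifies a code, which is the purpose of the singletons. Induction
  along \<open>subcodes\<close> rebuilds the datatype element, since true well-foundedness is
  available. Being the value of some code is thereby a formula over M.\<close>

lemma code_value_nonempty: "elts (code_value c) \<noteq> {} \<Longrightarrow> \<exists>b. c = bcode_code b"
proof (induction c rule: wf_induct_rule[OF wf_subcodes])
  case (1 c)
  let ?g = "hset ((\<lambda>y. kpair y (code_value y)) ` elts (subcodes c))"
  have ne: "eval_step c ?g \<noteq> hempty" using 1(2) code_value[of c] by (metis elts_hempty)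
  consider (1) "hfst c = num (Suc 0)" | (2) "hfst c = num (Suc (Suc 0))"
    | (0) "hfst c \<noteq> num (Suc 0)" "hfst c \<noteq> num (Suc (Suc 0))" by blast
  then show ?case
  proof cases
    case 1
    then have c: "c = kpair (num (Suc 0)) (hsnd c)" by (rule hfst_num_eq)
    have sc: "elts (subcodes c) = {hsnd c}" using 1 by (simp add: subcodes_def elts_hset)
    have g: "app ?g (hsnd c) = code_value (hsnd c)" by (rule app_graph) (simp only: sc singletonI)
    have "elts (code_value (hsnd c)) \<noteq> {}"
    proof
      assume "elts (code_value (hsnd c)) = {}"
      then have "eval_step c ?g = hempty"
        by (subst eval_step_def) (simp only: 1 g simp_thms if_True image_empty hempty_def)
      then show False using ne by simp
    qed
    then obtain b where "hsnd c = bcode_code b" using "1.IH"[of "hsnd c"] sc by auto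
    then have "c = bcode_code (BCompl b)" using c by (simp only: bcode_code_simps)
    then show ?thesis ..
  next
    case 2
    then have c: "c = kpair (num (Suc (Suc 0))) (hsnd c)" by (rule hfst_num_eq)
    have n12: "num (Suc (Suc 0)) \<noteq> num (Suc 0)" by simp
    have *: "hsnd c = hset ((\<lambda>x. kpair x (app (hsnd c) x)) ` elts omega) \<and>
          (\<forall>x\<in>elts omega. app ?g (app (hsnd c) x) \<noteq> hempty)"
    proof (rule ccontr)
      assume "\<not> ?thesis"
      then have "eval_step c ?g = hempty"
        by (subst eval_step_def) (simp only: 2 n12 simp_thms if_True if_False)
      then show False using ne by simp
    qed
    define h where "h n = app (hsnd c) (num n)" for n
    have "hset ((\<lambda>x. kpair x (app (hsnd c) x)) ` elts omega) = seqc h"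
      unfolding seqc_def h_def elts_omega image_image ..
    with * have s: "hsnd c = seqc h" by metis
    have sc: "elts (subcodes c) = range h" by (subst c, subst s) (rule subcodes_simps)
    have g: "app ?g (h n) = code_value (h n)" for n by (rule app_graph) (simp only: sc rangeI)
    have "\<exists>b. h n = bcode_code b" for n
    proof -
      have "app ?g (h n) \<noteq> hempty" using * unfolding h_def by simp
      then have "code_value (h n) \<noteq> hempty" unfolding g .
      then have "elts (code_value (h n)) \<noteq> {}" using hc_ext[of "code_value (h n)" hempty] elts_hempty by metis
      moreover have "(h n, c) \<in> {(y, x). y \<in> elts (subcodes x)}" using sc by auto
      ultimately show ?thesis using "1.IH"[of "h n"] by blast
    qed
    then obtain f where "h = (\<lambda>n. bcode_code (f n))" by metis
    then have "c = bcode_code (BUnion f)" using c unfolding s bcode_code_simps by (simp only:)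
    then show ?thesis ..
  next
    case 0
    have *: "hsnd c \<in> elts strs \<and> c = kpair (num 0) (hsnd c)"
    proof (rule ccontr)
      assume n: "\<not> ?thesis"
      have "eval_step c ?g = hempty"
        by (subst eval_step_def) (simp only: 0 n simp_thms if_True if_False)
      then show False using ne by simp
    qed
    then obtain t where "hsnd c = string_code t" by (auto simp: elts_strs)
    with * have "c = bcode_code (BCyl t)" unfolding bcode_code_simps by metis
    then show ?thesis ..
  qed
qed

definition code_set :: "hc \<Rightarrow> hc" where
  "code_set c = hset (\<Union>X\<in>elts (code_value c). elts X)"

lemma dft_code_set [dfi]: "dft t \<Longrightarrow> dft (\<lambda>e. code_set (t e))"
  unfolding code_set_def by (intro dfi)

lemma code_set_bcode [simp]: "code_set (bcode_code c) = set_code (interp (cantor M) c)"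
  by (simp add: code_set_def code_value_bcode hset_elts)

lemma borel_codes_M: "c \<in> borel_codes M \<longleftrightarrow> bcode_code c \<in> M"
  by (simp add: borel_codes_def)

lemma BCyl_codes [simp]: "BCyl s \<in> borel_codes M"
  by (simp only: borel_codes_M bcode_code_simps kpair_M num_M string_code_M simp_thms)

lemma BCompl_codes [simp]: "BCompl c \<in> borel_codes M \<longleftrightarrow> c \<in> borel_codes M"
  by (simp only: borel_codes_M bcode_code_simps kpair_M num_M simp_thms)

lemma BUnion_codes: "BUnion f \<in> borel_codes M \<longleftrightarrow> seqc (\<lambda>n. bcode_code (f n)) \<in> M"
  by (simp only: borel_codes_M bcode_code_simps kpair_M num_M simp_thms)

lemma BUnion_codesD: "BUnion f \<in> borel_codes M \<Longrightarrow> f n \<in> borel_codes M"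
  unfolding borel_codes_M[of "f n"] BUnion_codes by (rule seqc_M)

lemma interp_M: "c \<in> borel_codes M \<Longrightarrow> set_code (interp (cantor M) c) \<in> M"
  using dft_comp[where F = code_set, OF dft_code_set[OF dft_var], of "bcode_code c"]
  by (simp only: borel_codes_M code_set_bcode)

lemma interp_sets_in: "c \<in> borel_codes M \<Longrightarrow> interp (cantor M) c \<in> sets_in M"
  using interp_M interp_sub by (simp add: sets_in_iff)

lemma interp_seq_M: "BUnion f \<in> borel_codes M \<Longrightarrow> sets_code (\<lambda>n. interp (cantor M) (f n)) \<in> M"
proof (rule seqcI)
  assume "BUnion f \<in> borel_codes M"
  then have "seqc (\<lambda>n. bcode_code (f n)) \<in> M" by (simp only: BUnion_codes)
  from seqcD[OF this dft_num_unnum[OF dft_var]]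
  have "dft (\<lambda>e. code_set (bcode_code (f (unnum (e 0)))))"
    by (rule dft_code_set)
  then show "dft (\<lambda>e. set_code (interp (cantor M) (f (unnum (e 0)))))" by simp
qed

text \<open>Induction on the code. For a union the sequence of the interpretations must itself
  belong to M, which follows from the definability of the value of a code.\<close>

lemma companion_interp: "c \<in> borel_codes M \<Longrightarrow> companion (interp (cantor M) c) (interp UNIV c)"
proof (induction c)
  case (BCyl s)
  then show ?case using companion_clopen[OF clopen_cylinder] by (simp add: Int_commute)
next
  case (BCompl c)
  then show ?case using companion_Diff by simp
next
  case (BUnion f)
  have "companion (interp (cantor M) (f n)) (interp UNIV (f n))" for n
    using BUnion.IH BUnion_codesD[OF BUnion.prems] by blast
  from companion_UN[OF this interp_seq_M[OF BUnion.prems]] show ?case by simp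
qed

section \<open>Coded sets and the Borel sets of the model\<close>

definition coded :: "(nat \<Rightarrow> bool) set set" where
  "coded = interp (cantor M) ` borel_codes M"

lemma coded_sets_in: "X \<in> coded \<Longrightarrow> X \<in> sets_in M"
  unfolding coded_def using interp_sets_in by blast

lemma coded_sub: "X \<in> coded \<Longrightarrow> X \<subseteq> cantor M"
  using coded_sets_in sets_in_iff by blast

lemma coded_M: "X \<in> coded \<Longrightarrow> set_code X \<in> M"
  using coded_sets_in sets_in_iff by blast

lemma coded_iff: "X \<subseteq> cantor M \<Longrightarrow> X \<in> coded \<longleftrightarrow> (\<exists>c\<in>M. set_code X \<in> elts (code_value c))"
proof
  assume "X \<in> coded"
  then obtain c where "c \<in> borel_codes M" "X = interp (cantor M) c" unfolding coded_def by blast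
  then show "\<exists>c\<in>M. set_code X \<in> elts (code_value c)"
    using code_value_bcode[of c] by (intro bexI[of _ "bcode_code c"]) (auto simp: borel_codes_M)
next
  assume X: "X \<subseteq> cantor M" and "\<exists>c\<in>M. set_code X \<in> elts (code_value c)"
  then obtain c where c: "c \<in> M" "set_code X \<in> elts (code_value c)" by blast
  then obtain b where b: "c = bcode_code b" using code_value_nonempty[of c] by blast
  then have "set_code X = set_code (interp (cantor M) b)" using c code_value_bcode by simp
  then have "X = interp (cantor M) b"
    using unset_set_code countable_sub_cantor[OF X] countable_interp by metis
  then show "X \<in> coded" unfolding coded_def using b c by (auto simp: borel_codes_M)
qed

lemma coded_empty: "{} \<in> coded"
  unfolding coded_def by (rule image_eqI[of _ _ "BCompl (BCyl [])"]) (auto simp: cylinder_def)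

lemma coded_cylinder: "cantor M \<inter> cylinder s \<in> coded"
  unfolding coded_def by (rule image_eqI[of _ _ "BCyl s"]) auto

lemma coded_Diff: "X \<in> coded \<Longrightarrow> cantor M - X \<in> coded"
proof -
  assume "X \<in> coded"
  then obtain c where "c \<in> borel_codes M" "X = interp (cantor M) c" unfolding coded_def by blast
  then show ?thesis unfolding coded_def by (intro image_eqI[of _ _ "BCompl c"]) auto
qed

text \<open>A sequence of coded sets in M comes without a sequence of codes; one is picked by choice
  inside M, where having a given value is a formula.\<close>

lemma coded_UN:
  assumes X: "\<And>n. X n \<in> coded" and XM: "sets_code X \<in> M"
  shows "(\<Union>n. X n) \<in> coded"
proof -
  have "\<exists>h. (\<forall>n. set_code (X n) \<in> elts (code_value (h n))) \<and> seqc h \<in> M"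
  proof (rule model_choice)
    show "dfp (\<lambda>e. set_code (X (unnum (e 0))) \<in> elts (code_value (e 1)))"
      by (intro dfi seqcD[OF XM])
    show "\<exists>y\<in>M. set_code (X n) \<in> elts (code_value y)" for n
      using X[of n] coded_iff[OF coded_sub[OF X]] by blast
  qed
  then obtain h where h: "\<And>n. set_code (X n) \<in> elts (code_value (h n))" "seqc h \<in> M" by blast
  then have "\<exists>b. h n = bcode_code b" for n using code_value_nonempty[of "h n"] by blast
  then obtain f where f: "\<And>n. h n = bcode_code (f n)" by metis
  then have hf: "h = (\<lambda>n. bcode_code (f n))" by (rule ext)
  have "interp (cantor M) (f n) = X n" for n
  proof -
    have "set_code (X n) = set_code (interp (cantor M) (f n))" using h(1)[of n] f code_value_bcode by simp
    then show ?thesis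
      using unset_set_code countable_sub_cantor[OF coded_sub[OF X]] countable_interp by metis
  qed
  moreover have "BUnion f \<in> borel_codes M" using h(2) unfolding hf BUnion_codes .
  ultimately show ?thesis unfolding coded_def by (intro image_eqI[of _ _ "BUnion f"]) auto
qed

text \<open>An open set is the union of the cylinders it includes. Along an enumeration of all
  strings in M, a cylinder not included contributes the empty set, so the sequence stays definable
  from \<open>U\<close>.\<close>

lemma open_in_coded:
  assumes "open_in M U"
  shows "U \<in> coded"
proof -
  have U: "U \<subseteq> cantor M" "set_code U \<in> M"
    using assms sets_in_iff unfolding open_in_def by blast+
  obtain u where u: "u \<in> mseqs" "range u = UNIV" using string_enumeration by blast
  define X where "X n = {x \<in> cantor M. x \<in> cylinder (u n) \<and> (\<forall>y\<in>cantor M. y \<in> cylinder (u n) \<longrightarrow> y \<in> U)}" for n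
  have cU: "countable U" using countable_sub_cantor[OF U(1)] .
  have XM: "sets_code X \<in> M"
    unfolding X_def by (intro seqcI dfi mseqsD[OF u(1)] dfp_mem_set cU U(2))
  have X: "X n = cantor M \<inter> cylinder (u n) \<or> X n = {}" for n
    unfolding X_def by blast
  have "X n \<in> coded" for n
    using X[of n] coded_cylinder coded_empty by metis
  from coded_UN[OF this XM] have "(\<Union>n. X n) \<in> coded" .
  moreover have "(\<Union>n. X n) = U"
  proof (intro equalityI subsetI)
    fix x assume x: "x \<in> U"
    then obtain m where m: "\<forall>y\<in>cantor M. (\<forall>i<m. y i = x i) \<longrightarrow> y \<in> U"
      using assms unfolding open_in_def by blast
    obtain n where n: "u n = map x [0..<m]" using u(2) by (metis rangeE UNIV_I)
    have "x \<in> X n" unfolding X_def n using x U m by (auto simp: cylinder_def)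
    then show "x \<in> (\<Union>n. X n)" by blast
  qed (auto simp: X_def)
  ultimately show ?thesis by simp
qed

lemma set_code_coded_M: "hset (set_code ` coded) \<in> M" and elts_set_code_coded: "elts (hset (set_code ` coded)) = set_code ` coded"
proof -
  have "set_code ` coded \<subseteq> M" using coded_M by blast
  then show e: "elts (hset (set_code ` coded)) = set_code ` coded" by (intro elts_hset countable_in_M)
  have eP: "elts (hset {z \<in> M. elts z \<subseteq> elts (set_code (cantor M))}) = {z \<in> M. elts z \<subseteq> elts (set_code (cantor M))}"
    by (intro elts_hset countable_in_M) auto
  have "set_code ` coded = {z \<in> elts (hset {z \<in> M. elts z \<subseteq> elts (set_code (cantor M))}). \<exists>c\<in>M. z \<in> elts (code_value c)}"
    unfolding eP
  proof (intro equalityI subsetI)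
    fix z assume "z \<in> set_code ` coded"
    then obtain X where X: "X \<in> coded" "z = set_code X" by blast
    have "elts z \<subseteq> elts (set_code (cantor M))"
      unfolding X(2) elts_set_code[OF countable_cantor] elts_set_code[OF countable_sub_cantor[OF coded_sub[OF X(1)]]]
      using coded_sub[OF X(1)] by blast
    then show "z \<in> {z \<in> {z \<in> M. elts z \<subseteq> elts (set_code (cantor M))}. \<exists>c\<in>M. z \<in> elts (code_value c)}"
      using X coded_M coded_iff[OF coded_sub[OF X(1)]] by blast
  next
    fix z assume "z \<in> {z \<in> {z \<in> M. elts z \<subseteq> elts (set_code (cantor M))}. \<exists>c\<in>M. z \<in> elts (code_value c)}"
    then obtain c where c: "c \<in> M" "z \<in> elts (code_value c)" by blast
    then obtain b where b: "c = bcode_code b" using code_value_nonempty[of c] by blast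
    then have "z = set_code (interp (cantor M) b)" using c code_value_bcode by simp
    then show "z \<in> set_code ` coded" unfolding coded_def using b c(1) borel_codes_M by blast
  qed
  moreover have "dft (\<lambda>e. hset {z \<in> elts (hset {z \<in> M. elts z \<subseteq> elts (set_code (cantor M))}). \<exists>c\<in>M. z \<in> elts (code_value c)})"
    by (intro dfi)
  ultimately show "hset (set_code ` coded) \<in> M"
    using dft_M[of _ "\<lambda>_. hempty"] hempty_M by fastforce
qed

text \<open>The coded sets form a \<sigma>-algebra of M that contains the open sets. Conversely,
  induction on codes puts them into every such \<sigma>-algebra, because the sequences met in a
  union belong to M.\<close>

lemma borel_in_eq: "borel_in M = coded"
proof (intro equalityI subsetI)
  fix X assume X: "X \<in> borel_in M"
  have "sigma_algebra_in M coded"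
    unfolding sigma_algebra_in_def
  proof (intro conjI ballI allI impI)
    show "coded \<subseteq> sets_in M" using coded_sets_in by blast
    show "in_model M (set_code ` coded)"
      unfolding in_model_def using set_code_coded_M elts_set_code_coded by blast
    fix f :: "nat \<Rightarrow> (nat \<Rightarrow> bool) set"
    assume "range f \<subseteq> coded \<and> in_model M {kpair (num n) (set_code (f n)) |n. True}"
    then show "(\<Union>n. f n) \<in> coded" unfolding in_model_seqc by (intro coded_UN) auto
  qed (use coded_empty coded_Diff in auto)
  then show "X \<in> coded" using X open_in_coded unfolding borel_in_def by blast
next
  fix X assume "X \<in> coded"
  then obtain c where c: "c \<in> borel_codes M" "X = interp (cantor M) c" unfolding coded_def by blast
  have "interp (cantor M) c \<in> S"
    if S: "sigma_algebra_in M S" "\<forall>U. open_in M U \<longrightarrow> U \<in> S" for S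
    using c(1)
  proof (induction c)
    case (BCyl s)
    have "open_in M (interp (cantor M) (BCyl s))"
      unfolding open_in_def
    proof (intro conjI ballI)
      show "interp (cantor M) (BCyl s) \<in> sets_in M" by (rule interp_sets_in[OF BCyl])
      fix x assume "x \<in> interp (cantor M) (BCyl s)"
      then show "\<exists>n. \<forall>y\<in>cantor M. (\<forall>i<n. y i = x i) \<longrightarrow> y \<in> interp (cantor M) (BCyl s)"
        by (intro exI[of _ "length s"]) (auto simp: cylinder_def)
    qed
    then show ?case using S(2) by blast
  next
    case (BCompl c)
    then show ?case using S(1) by (simp add: sigma_algebra_in_def)
  next
    case (BUnion f)
    have "interp (cantor M) (f n) \<in> S" for n
      using BUnion.IH BUnion_codesD[OF BUnion.prems] by blast
    then have "range (\<lambda>n. interp (cantor M) (f n)) \<subseteq> S" by blast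
    moreover have "in_model M {kpair (num n) (set_code (interp (cantor M) (f n))) |n. True}"
      unfolding in_model_seqc by (rule interp_seq_M[OF BUnion.prems])
    ultimately have "(\<Union>n. interp (cantor M) (f n)) \<in> S"
      using S(1)[unfolded sigma_algebra_in_def, THEN conjunct2, THEN conjunct2, THEN conjunct2, THEN conjunct2,
          rule_format, of "\<lambda>n. interp (cantor M) (f n)"] by blast
    then show ?case by simp
  qed
  then show "X \<in> borel_in M" unfolding borel_in_def c(2) using interp_sets_in[OF c(1)] by blast
qed

lemma measure_interp: "c \<in> borel_codes M \<Longrightarrow> measure_in M (interp (cantor M) c) = emeasure cantor_measure (interp UNIV c)"
  by (rule companion_measure[OF companion_interp])

text \<open>\<open>weight_le\<close> compares two sequences, so smallness is measured against a
  reference sequence of weight \<open>2 * (1 / 2) ^ n\<close>. Together with the error term, the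
  cover has weight at most \<open>3 * (1 / 2) ^ n\<close>.\<close>

definition null_in :: "(nat \<Rightarrow> bool) set \<Rightarrow> bool" where
  "null_in X \<longleftrightarrow> (\<forall>n. \<exists>s\<in>mseqs. covers s X \<and> weight_le s (unseq (strings_code (\<lambda>i. replicate (i + n) False))) n)"

lemma dfp_null_in [dfi]: "dft t \<Longrightarrow> dfp (\<lambda>e. null_in (unset (t e)))"
proof (rule dfp_sub1[where Q = "\<lambda>x. null_in (unset x)"])
  show "dfp (\<lambda>e. null_in (unset (e 0)))"
    unfolding null_in_def by (intro dfi)
qed

lemma null_in_iff:
  assumes X: "X \<subseteq> cantor M"
  shows "null_in X \<longleftrightarrow> measure_in M X = 0"
proof
  assume n: "null_in X"
  have le: "measure_in M X \<le> 0 + ennreal \<epsilon>" if e: "0 < \<epsilon>" for \<epsilon>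
  proof -
    obtain n where n': "3 * (1 / 2) ^ n < \<epsilon>"
      using real_arch_pow_inv[of "\<epsilon> / 3" "1 / 2"] e by (auto simp: field_simps)
    obtain s where s: "s \<in> mseqs" "covers s X" "weight_le s (\<lambda>i. replicate (i + n) False) n"
      using n unfolding null_in_def unseq_strings_code by blast
    have "measure_in M X \<le> weight s" using s covers_iff[OF X] by (intro measure_in_le) auto
    also have "\<dots> \<le> ennreal (2 * (1 / 2) ^ n) + ennreal ((1 / 2) ^ n)"
      using weight_leD[OF s(3)] unfolding weight_geometric .
    also have "\<dots> = ennreal (3 * (1 / 2) ^ n)" by (subst ennreal_plus[symmetric]) auto
    also have "\<dots> \<le> ennreal \<epsilon>" using n' by (intro ennreal_leI) simp
    finally show ?thesis by simp
  qed
  have "measure_in M X \<le> 0" by (rule ennreal_le_epsilon) (rule le)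
  then show "measure_in M X = 0" by simp
next
  assume z: "measure_in M X = 0"
  show "null_in X"
    unfolding null_in_def unseq_strings_code
  proof
    fix n
    have "measure_in M X < ennreal ((1 / 2) ^ n)" unfolding z by simp
    from measure_in_lessD[OF this] obtain s
      where s: "s \<in> mseqs" "X \<subseteq> (\<Union>i. cylinder (s i))" "weight s < ennreal ((1 / 2) ^ n)"
      by blast
    have "weight_le s (\<lambda>i. replicate (i + n) False) n"
      by (rule weight_leI, rule less_le_trans[OF s(3)], rule add_increasing) (rule zero_le order_refl)+
    then show "\<exists>s\<in>mseqs. covers s X \<and> weight_le s (\<lambda>i. replicate (i + n) False) n"
      using s covers_iff[OF X] by blast
  qed
qed

lemma random_poset_eq: "random_poset M = set_code ` {X \<in> coded. measure_in M X \<noteq> 0}"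
  unfolding random_poset_def borel_in_eq by (simp add: zero_less_iff_neq_zero)

lemma elts_hset_random_poset: "elts (hset (random_poset M)) = random_poset M"
  unfolding random_poset_eq by (intro elts_hset countable_in_M) (use coded_M in auto)

text \<open>Since being null is a formula, the poset can be separated from the set of all coded
  sets. Later dense sets are in turn separated from the poset.\<close>

lemma random_poset_M: "hset (random_poset M) \<in> M"
proof -
  have "random_poset M = {z \<in> elts (hset (set_code ` coded)). \<not> null_in (unset z)}"
    unfolding random_poset_eq elts_set_code_coded
    using null_in_iff[OF coded_sub] unset_set_code countable_sub_cantor[OF coded_sub] by auto
  then have "hset (random_poset M) = hset {z \<in> elts (hset (set_code ` coded)). \<not> null_in (unset z)}"
    by (rule arg_cong)
  moreover have "dft (\<lambda>e. hset {z \<in> elts (hset (set_code ` coded)). \<not> null_in (unset z)})"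
    by (intro dfi set_code_coded_M)
  ultimately show ?thesis
    using dft_M[of _ "\<lambda>_. hempty"] hempty_M by fastforce
qed

section \<open>Almost every real is random\<close>

lemma BUnion_pair:
  assumes "c \<in> borel_codes M" "d \<in> borel_codes M"
  shows "BUnion (\<lambda>n. if n = 0 then c else d) \<in> borel_codes M"
proof -
  have "dft (\<lambda>e. bcode_code d)" using assms(2) by (intro dft_const) (simp only: borel_codes_M)
  then have "seqc (\<lambda>n. bcode_code d) \<in> M" by (rule seqcI)
  from seqc_update[OF this, of "bcode_code c" 0] have *: "seqc ((\<lambda>n. bcode_code d)(0 := bcode_code c)) \<in> M" using assms(1) by (simp only: borel_codes_M)
  have "(\<lambda>n. bcode_code d)(0 := bcode_code c) = (\<lambda>n. bcode_code (if n = 0 then c else d))" by auto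
  from *[unfolded this] show ?thesis unfolding BUnion_codes .
qed

lemma codes_Int:
  assumes c: "c \<in> borel_codes M" and d: "d \<in> borel_codes M"
  obtains e where "e \<in> borel_codes M" "interp (cantor M) e = interp (cantor M) c \<inter> interp (cantor M) d"
    "interp UNIV e = interp UNIV c \<inter> interp UNIV d"
proof
  let ?e = "BCompl (BUnion (\<lambda>n. if n = 0 then BCompl c else BCompl d))"
  show "?e \<in> borel_codes M" using BUnion_pair[of "BCompl c" "BCompl d"] c d by simp
  have "(\<Union>n::nat. interp W (if n = 0 then BCompl c else BCompl d)) = (W - interp W c) \<union> (W - interp W d)" for W
    by (auto split: if_splits intro: exI[of _ 0] exI[of _ "Suc 0"])
  then have *: "interp W ?e = W - ((W - interp W c) \<union> (W - interp W d))" for W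
    unfolding interp.simps by (rule arg_cong)
  show "interp (cantor M) ?e = interp (cantor M) c \<inter> interp (cantor M) d"
    unfolding * using interp_sub[of c] interp_sub[of d] by blast
  show "interp UNIV ?e = interp UNIV c \<inter> interp UNIV d" unfolding * by blast
qed

lemma coded_Int: "X \<in> coded \<Longrightarrow> Y \<in> coded \<Longrightarrow> X \<inter> Y \<in> coded"
proof -
  assume "X \<in> coded" "Y \<in> coded"
  then obtain c d where cd: "c \<in> borel_codes M" "X = interp (cantor M) c"
    "d \<in> borel_codes M" "Y = interp (cantor M) d" unfolding coded_def by blast
  obtain e where "e \<in> borel_codes M" "interp (cantor M) e = X \<inter> Y"
    using codes_Int[OF cd(1,3)] cd(2,4) by metis
  then show ?thesis unfolding coded_def by blast
qed

lemma coded_minus: "X \<in> coded \<Longrightarrow> Y \<in> coded \<Longrightarrow> X - Y \<in> coded"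
proof -
  assume XY: "X \<in> coded" "Y \<in> coded"
  have "X - Y = X \<inter> (cantor M - Y)" using coded_sub[OF XY(1)] by blast
  then show ?thesis using coded_Int[OF XY(1) coded_Diff[OF XY(2)]] by simp
qed

definition nonnull :: "(nat \<Rightarrow> bool) set set" where
  "nonnull = {X \<in> coded. measure_in M X \<noteq> 0}"

text \<open>The random filter with its conditions decoded to sets of reals of M. Some code of
  \<open>X\<close> has to contain \<open>x\<close> outside; a priori another code of the same
  \<open>X\<close> might fail to.\<close>

definition conditions :: "(nat \<Rightarrow> bool) \<Rightarrow> (nat \<Rightarrow> bool) set set" where
  "conditions x = {X \<in> nonnull. \<exists>c\<in>borel_codes M. interp (cantor M) c = X \<and> x \<in> interp UNIV c}"

definition dense_in :: "(nat \<Rightarrow> bool) set set \<Rightarrow> bool" where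
  "dense_in D \<longleftrightarrow> D \<subseteq> nonnull \<and> hset (set_code ` D) \<in> M \<and> (\<forall>X\<in>nonnull. \<exists>Y\<in>D. Y \<subseteq> X)"

lemma nonnull_coded: "X \<in> nonnull \<Longrightarrow> X \<in> coded"
  by (simp add: nonnull_def)

lemma nonnull_nonempty: "X \<in> nonnull \<Longrightarrow> X \<noteq> {}"
  by (auto simp: nonnull_def)

lemma countable_coded: "X \<in> coded \<Longrightarrow> countable X"
  by (rule countable_sub_cantor[OF coded_sub])

lemma set_code_inject: "X \<in> coded \<Longrightarrow> Y \<in> coded \<Longrightarrow> set_code X = set_code Y \<longleftrightarrow> X = Y"
  using unset_set_code countable_coded by metis

lemma set_code_subset:
  assumes "X \<in> coded" "Y \<in> coded"
  shows "elts (set_code X) \<subseteq> elts (set_code Y) \<longleftrightarrow> X \<subseteq> Y"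
proof -
  have "elts (set_code X) = real_code ` X" "elts (set_code Y) = real_code ` Y"
    by (rule elts_set_code[OF countable_coded[OF assms(1)]]) (rule elts_set_code[OF countable_coded[OF assms(2)]])
  moreover have "inj real_code" by (simp add: inj_def)
  ultimately show ?thesis by (simp only: inj_image_subset_iff)
qed

lemma random_poset_nonnull: "random_poset M = set_code ` nonnull"
  by (simp add: random_poset_eq nonnull_def)

lemma random_filter_conditions: "random_filter M x = set_code ` conditions x"
proof (intro equalityI subsetI)
  fix z assume "z \<in> random_filter M x"
  then obtain c where c: "z = set_code (interp (cantor M) c)" "c \<in> borel_codes M"
    "set_code (interp (cantor M) c) \<in> random_poset M" "x \<in> interp UNIV c"
    unfolding random_filter_def by blast
  then obtain X where "X \<in> nonnull" "set_code (interp (cantor M) c) = set_code X"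
    unfolding random_poset_nonnull by blast
  moreover have "interp (cantor M) c \<in> coded" unfolding coded_def using c(2) by blast
  ultimately have "interp (cantor M) c \<in> nonnull" using set_code_inject nonnull_coded by metis
  then show "z \<in> set_code ` conditions x" using c unfolding conditions_def by blast
next
  fix z assume "z \<in> set_code ` conditions x"
  then show "z \<in> random_filter M x"
    unfolding conditions_def random_filter_def random_poset_nonnull by blast
qed

text \<open>On \<open>nonnull\<close> the map \<open>set_code\<close> is an order isomorphism onto
  the random poset, so genericity can be expressed with sets of reals throughout.\<close>

lemma random_reals_iff:
  "x \<in> random_reals M \<longleftrightarrow>
    conditions x \<noteq> {} \<and>
    (\<forall>X\<in>conditions x. \<forall>Y\<in>nonnull. X \<subseteq> Y \<longrightarrow> Y \<in> conditions x) \<and>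
    (\<forall>X\<in>conditions x. \<forall>Y\<in>conditions x. \<exists>Z\<in>conditions x. Z \<subseteq> X \<and> Z \<subseteq> Y) \<and>
    (\<forall>D. dense_in D \<longrightarrow> D \<inter> conditions x \<noteq> {})"
proof -
  have sub: "conditions x \<subseteq> nonnull" unfolding conditions_def by blast
  have pc: "nonnull \<subseteq> coded" using nonnull_coded by blast
  have mem: "set_code X \<in> set_code ` conditions x \<longleftrightarrow> X \<in> conditions x" if "X \<in> nonnull" for X
  proof
    assume "set_code X \<in> set_code ` conditions x"
    then obtain Y where "Y \<in> conditions x" "set_code X = set_code Y" by blast
    moreover from this have "X = Y"
      using set_code_inject[OF nonnull_coded[OF that] nonnull_coded] sub by blast
    ultimately show "X \<in> conditions x" by simp
  qed blast
  have le: "elts (set_code X) \<subseteq> elts (set_code Y) \<longleftrightarrow> X \<subseteq> Y" if "X \<in> nonnull" "Y \<in> nonnull" for X Y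
    using that set_code_subset nonnull_coded by blast
  have bi: "(\<forall>p\<in>set_code ` A. Q p) \<longleftrightarrow> (\<forall>X\<in>A. Q (set_code X))"
    and wi: "(\<exists>p\<in>set_code ` A. Q p) \<longleftrightarrow> (\<exists>X\<in>A. Q (set_code X))" for A Q by blast+
  have 1: "(\<forall>p\<in>set_code ` conditions x. \<forall>q\<in>set_code ` nonnull. elts p \<subseteq> elts q \<longrightarrow> q \<in> set_code ` conditions x) \<longleftrightarrow>
    (\<forall>X\<in>conditions x. \<forall>Y\<in>nonnull. X \<subseteq> Y \<longrightarrow> Y \<in> conditions x)"
    unfolding bi
  proof (intro ball_cong refl)
    fix X Y assume "X \<in> conditions x" and Y: "Y \<in> nonnull"
    then have X: "X \<in> nonnull" using sub by blast
    show "(elts (set_code X) \<subseteq> elts (set_code Y) \<longrightarrow> set_code Y \<in> set_code ` conditions x) =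
        (X \<subseteq> Y \<longrightarrow> Y \<in> conditions x)"
      unfolding le[OF X Y] mem[OF Y] ..
  qed
  have 2: "(\<forall>p\<in>set_code ` conditions x. \<forall>q\<in>set_code ` conditions x.
      \<exists>r\<in>set_code ` conditions x. elts r \<subseteq> elts p \<and> elts r \<subseteq> elts q) \<longleftrightarrow>
    (\<forall>X\<in>conditions x. \<forall>Y\<in>conditions x. \<exists>Z\<in>conditions x. Z \<subseteq> X \<and> Z \<subseteq> Y)"
    unfolding bi wi
  proof (intro ball_cong bex_cong refl)
    fix X Y Z assume "X \<in> conditions x" "Y \<in> conditions x" "Z \<in> conditions x"
    then have X: "X \<in> nonnull" and Y: "Y \<in> nonnull" and Z: "Z \<in> nonnull" using sub by blast+
    show "(elts (set_code Z) \<subseteq> elts (set_code X) \<and> elts (set_code Z) \<subseteq> elts (set_code Y)) = (Z \<subseteq> X \<and> Z \<subseteq> Y)"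
      unfolding le[OF Z X] le[OF Z Y] ..
  qed
  have 3: "(\<forall>D. in_model M D \<and> dense_in_poset (set_code ` nonnull) D \<longrightarrow> D \<inter> set_code ` conditions x \<noteq> {}) \<longleftrightarrow>
    (\<forall>D. dense_in D \<longrightarrow> D \<inter> conditions x \<noteq> {})"
  proof
    assume L: "\<forall>D. in_model M D \<and> dense_in_poset (set_code ` nonnull) D \<longrightarrow> D \<inter> set_code ` conditions x \<noteq> {}"
    show "\<forall>D. dense_in D \<longrightarrow> D \<inter> conditions x \<noteq> {}"
    proof (intro allI impI)
      fix D assume D: "dense_in D"
      then have Dp: "D \<subseteq> nonnull" unfolding dense_in_def by blast
      have "set_code ` D \<subseteq> M" using Dp pc coded_M by blast
      then have "elts (hset (set_code ` D)) = set_code ` D" by (intro elts_hset countable_in_M)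
      then have "in_model M (set_code ` D)" using D unfolding dense_in_def in_model_def by blast
      moreover have "dense_in_poset (set_code ` nonnull) (set_code ` D)"
        unfolding dense_in_poset_def
      proof (intro conjI ballI)
        fix p assume "p \<in> set_code ` nonnull"
        then obtain X where X: "X \<in> nonnull" "p = set_code X" by blast
        then obtain Y where "Y \<in> D" "Y \<subseteq> X" using D unfolding dense_in_def by blast
        then show "\<exists>d\<in>set_code ` D. elts d \<subseteq> elts p" using X le Dp by blast
      qed (use Dp in blast)
      ultimately obtain X Y where "X \<in> D" "Y \<in> conditions x" "set_code X = set_code Y"
        using L by blast
      moreover have "X = Y" using calculation set_code_inject Dp sub pc by (metis subsetD)
      ultimately show "D \<inter> conditions x \<noteq> {}" by blast
    qed
  next
    assume R: "\<forall>D. dense_in D \<longrightarrow> D \<inter> conditions x \<noteq> {}"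
    show "\<forall>D. in_model M D \<and> dense_in_poset (set_code ` nonnull) D \<longrightarrow> D \<inter> set_code ` conditions x \<noteq> {}"
    proof (intro allI impI, elim conjE)
      fix D' assume D': "in_model M D'" "dense_in_poset (set_code ` nonnull) D'"
      define D where "D = {X \<in> nonnull. set_code X \<in> D'}"
      have eq: "set_code ` D = D'" using D'(2) unfolding D_def dense_in_poset_def by blast
      obtain a where a: "a \<in> M" "elts a = D'" using D'(1) unfolding in_model_def by blast
      have "hset (set_code ` D) \<in> M" unfolding eq using a by (metis hset_elts)
      moreover have "\<exists>Y\<in>D. Y \<subseteq> X" if X: "X \<in> nonnull" for X
      proof -
        obtain d where d: "d \<in> D'" "elts d \<subseteq> elts (set_code X)"
          using D'(2) X unfolding dense_in_poset_def by blast
        then obtain Y where "Y \<in> D" "d = set_code Y" using eq by blast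
        then show ?thesis using d le[of Y X] X unfolding D_def by blast
      qed
      ultimately have "dense_in D" unfolding dense_in_def D_def by blast
      then show "D' \<inter> set_code ` conditions x \<noteq> {}" using R eq by blast
    qed
  qed
  have "set_code ` conditions x \<subseteq> set_code ` nonnull" using sub by blast
  then show ?thesis
    unfolding random_reals_def generic_filter_def random_filter_conditions random_poset_nonnull mem_Collect_eq
    using 1 2 3 by simp
qed

lemma countable_borel_codes: "countable (borel_codes M)"
proof -
  have "inj_on bcode_code (borel_codes M)" by (rule inj_onI) (rule bcode_code_inject)
  moreover have "countable (bcode_code ` borel_codes M)"
    by (rule countable_in_M) (auto simp: borel_codes_M)
  ultimately show ?thesis using countable_image_inj_on by blast
qed

lemma countable_nonnull: "countable nonnull"
proof (rule countable_subset)
  show "nonnull \<subseteq> interp (cantor M) ` borel_codes M" unfolding nonnull_def coded_def by blast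
qed (use countable_borel_codes in blast)

lemma sets_interp: "c \<in> borel_codes M \<Longrightarrow> interp UNIV c \<in> sets cantor_measure"
  using companion_interp unfolding companion_def by blast

lemma sets_conditions: "{x. X \<in> conditions x} \<in> sets cantor_measure"
proof (cases "X \<in> nonnull")
  case True
  then have "{x. X \<in> conditions x} = (\<Union>c\<in>{c \<in> borel_codes M. interp (cantor M) c = X}. interp UNIV c)"
    unfolding conditions_def by blast
  also have "\<dots> \<in> sets cantor_measure"
    by (intro sets.countable_UN' countable_subset[OF _ countable_borel_codes]) (auto simp: sets_interp)
  finally show ?thesis .
qed (simp add: conditions_def)

lemma countable_dense_in: "countable {D. dense_in D}"
proof -
  have "inj_on (\<lambda>D. hset (set_code ` D)) {D. dense_in D}"
  proof (rule inj_onI)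
    fix D D' assume D: "D \<in> {D. dense_in D}" "D' \<in> {D. dense_in D}" "hset (set_code ` D) = hset (set_code ` D')"
    then have s: "D \<subseteq> coded" "D' \<subseteq> coded" unfolding dense_in_def using nonnull_coded by blast+
    then have sM: "set_code ` D \<subseteq> M" "set_code ` D' \<subseteq> M" using coded_M by blast+
    have "set_code ` D = set_code ` D'"
      using D(3) hset_inject[OF countable_in_M[OF sM(1)] countable_in_M[OF sM(2)]] by blast
    moreover have "inj_on set_code coded" using set_code_inject by (intro inj_onI) blast
    ultimately show "D = D'" using inj_on_image_eq_iff[OF _ s] by blast
  qed
  moreover have "countable ((\<lambda>D. hset (set_code ` D)) ` {D. dense_in D})"
    by (rule countable_in_M) (auto simp: dense_in_def)
  ultimately show ?thesis using countable_image_inj_on by blast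
qed

text \<open>M has only countably many conditions and dense sets. Every clause of genericity is thus
  a countable combination of the measurable sets of those \<open>x\<close> whose filter contains a
  given \<open>X\<close>.\<close>

lemma random_reals_sets: "random_reals M \<in> sets cantor_measure"
proof -
  let ?P = "\<lambda>Q. {x \<in> space cantor_measure. Q x} \<in> sets cantor_measure"
  have c: "?P (\<lambda>x. X \<in> conditions x)" for X using sets_conditions[of X] by simp
  define DD where "DD = {D. dense_in D}"
  have cDD: "countable DD" unfolding DD_def by (rule countable_dense_in)
  have "random_reals M = {x \<in> space cantor_measure.
    (\<exists>X\<in>nonnull. X \<in> conditions x) \<and>
    (\<forall>X\<in>nonnull. \<forall>Y\<in>nonnull. X \<subseteq> Y \<longrightarrow> X \<in> conditions x \<longrightarrow> Y \<in> conditions x) \<and>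
    (\<forall>X\<in>nonnull. \<forall>Y\<in>nonnull. X \<in> conditions x \<longrightarrow> Y \<in> conditions x \<longrightarrow>
      (\<exists>Z\<in>nonnull. Z \<in> conditions x \<and> Z \<subseteq> X \<and> Z \<subseteq> Y)) \<and>
    (\<forall>D\<in>DD. \<exists>X\<in>nonnull. X \<in> D \<and> X \<in> conditions x)}" (is "_ = ?R")
  proof -
    have sub: "X \<in> nonnull" if "X \<in> conditions x" for X x using that unfolding conditions_def by blast
    have "conditions x \<noteq> {} \<longleftrightarrow> (\<exists>X\<in>nonnull. X \<in> conditions x)" for x using sub by blast
    moreover have "(\<forall>X\<in>conditions x. \<forall>Y\<in>nonnull. X \<subseteq> Y \<longrightarrow> Y \<in> conditions x) \<longleftrightarrow>
      (\<forall>X\<in>nonnull. \<forall>Y\<in>nonnull. X \<subseteq> Y \<longrightarrow> X \<in> conditions x \<longrightarrow> Y \<in> conditions x)" for x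
      using sub by blast
    moreover have "(\<forall>X\<in>conditions x. \<forall>Y\<in>conditions x. \<exists>Z\<in>conditions x. Z \<subseteq> X \<and> Z \<subseteq> Y) \<longleftrightarrow>
      (\<forall>X\<in>nonnull. \<forall>Y\<in>nonnull. X \<in> conditions x \<longrightarrow> Y \<in> conditions x \<longrightarrow>
      (\<exists>Z\<in>nonnull. Z \<in> conditions x \<and> Z \<subseteq> X \<and> Z \<subseteq> Y))" for x
      using sub by meson
    moreover have "(\<forall>D. dense_in D \<longrightarrow> D \<inter> conditions x \<noteq> {}) \<longleftrightarrow>
      (\<forall>D\<in>DD. \<exists>X\<in>nonnull. X \<in> D \<and> X \<in> conditions x)" for x
      unfolding DD_def using sub by blast
    ultimately have "x \<in> random_reals M \<longleftrightarrow> x \<in> ?R" for x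
      unfolding random_reals_iff by simp
    then show ?thesis by (rule Set.set_eqI)
  qed
  also have "\<dots> \<in> sets cantor_measure"
    by (intro sets.sets_Collect_conj sets.sets_Collect_countable_All' sets.sets_Collect_countable_Ex'
        sets.sets_Collect_imp sets.sets_Collect_const c countable_nonnull cDD)
  finally show ?thesis .
qed

lemma ennreal_small_le:
  assumes "\<And>n. x \<le> y + ennreal ((1 / 2) ^ n)"
  shows "x \<le> y"
proof (rule ennreal_le_epsilon)
  fix \<epsilon> :: real assume "0 < \<epsilon>"
  then obtain n where "(1 / 2) ^ n < \<epsilon>" using real_arch_pow_inv[of \<epsilon> "1 / 2"] by auto
  then have "ennreal ((1 / 2) ^ n) \<le> ennreal \<epsilon>" by (intro ennreal_leI) simp
  then show "x \<le> y + ennreal \<epsilon>" using assms[of n] add_left_mono order_trans by blast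
qed

lemma sets_code_unsets: "y \<in> M \<Longrightarrow> sets_code (unsets y) \<in> M"
  unfolding unsets_def by (intro seqcI dfi)

lemma measure_in_finite: "measure_in M X \<noteq> \<infinity>"
  using measure_in_le_1[of X] by (auto simp: top_unique)

lemma measure_companion_Un_disjoint:
  assumes "companion X Y" "companion X' Y'" "X \<inter> X' = {}"
  shows "measure_in M (X \<union> X') = measure_in M X + measure_in M X'"
proof -
  have S: "Y \<in> sets cantor_measure" "Y' \<in> sets cantor_measure"
    using assms unfolding companion_def by blast+
  have "X' - X = X'" using assms(3) by blast
  then have c: "companion X' (Y' - Y)" using companion_minus[OF assms(2,1)] by simp
  have "emeasure cantor_measure (Y \<union> Y') = emeasure cantor_measure (Y \<union> (Y' - Y))"
    by (rule arg_cong[where f = "emeasure cantor_measure"]) blast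
  also have "\<dots> = emeasure cantor_measure Y + emeasure cantor_measure (Y' - Y)"
    using S by (intro plus_emeasure[symmetric]) auto
  finally show ?thesis
    using companion_measure[OF companion_Un[OF assms(1,2)]] companion_measure[OF assms(1)] companion_measure[OF c]
    by simp
qed

text \<open>The countable chain condition is used as follows: among the unions, in the model, of countably
  many members of \<open>D\<close> choose a sequence whose measures approach the supremum; the complement of
  the union of this sequence is null, as otherwise it would contain a further member of \<open>D\<close>.\<close>

lemma dense_in_conull:
  assumes D: "dense_in D"
  shows "- (\<Union>c\<in>{c \<in> borel_codes M. interp (cantor M) c \<in> D}. interp UNIV c) \<in> null_sets cantor_measure"
proof -
  define E where "E = (\<Union>c\<in>{c \<in> borel_codes M. interp (cantor M) c \<in> D}. interp UNIV c)"
  have DP: "D \<subseteq> nonnull" and aM: "hset (set_code ` D) \<in> M"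
    and dense: "\<And>X. X \<in> nonnull \<Longrightarrow> \<exists>Y\<in>D. Y \<subseteq> X"
    using D unfolding dense_in_def by blast+
  have Dc: "X \<in> coded" if "X \<in> D" for X using that DP nonnull_coded by blast
  have DM: "set_code ` D \<subseteq> M" using Dc coded_M by blast
  define a where "a = hset (set_code ` D)"
  have ea: "elts a = set_code ` D" unfolding a_def by (rule elts_hset[OF countable_in_M[OF DM]])
  have ES: "E \<in> sets cantor_measure"
    unfolding E_def
    by (intro sets.countable_UN' countable_subset[OF _ countable_borel_codes]) (auto simp: sets_interp)
  have "\<exists>c. c \<in> borel_codes M \<and> interp (cantor M) c = X" if "X \<in> D" for X
    using Dc[OF that] unfolding coded_def by blast
  \<comment> \<open>These codes are chosen outside M. That suffices for the sets \<open>W y\<close>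
    below, which only have to be companions of the sets \<open>U y\<close> and included in
    \<open>E\<close>.\<close>
  then obtain \<kappa> where \<kappa>: "\<And>X. X \<in> D \<Longrightarrow> \<kappa> X \<in> borel_codes M \<and> interp (cantor M) (\<kappa> X) = X" by metis
  have \<kappa>c: "companion X (interp UNIV (\<kappa> X))" if "X \<in> D" for X
    using companion_interp[of "\<kappa> X"] \<kappa>[OF that] by simp
  have \<kappa>E: "interp UNIV (\<kappa> X) \<subseteq> E" if "X \<in> D" for X
  proof -
    have "\<kappa> X \<in> {c \<in> borel_codes M. interp (cantor M) c \<in> D}" using \<kappa>[OF that] that by simp
    then show ?thesis unfolding E_def by (rule UN_upper)
  qed
  define good where "good y \<longleftrightarrow> (\<forall>n. app y (num n) \<in> elts a)" for y
  define U where "U y = {x \<in> cantor M. \<exists>n. x \<in> unset (app y (num n))}" for y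
  define W where "W y = (\<Union>n. interp UNIV (\<kappa> (unsets y n)))" for y
  have gD: "unsets y n \<in> D" if g: "good y" for y n
  proof -
    obtain X where X: "X \<in> D" "app y (num n) = set_code X" using g unfolding good_def ea by blast
    then have "unsets y n = X" unfolding unsets_def using unset_set_code[OF countable_coded[OF Dc]] by simp
    then show ?thesis using X by simp
  qed
  have U_eq: "U y = (\<Union>n. unsets y n)" if g: "good y" for y
    using coded_sub[OF Dc[OF gD[OF g]]] unfolding U_def unsets_def by blast
  have UW: "companion (U y) (W y)" if "good y" "y \<in> M" for y
    unfolding U_eq[OF that(1)] W_def
    by (rule companion_UN[OF \<kappa>c[OF gD[OF that(1)]] sets_code_unsets[OF that(2)]])
  have Uc: "U y \<in> coded" if "good y" "y \<in> M" for y
    unfolding U_eq[OF that(1)]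
    by (rule coded_UN[OF Dc[OF gD[OF that(1)]] sets_code_unsets[OF that(2)]])
  have WE: "W y \<subseteq> E" if "good y" for y
    unfolding W_def using \<kappa>E[OF gD[OF that]] by blast
  have dU: "dft (\<lambda>e. set_code (U (t e)))" if "dft t" for t
    unfolding U_def by (intro dfi dft_shift that)
  have cU: "U y \<subseteq> cantor M" for y unfolding U_def by blast
  have U_unset: "unset (set_code (U y)) = U y" for y
    using countable_sub_cantor[OF cU] by simp
  \<comment> \<open>Expresses in M that the measure of \<open>U y'\<close> is at most that of
    \<open>U y\<close> plus \<open>(1 / 2) ^ n\<close>: every cover of the one is matched by a cover
    of the other.\<close>
  define le where "le y' y n \<longleftrightarrow> (\<forall>r\<in>mseqs. covers r (U y) \<longrightarrow> (\<exists>s\<in>mseqs. covers s (U y') \<and> weight_le s r n))"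
    for y' y n
  have dcov: "dfp (\<lambda>e. covers (unseq (t e)) (U (u e)))" if "dft t" "dft u" for t u
    using dfp_covers[OF that(1) dU[OF that(2)]] by (simp only: U_unset)
  have leD: "measure_in M (U y') \<le> measure_in M (U y) + ennreal ((1 / 2) ^ n)" if le: "le y' y n" for y' y n
  proof -
    have "measure_in M (U y') - ennreal ((1 / 2) ^ n) \<le> measure_in M (U y)"
    proof (rule measure_in_geI)
      fix r assume r: "r \<in> mseqs" "U y \<subseteq> (\<Union>i. cylinder (r i))"
      then obtain s where s: "s \<in> mseqs" "covers s (U y')" "weight_le s r n"
        using le covers_iff[OF cU] unfolding le_def by blast
      have "measure_in M (U y') \<le> weight s" using s covers_iff[OF cU] by (intro measure_in_le) blast+
      also have "\<dots> \<le> weight r + ennreal ((1 / 2) ^ n)" using s(3) by (rule weight_leD)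
      finally show "measure_in M (U y') - ennreal ((1 / 2) ^ n) \<le> weight r"
        by (subst ennreal_minus_le_iff) (auto simp: add.commute)
    qed
    then show ?thesis by (subst (asm) ennreal_minus_le_iff) (auto simp: add.commute)
  qed
  have "cantor M \<in> nonnull"
    using coded_Diff[OF coded_empty] measure_in_cantor by (simp add: nonnull_def)
  then obtain X0 where X0: "X0 \<in> D" using dense by blast
  define y0 where "y0 = seqc (\<lambda>n. set_code X0)"
  have y0: "y0 \<in> M" "good y0"
  proof -
    have "set_code X0 \<in> M" using X0 DM by blast
    then show "y0 \<in> M" unfolding y0_def by (intro seqcI dft_const)
    show "good y0" unfolding good_def y0_def ea using X0 by simp
  qed
  let ?G = "{y \<in> M. good y}"
  \<comment> \<open>The supremum is a real number outside M. Inside, a nearly optimal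
    \<open>y\<close> is recognised by the comparison \<open>le\<close> with all other good
    sequences.\<close>
  let ?S = "SUP y\<in>?G. measure_in M (U y)"
  have S1: "?S \<le> 1" by (intro SUP_least measure_in_le_1)
  have "\<exists>h. (\<forall>n. good (h n) \<and> (\<forall>y'\<in>M. good y' \<longrightarrow> le y' (h n) n)) \<and> seqc h \<in> M"
  proof (rule model_choice[where P = "\<lambda>n y. good y \<and> (\<forall>y'\<in>M. good y' \<longrightarrow> le y' y n)"])
    have "a \<in> M" unfolding a_def by (rule aM)
    then show "dfp (\<lambda>e. good (e 1) \<and> (\<forall>y'\<in>M. good y' \<longrightarrow> le y' (e 1) (unnum (e 0))))"
      unfolding good_def le_def by (intro dfi dcov)
    fix n
    have "?S < ?S + ennreal ((1 / 2) ^ n)"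
    proof -
      have "?S \<noteq> \<infinity>" using S1 by (intro notI) (simp only: infinity_ennreal_def top_unique, simp)
      then have "?S + 0 < ?S + ennreal ((1 / 2) ^ n)" by (subst ennreal_add_left_cancel_less) simp
      then show ?thesis by simp
    qed
    also have "\<dots> = (SUP y\<in>?G. measure_in M (U y) + ennreal ((1 / 2) ^ n))"
      using y0 by (intro ennreal_SUP_add_left[symmetric]) blast
    finally obtain y where y: "y \<in> M" "good y" "?S < measure_in M (U y) + ennreal ((1 / 2) ^ n)"
      unfolding less_SUP_iff by blast
    have "le y' y n" if y': "y' \<in> M" "good y'" for y'
      unfolding le_def
    proof (intro ballI impI)
      fix r assume r: "r \<in> mseqs" "covers r (U y)"
      have "measure_in M (U y') \<le> ?S" using y' by (intro SUP_upper) blast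
      also note y(3)
      also have "measure_in M (U y) + ennreal ((1 / 2) ^ n) \<le> weight r + ennreal ((1 / 2) ^ n)"
        using r covers_iff[OF cU] by (intro add_right_mono measure_in_le) blast+
      finally have "measure_in M (U y') < weight r + ennreal ((1 / 2) ^ n)" .
      from measure_in_lessD[OF this] obtain s
        where "s \<in> mseqs" "U y' \<subseteq> (\<Union>i. cylinder (s i))" "weight s < weight r + ennreal ((1 / 2) ^ n)"
        by blast
      then show "\<exists>s\<in>mseqs. covers s (U y') \<and> weight_le s r n"
        using covers_iff[OF cU] weight_leI by blast
    qed
    then show "\<exists>y\<in>M. good y \<and> (\<forall>y'\<in>M. good y' \<longrightarrow> le y' y n)" using y by blast
  qed
  then obtain h where h: "\<And>n. good (h n)" "\<And>n y'. y' \<in> M \<Longrightarrow> good y' \<Longrightarrow> le y' (h n) n" "seqc h \<in> M"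
    by blast
  have hM: "h n \<in> M" for n by (rule seqc_M[OF h(3)])
  have UhM: "sets_code (\<lambda>n. U (h n)) \<in> M"
    by (intro seqcI dU seqcD[OF h(3)] dfi)
  define A where "A = cantor M - (\<Union>n. U (h n))"
  have Ac: "A \<in> coded" unfolding A_def by (intro coded_Diff coded_UN Uc h hM UhM)
  have cA: "companion A (UNIV - (\<Union>n. W (h n)))"
    unfolding A_def by (intro companion_Diff companion_UN UW h hM UhM)
  have "measure_in M A = 0"
  proof (rule ccontr)
    assume "measure_in M A \<noteq> 0"
    then have "A \<in> nonnull" using Ac by (simp add: nonnull_def)
    then obtain X where X: "X \<in> D" "X \<subseteq> A" using dense by blast
    have "measure_in M X \<le> 0 + ennreal ((1 / 2) ^ n)" for n
    proof -
      \<comment> \<open>Prepending \<open>X\<close> to the sequence \<open>h n\<close> gives another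
        good sequence. As \<open>X\<close> is disjoint from \<open>U (h n)\<close>, the measure
        grows by that of \<open>X\<close>, and near-optimality bounds the gain by
        \<open>(1 / 2) ^ n\<close>.\<close>
      define y where "y = seqc (\<lambda>k. if k = 0 then set_code X else app (h n) (num (k - 1)))"
      have XM: "set_code X \<in> M" using X(1) DM by blast
      have "dft (\<lambda>e. if unnum (e 0) = 0 then set_code X else app (h n) (num (unnum (e 0) - 1)))"
        by (intro dfi XM hM num_M)
      then have yM: "y \<in> M" unfolding y_def by (rule seqcI)
      have yapp: "app y (num k) = (if k = 0 then set_code X else app (h n) (num (k - 1)))" for k
        unfolding y_def by simp
      have gy: "good y"
        unfolding good_def yapp using h(1)[of n] X(1) by (simp add: good_def ea)
      have "U y = X \<union> U (h n)"
      proof -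
        have 1: "(\<exists>k. x \<in> unset (app y (num k))) \<longleftrightarrow> x \<in> unset (set_code X) \<or> (\<exists>k. x \<in> unset (app (h n) (num k)))" for x
        proof
          assume "\<exists>k. x \<in> unset (app y (num k))"
          then obtain k where "x \<in> unset (app y (num k))" by blast
          then show "x \<in> unset (set_code X) \<or> (\<exists>k. x \<in> unset (app (h n) (num k)))"
            unfolding yapp by (auto split: if_splits)
        next
          assume "x \<in> unset (set_code X) \<or> (\<exists>k. x \<in> unset (app (h n) (num k)))"
          then consider "x \<in> unset (set_code X)" | k where "x \<in> unset (app (h n) (num k))" by blast
          then show "\<exists>k. x \<in> unset (app y (num k))"
          proof cases
            case 1 then show ?thesis unfolding yapp by (intro exI[of _ 0]) simp
          next
            case 2 then show ?thesis unfolding yapp by (intro exI[of _ "Suc k"]) simp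
          qed
        qed
        show ?thesis
          unfolding U_def 1 unset_set_code[OF countable_coded[OF Dc[OF X(1)]]]
          using coded_sub[OF Dc[OF X(1)]] by blast
      qed
      moreover have "X \<inter> U (h n) = {}" using X(2) unfolding A_def by blast
      ultimately have "measure_in M (U y) = measure_in M X + measure_in M (U (h n))"
        using measure_companion_Un_disjoint[OF \<kappa>c[OF X(1)] UW[OF h(1) hM]] by simp
      then have "measure_in M (U (h n)) + measure_in M X \<le> measure_in M (U (h n)) + ennreal ((1 / 2) ^ n)"
        using leD[OF h(2)[OF yM gy, of n]] by (simp add: add.commute)
      then show ?thesis
        using measure_in_finite[of "U (h n)"] by (simp add: ennreal_add_left_cancel_le)
    qed
    then have "measure_in M X \<le> 0" by (rule ennreal_small_le)
    moreover have "measure_in M X \<noteq> 0" using X(1) DP unfolding nonnull_def by blast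
    ultimately show False by simp
  qed
  then have "emeasure cantor_measure (UNIV - (\<Union>n. W (h n))) = 0"
    using companion_measure[OF cA] by simp
  moreover have "UNIV - (\<Union>n. W (h n)) \<in> sets cantor_measure" using cA unfolding companion_def by blast
  ultimately have N: "UNIV - (\<Union>n. W (h n)) \<in> null_sets cantor_measure" by (intro null_setsI)
  have "- E \<subseteq> UNIV - (\<Union>n. W (h n))" using WE[OF h(1)] by blast
  moreover have "- E \<in> sets cantor_measure" using sets.compl_sets[OF ES] by (simp add: Compl_eq_Diff_UNIV)
  ultimately show ?thesis unfolding E_def[symmetric] using null_sets_subset[OF N] by blast
qed

text \<open>Three countable families of exceptional points are removed: points in null codes, points
  at which an inclusion valid in M fails outside, and points that miss some dense set. The second
  family is null because the difference of the two codes is a companion of the empty set.\<close>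

lemma random_reals_conull: "- random_reals M \<in> null_sets cantor_measure"
proof -
  define N1 where "N1 = (\<Union>c\<in>{c \<in> borel_codes M. measure_in M (interp (cantor M) c) = 0}. interp UNIV c)"
  define N2 where "N2 = (\<Union>(c, d)\<in>{(c, d). c \<in> borel_codes M \<and> d \<in> borel_codes M \<and>
    interp (cantor M) c \<subseteq> interp (cantor M) d}. interp UNIV c - interp UNIV d)"
  define E where "E D = (\<Union>c\<in>{c \<in> borel_codes M. interp (cantor M) c \<in> D}. interp UNIV c)" for D
  have "N1 \<in> null_sets cantor_measure"
    unfolding N1_def
  proof (intro null_sets_UN' countable_subset[OF _ countable_borel_codes])
    fix c assume "c \<in> {c \<in> borel_codes M. measure_in M (interp (cantor M) c) = 0}"
    then show "interp UNIV c \<in> null_sets cantor_measure"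
      using measure_interp[of c] sets_interp[of c] by (intro null_setsI) auto
  qed blast
  moreover have "N2 \<in> null_sets cantor_measure"
    unfolding N2_def
  proof (intro null_sets_UN' countable_subset[OF _ countable_SIGMA[OF countable_borel_codes countable_borel_codes]])
    fix p assume "p \<in> {(c, d). c \<in> borel_codes M \<and> d \<in> borel_codes M \<and> interp (cantor M) c \<subseteq> interp (cantor M) d}"
    then obtain c d where p: "p = (c, d)" "c \<in> borel_codes M" "d \<in> borel_codes M"
      "interp (cantor M) c \<subseteq> interp (cantor M) d" by blast
    then have e: "interp (cantor M) c - interp (cantor M) d = {}" by blast
    have "companion {} (interp UNIV c - interp UNIV d)"
      using companion_minus[OF companion_interp[OF p(2)] companion_interp[OF p(3)]] unfolding e .
    from companion_measure[OF this] have "emeasure cantor_measure (interp UNIV c - interp UNIV d) = 0" by simp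
    then show "(case p of (c, d) \<Rightarrow> interp UNIV c - interp UNIV d) \<in> null_sets cantor_measure"
      unfolding p(1) using sets_interp p by (auto intro!: null_setsI)
  qed blast
  moreover have "(\<Union>D\<in>{D. dense_in D}. - E D) \<in> null_sets cantor_measure"
    unfolding E_def by (intro null_sets_UN' countable_dense_in dense_in_conull) simp
  ultimately have N: "N1 \<union> N2 \<union> (\<Union>D\<in>{D. dense_in D}. - E D) \<in> null_sets cantor_measure"
    by (intro null_sets.Un)
  have "x \<in> random_reals M" if x: "x \<notin> N1" "x \<notin> N2" "\<And>D. dense_in D \<Longrightarrow> x \<in> E D" for x
    unfolding random_reals_iff
  proof (intro conjI ballI allI impI)
    have pos: "interp (cantor M) c \<in> conditions x" if "c \<in> borel_codes M" "x \<in> interp UNIV c" for c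
    proof -
      have "measure_in M (interp (cantor M) c) \<noteq> 0" using x(1) that unfolding N1_def by blast
      then show ?thesis using that unfolding conditions_def nonnull_def coded_def by blast
    qed
    have "x \<in> interp UNIV (BCyl [])" by (simp add: cylinder_def)
    then show "conditions x \<noteq> {}" using pos[of "BCyl []"] BCyl_codes by blast
    {
      fix X Y assume "X \<in> conditions x" and Y: "Y \<in> nonnull" "X \<subseteq> Y"
      then obtain c where c: "c \<in> borel_codes M" "X = interp (cantor M) c" "x \<in> interp UNIV c"
        unfolding conditions_def by blast
      obtain d where d: "d \<in> borel_codes M" "Y = interp (cantor M) d"
        using nonnull_coded[OF Y(1)] unfolding coded_def by blast
      have "x \<in> interp UNIV d" using x(2) c d Y(2) unfolding N2_def by blast
      then show "Y \<in> conditions x" using pos d by blast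
    next
      fix X Y assume "X \<in> conditions x" "Y \<in> conditions x"
      then obtain c d where c: "c \<in> borel_codes M" "X = interp (cantor M) c" "x \<in> interp UNIV c"
        and d: "d \<in> borel_codes M" "Y = interp (cantor M) d" "x \<in> interp UNIV d"
        unfolding conditions_def by blast
      obtain e where e: "e \<in> borel_codes M" "interp (cantor M) e = X \<inter> Y"
        "interp UNIV e = interp UNIV c \<inter> interp UNIV d"
        using codes_Int[OF c(1) d(1)] c(2) d(2) by metis
      then have "X \<inter> Y \<in> conditions x" using pos[OF e(1)] c(3) d(3) by simp
      then show "\<exists>Z\<in>conditions x. Z \<subseteq> X \<and> Z \<subseteq> Y"
        by (rule bexI[rotated]) (intro conjI Int_lower1 Int_lower2)
    next
      fix D assume "dense_in D"
      then have "x \<in> E D" by (rule x(3))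
      then obtain c where c: "c \<in> borel_codes M" "interp (cantor M) c \<in> D" "x \<in> interp UNIV c"
        unfolding E_def by blast
      then show "D \<inter> conditions x \<noteq> {}" using pos[of c] by blast
    }
  qed
  then have "x \<in> N1 \<union> N2 \<union> (\<Union>D\<in>{D. dense_in D}. - E D)" if "x \<notin> random_reals M" for x
    using that by (metis (mono_tags, lifting) ComplI UN_I UnI1 UnI2 mem_Collect_eq)
  then have "- random_reals M \<subseteq> N1 \<union> N2 \<union> (\<Union>D\<in>{D. dense_in D}. - E D)" by (intro subsetI) simp
  moreover have "- random_reals M \<in> sets cantor_measure"
    using sets.compl_sets[OF random_reals_sets] by (simp add: Compl_eq_Diff_UNIV)
  ultimately show ?thesis using null_sets_subset[OF N] by blast
qed

section \<open>What the filter of a random real decides\<close>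

lemma conditions_nonnull: "X \<in> conditions x \<Longrightarrow> X \<in> nonnull"
  unfolding conditions_def by blast

lemma random_up:
  "x \<in> random_reals M \<Longrightarrow> X \<in> conditions x \<Longrightarrow> Y \<in> nonnull \<Longrightarrow> X \<subseteq> Y \<Longrightarrow> Y \<in> conditions x"
  unfolding random_reals_iff by blast

lemma random_compatible:
  "x \<in> random_reals M \<Longrightarrow> X \<in> conditions x \<Longrightarrow> Y \<in> conditions x \<Longrightarrow> \<exists>Z\<in>conditions x. Z \<subseteq> X \<and> Z \<subseteq> Y"
  unfolding random_reals_iff by blast

lemma random_not_disjoint:
  assumes "x \<in> random_reals M" "X \<in> conditions x" "Y \<in> conditions x"
  shows "X \<inter> Y \<noteq> {}"
proof -
  obtain Z where "Z \<in> conditions x" "Z \<subseteq> X" "Z \<subseteq> Y" using random_compatible[OF assms] by blast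
  then show ?thesis using nonnull_nonempty conditions_nonnull by blast
qed

lemma cylinder_conditions: "cantor M \<inter> cylinder (map x [0..<m]) \<in> conditions x"
proof -
  have "measure_in M (cantor M \<inter> cylinder (map x [0..<m])) \<noteq> 0"
    using measure_in_clopen[OF clopen_cylinder, of "map x [0..<m]"] by (simp add: emeasure_cylinder Int_commute)
  then have "cantor M \<inter> cylinder (map x [0..<m]) \<in> nonnull"
    using coded_cylinder by (simp add: nonnull_def)
  moreover have "x \<in> interp UNIV (BCyl (map x [0..<m]))" by (simp add: cylinder_def)
  moreover have "interp (cantor M) (BCyl (map x [0..<m])) = cantor M \<inter> cylinder (map x [0..<m])" by simp
  ultimately show ?thesis unfolding conditions_def using BCyl_codes by blast
qed

text \<open>The elements of a condition are reals of M, and \<open>x\<close> need not be among them.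
  Compatibility with the cylinders around \<open>x\<close> still provides elements that agree with
  \<open>x\<close> to any finite length.\<close>

lemma random_agree:
  assumes "x \<in> random_reals M" "X \<in> conditions x"
  shows "\<exists>y\<in>X. \<forall>i<m. y i = x i"
proof -
  obtain y where "y \<in> X" "y \<in> cylinder (map x [0..<m])"
    using random_not_disjoint[OF assms cylinder_conditions[of x m]] by blast
  then show ?thesis by (auto simp: cylinder_def)
qed

text \<open>The conditions that miss the union or lie within one of the sets are dense. Below
  \<open>X\<close> take the part outside the union if it is not null; otherwise subadditivity in M
  makes some \<open>X \<inter> A n\<close> non-null.\<close>

lemma random_decides:
  assumes x: "x \<in> random_reals M" and A: "\<And>n. A n \<in> coded" and AM: "sets_code A \<in> M"
  shows "\<exists>X\<in>conditions x. X \<inter> (\<Union>n. A n) = {} \<or> (\<exists>n. X \<subseteq> A n)"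
proof -
  define D where "D = {X \<in> nonnull. X \<inter> (\<Union>n. A n) = {} \<or> (\<exists>n. X \<subseteq> A n)}"
  have AU: "(\<Union>n. A n) \<in> coded" by (rule coded_UN[OF A AM])
  have Asub: "A n \<subseteq> cantor M" for n by (rule coded_sub[OF A])
  let ?Q = "\<lambda>z. (\<forall>y\<in>cantor M. y \<in> unset z \<longrightarrow> \<not> (\<exists>n. y \<in> A n)) \<or> (\<exists>n. \<forall>y\<in>cantor M. y \<in> unset z \<longrightarrow> y \<in> A n)"
  have Q: "?Q (set_code X) \<longleftrightarrow> X \<inter> (\<Union>n. A n) = {} \<or> (\<exists>n. X \<subseteq> A n)" if "X \<in> nonnull" for X
    unfolding unset_set_code[OF countable_coded[OF nonnull_coded[OF that]]]
    using coded_sub[OF nonnull_coded[OF that]] by blast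
  have eP: "elts (hset (random_poset M)) = set_code ` nonnull"
    by (rule trans[OF elts_hset_random_poset random_poset_nonnull])
  have "set_code ` D = {z \<in> elts (hset (random_poset M)). ?Q z}"
  proof (intro equalityI subsetI)
    fix z assume "z \<in> set_code ` D"
    then obtain X where X: "X \<in> nonnull" "z = set_code X" "X \<inter> (\<Union>n. A n) = {} \<or> (\<exists>n. X \<subseteq> A n)"
      unfolding D_def by blast
    have "?Q z" unfolding X(2) Q[OF X(1)] by (rule X(3))
    then show "z \<in> {z \<in> elts (hset (random_poset M)). ?Q z}"
      unfolding eP using X(1,2) by blast
  next
    fix z assume z: "z \<in> {z \<in> elts (hset (random_poset M)). ?Q z}"
    then have "z \<in> set_code ` nonnull" unfolding eP by blast
    then obtain X where X: "X \<in> nonnull" "z = set_code X" by blast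
    have "?Q (set_code X)" using z unfolding X(2) by blast
    then have "X \<inter> (\<Union>n. A n) = {} \<or> (\<exists>n. X \<subseteq> A n)" unfolding Q[OF X(1)] .
    then show "z \<in> set_code ` D" unfolding D_def using X by blast
  qed
  then have "hset (set_code ` D) = hset {z \<in> elts (hset (random_poset M)). ?Q z}" by (rule arg_cong)
  moreover have "dft (\<lambda>e. hset {z \<in> elts (hset (random_poset M)). ?Q z})"
    by (intro dfi random_poset_M sets_codeD[OF AM Asub])
  then have "hset {z \<in> elts (hset (random_poset M)). ?Q z} \<in> M"
    using dft_M[of _ "\<lambda>_. hempty"] hempty_M by fastforce
  ultimately have DM: "hset (set_code ` D) \<in> M" by simp
  have "\<exists>Y\<in>D. Y \<subseteq> X" if X: "X \<in> nonnull" for X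
  proof -
    have Xc: "X \<in> coded" by (rule nonnull_coded[OF X])
    show ?thesis
    proof (cases "measure_in M (X - (\<Union>n. A n)) = 0")
      case False
      have "(X - (\<Union>n. A n)) \<inter> (\<Union>n. A n) = {}" by blast
      then have "X - (\<Union>n. A n) \<in> D"
        unfolding D_def nonnull_def by (intro CollectI conjI disjI1 coded_minus[OF Xc AU] False)
      then show ?thesis by (rule bexI[rotated]) (rule Diff_subset)
    next
      case True
      have XM: "set_code X \<in> M" by (rule coded_M[OF Xc])
      have "X \<inter> A n = {y \<in> cantor M. y \<in> X \<and> y \<in> A n}" for n using Asub by blast
      then have sM: "sets_code (\<lambda>n. X \<inter> A n) \<in> M"
        by (simp only:) (intro seqcI dfi sets_codeD[OF AM Asub] dfp_mem_set countable_coded[OF Xc] XM)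
      have "measure_in M X \<le> measure_in M ((X - (\<Union>n. A n)) \<union> (\<Union>n. X \<inter> A n))"
        by (rule measure_in_mono) blast
      also have "\<dots> \<le> measure_in M (X - (\<Union>n. A n)) + measure_in M (\<Union>n. X \<inter> A n)"
        using coded_sub[OF Xc] by (intro measure_in_Un_le) blast+
      also have "\<dots> \<le> 0 + (\<Sum>n. measure_in M (X \<inter> A n))"
        using coded_sub[OF Xc] unfolding True by (intro add_left_mono measure_in_UN_le sM) blast
      finally have le: "measure_in M X \<le> (\<Sum>n. measure_in M (X \<inter> A n))" by simp
      have "\<exists>n. measure_in M (X \<inter> A n) \<noteq> 0"
      proof (rule ccontr)
        assume "\<not> ?thesis"
        then have "(\<Sum>n. measure_in M (X \<inter> A n)) = 0" by simp
        then show False using le X unfolding nonnull_def by simp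
      qed
      then obtain n where "measure_in M (X \<inter> A n) \<noteq> 0" by blast
      moreover have "\<exists>k. X \<inter> A n \<subseteq> A k" by (rule exI[of _ n]) (rule Int_lower2)
      ultimately have "X \<inter> A n \<in> D"
        unfolding D_def nonnull_def by (intro CollectI conjI disjI2 coded_Int[OF Xc A])
      then show ?thesis by (rule bexI[rotated]) (rule Int_lower1)
    qed
  qed
  then have "dense_in D" using DM unfolding dense_in_def D_def by blast
  then obtain X where "X \<in> D" "X \<in> conditions x" using x unfolding random_reals_iff by blast
  then show ?thesis unfolding D_def by blast
qed

section \<open>Automorphisms of the random poset\<close>

definition perm_in :: "(nat \<Rightarrow> nat) \<Rightarrow> (nat \<Rightarrow> nat) \<Rightarrow> bool" where
  "perm_in \<phi> \<psi> \<longleftrightarrow> (\<forall>n. \<phi> (\<psi> n) = n) \<and> (\<forall>n. \<psi> (\<phi> n) = n) \<and>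
    seqc (\<lambda>n. num (\<phi> n)) \<in> M \<and> seqc (\<lambda>n. num (\<psi> n)) \<in> M"

lemma perm_in_sym: "perm_in \<phi> \<psi> \<Longrightarrow> perm_in \<psi> \<phi>"
  unfolding perm_in_def by blast

definition pull :: "(nat \<Rightarrow> nat) \<Rightarrow> (nat \<Rightarrow> bool) set \<Rightarrow> (nat \<Rightarrow> bool) set" where
  "pull \<phi> X = {x \<in> cantor M. (\<lambda>n. x (\<phi> n)) \<in> X}"

lemma dft_real_perm:
  assumes "perm_in \<phi> \<psi>" "dft t"
  shows "dft (\<lambda>e. real_code (\<lambda>n. unreal (t e) (\<phi> n)))"
proof -
  have "seqc (\<lambda>n. num (\<phi> n)) \<in> M" using assms(1) unfolding perm_in_def by blast
  note * = seqcD[OF this]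
  show ?thesis
    unfolding real_code_seqc by (intro dfi * dft_shift assms(2))
qed

lemma cantor_perm: "perm_in \<phi> \<psi> \<Longrightarrow> x \<in> cantor M \<Longrightarrow> (\<lambda>n. x (\<phi> n)) \<in> cantor M"
  using dft_comp[where F = "\<lambda>y. real_code (\<lambda>n. unreal y (\<phi> n))", OF dft_real_perm[OF _ dft_var], of _ "real_code x"]
  by (simp add: cantor_def)

lemma pull_sub: "pull \<phi> X \<subseteq> cantor M"
  unfolding pull_def by blast

lemma pull_pull: "perm_in \<phi> \<psi> \<Longrightarrow> X \<subseteq> cantor M \<Longrightarrow> pull \<phi> (pull \<psi> X) = X"
  using cantor_perm[of \<phi> \<psi>] unfolding pull_def perm_in_def by auto

lemma pull_mono: "X \<subseteq> Y \<Longrightarrow> pull \<phi> X \<subseteq> pull \<phi> Y"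
  unfolding pull_def by blast

lemma pull_le_iff:
  assumes "perm_in \<phi> \<psi>" "X \<subseteq> cantor M" "Y \<subseteq> cantor M"
  shows "pull \<psi> X \<subseteq> Y \<longleftrightarrow> X \<subseteq> pull \<phi> Y"
  using pull_pull[OF assms(1,2)] pull_pull[OF perm_in_sym[OF assms(1)] assms(3)]
    pull_mono[of "pull \<psi> X" Y \<phi>] pull_mono[of X "pull \<phi> Y" \<psi>] by auto

lemma dft_pull:
  assumes "perm_in \<phi> \<psi>" "dft t"
  shows "dft (\<lambda>e. set_code (pull \<phi> (unset (t e))))"
  unfolding pull_def by (intro dfi dft_shift assms(2) dft_real_perm[OF assms(1)])

text \<open>Induction on the code. The inverse image of a cylinder need not be a cylinder, but it
  depends on finitely many coordinates and is therefore open in M.\<close>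

lemma pull_coded:
  assumes p: "perm_in \<phi> \<psi>" and X: "X \<in> coded"
  shows "pull \<phi> X \<in> coded"
proof -
  obtain c where c: "c \<in> borel_codes M" "X = interp (cantor M) c" using X unfolding coded_def by blast
  have pM: "set_code (pull \<phi> X) \<in> M" if "X \<subseteq> cantor M" "set_code X \<in> M" for X
    using dft_comp[where F = "\<lambda>z. set_code (pull \<phi> (unset z))", OF dft_pull[OF p dft_var] that(2)]
      countable_sub_cantor[OF that(1)] by simp
  have "pull \<phi> (interp (cantor M) c) \<in> coded"
    using c(1)
  proof (induction c)
    case (BCyl s)
    have "open_in M (pull \<phi> (interp (cantor M) (BCyl s)))"
      unfolding open_in_def
    proof (intro conjI ballI)
      show "pull \<phi> (interp (cantor M) (BCyl s)) \<in> sets_in M"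
        unfolding sets_in_iff using pull_sub pM[OF interp_sub interp_M[OF BCyl]] by blast
      fix x assume x: "x \<in> pull \<phi> (interp (cantor M) (BCyl s))"
      have "\<phi> i < Suc (\<Sum>i<length s. \<phi> i)" if "i < length s" for i
        using member_le_sum[of i "{..<length s}" \<phi>] that by (simp add: le_imp_less_Suc)
      then show "\<exists>n. \<forall>y\<in>cantor M. (\<forall>i<n. y i = x i) \<longrightarrow> y \<in> pull \<phi> (interp (cantor M) (BCyl s))"
        using x cantor_perm[OF p] unfolding pull_def
        by (intro exI[of _ "Suc (\<Sum>i<length s. \<phi> i)"]) (auto simp: cylinder_def)
    qed
    then show ?case by (rule open_in_coded)
  next
    case (BCompl c)
    have "pull \<phi> (interp (cantor M) (BCompl c)) = cantor M - pull \<phi> (interp (cantor M) c)"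
      unfolding pull_def using cantor_perm[OF p] by auto
    then show ?case using BCompl by (simp only: BCompl_codes coded_Diff)
  next
    case (BUnion f)
    have "sets_code (\<lambda>n. pull \<phi> (interp (cantor M) (f n))) \<in> M"
    proof (rule seqcI)
      have "dft (\<lambda>e. set_code (interp (cantor M) (f (unnum (e 0)))))"
        by (rule seqcD[OF interp_seq_M[OF BUnion.prems] dft_num_unnum[OF dft_var]])
      from dft_pull[OF p this] show "dft (\<lambda>e. set_code (pull \<phi> (interp (cantor M) (f (unnum (e 0))))))"
        by (simp only: unset_set_code[OF countable_interp])
    qed
    moreover have "pull \<phi> (interp (cantor M) (f n)) \<in> coded" for n
      using BUnion.IH BUnion_codesD[OF BUnion.prems] by blast
    ultimately have "(\<Union>n. pull \<phi> (interp (cantor M) (f n))) \<in> coded" by (intro coded_UN)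
    moreover have "pull \<phi> (interp (cantor M) (BUnion f)) = (\<Union>n. pull \<phi> (interp (cantor M) (f n)))"
      unfolding pull_def by auto
    ultimately show ?case by (simp only:)
  qed
  then show ?thesis unfolding c(2) .
qed

text \<open>The inverse image of a cylinder prescribes equally many coordinates, because \<phi> is
  injective, and so has the same measure. Subadditivity in M then bounds the inverse image of a
  covered set by the weight of the cover.\<close>

lemma measure_pull_le:
  assumes p: "perm_in \<phi> \<psi>"
  shows "measure_in M (pull \<phi> X) \<le> measure_in M X"
proof (rule measure_in_geI)
  fix s assume s: "s \<in> mseqs" "X \<subseteq> (\<Union>n. cylinder (s n))"
  define A where "A n = pull \<phi> (cantor M \<inter> cylinder (s n))" for n
  have inj: "inj \<phi>" using p unfolding perm_in_def inj_def by metis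
  have "A n = {x \<in> cantor M. (\<lambda>i. x (\<phi> i)) \<in> cylinder (s n)}" for n
    unfolding A_def pull_def using cantor_perm[OF p] by blast
  then have AM: "sets_code A \<in> M"
    by (simp only:) (intro seqcI dfi dft_real_perm[OF p] mseqsD[OF s(1)])
  have "measure_in M (pull \<phi> X) \<le> measure_in M (\<Union>n. A n)"
    using s(2) cantor_perm[OF p] unfolding A_def pull_def by (intro measure_in_mono) blast
  also have "\<dots> \<le> (\<Sum>n. measure_in M (A n))"
    by (rule measure_in_UN_le[OF _ AM]) (unfold A_def, rule pull_sub)
  also have "\<dots> = weight s"
    unfolding weight_def
  proof (rule suminf_cong)
    fix n
    define K where "K = {x :: nat \<Rightarrow> bool. \<forall>j\<in>\<phi> ` {..<length (s n)}. x j = s n ! \<psi> j}"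
    have "A n = K \<inter> cantor M"
      using cantor_perm[OF p] p unfolding A_def pull_def K_def cylinder_def perm_in_def by auto
    moreover have "clopen K" unfolding K_def by (rule clopen_coordinates) simp
    moreover have "emeasure cantor_measure K = ennreal ((1 / 2) ^ card (\<phi> ` {..<length (s n)}))"
      unfolding K_def by (rule emeasure_coordinates) simp
    moreover have "card (\<phi> ` {..<length (s n)}) = length (s n)"
      using card_image[OF inj_on_subset[OF inj], of "{..<length (s n)}"] by simp
    ultimately show "measure_in M (A n) = ennreal ((1 / 2) ^ length (s n))"
      using measure_in_clopen[of K] by simp
  qed
  finally show "measure_in M (pull \<phi> X) \<le> weight s" .
qed

lemma pull_nonnull:
  assumes p: "perm_in \<phi> \<psi>" and X: "X \<in> nonnull"
  shows "pull \<phi> X \<in> nonnull"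
proof -
  have Xc: "X \<in> coded" by (rule nonnull_coded[OF X])
  have "measure_in M X \<noteq> 0" using X unfolding nonnull_def by blast
  moreover have "measure_in M X \<le> measure_in M (pull \<phi> X)"
    using measure_pull_le[OF perm_in_sym[OF p], of "pull \<phi> X"]
    unfolding pull_pull[OF perm_in_sym[OF p] coded_sub[OF Xc]] .
  ultimately have "measure_in M (pull \<phi> X) \<noteq> 0" by (metis le_zero_eq)
  then show ?thesis using pull_coded[OF p Xc] unfolding nonnull_def by blast
qed

text \<open>For a random real, membership in a Borel set is decided by the conditions in its filter. This
  replaces the absoluteness of inclusions between coded Borel sets.\<close>

lemma random_mem_iff:
  assumes p: "perm_in \<phi> \<psi>" and x: "x \<in> random_reals M" and c: "c \<in> borel_codes M"
  shows "(\<lambda>n. x (\<phi> n)) \<in> interp UNIV c \<longleftrightarrow> (\<exists>X\<in>conditions x. X \<subseteq> pull \<phi> (interp (cantor M) c))"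
  using c
proof (induction c)
  case (BCyl s)
  define m where "m = Suc (\<Sum>i<length s. \<phi> i)"
  have m: "\<phi> i < m" if "i < length s" for i
    unfolding m_def using member_le_sum[of i "{..<length s}" \<phi>] that by (simp add: le_imp_less_Suc)
  show ?case
  proof
    assume "(\<lambda>n. x (\<phi> n)) \<in> interp UNIV (BCyl s)"
    then have "cantor M \<inter> cylinder (map x [0..<m]) \<subseteq> pull \<phi> (interp (cantor M) (BCyl s))"
      using m cantor_perm[OF p] unfolding pull_def by (auto simp: cylinder_def)
    then show "\<exists>X\<in>conditions x. X \<subseteq> pull \<phi> (interp (cantor M) (BCyl s))"
      using cylinder_conditions by blast
  next
    assume "\<exists>X\<in>conditions x. X \<subseteq> pull \<phi> (interp (cantor M) (BCyl s))"
    then obtain X where X: "X \<in> conditions x" "X \<subseteq> pull \<phi> (interp (cantor M) (BCyl s))" by blast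
    obtain y where y: "y \<in> X" "\<forall>i<m. y i = x i" using random_agree[OF x X(1)] by blast
    then have "y \<in> pull \<phi> (interp (cantor M) (BCyl s))" using X(2) by blast
    then show "(\<lambda>n. x (\<phi> n)) \<in> interp UNIV (BCyl s)"
      using y(2) m unfolding pull_def by (auto simp: cylinder_def)
  qed
next
  case (BCompl c)
  then have c: "c \<in> borel_codes M" by simp
  let ?A = "pull \<phi> (interp (cantor M) c)"
  have Ac: "?A \<in> coded" using pull_coded[OF p] c unfolding coded_def by blast
  have eq: "pull \<phi> (interp (cantor M) (BCompl c)) = cantor M - ?A"
    unfolding pull_def using cantor_perm[OF p] by auto
  have "(\<lambda>n. x (\<phi> n)) \<in> interp UNIV (BCompl c) \<longleftrightarrow> \<not> (\<exists>X\<in>conditions x. X \<subseteq> ?A)"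
    using BCompl.IH[OF c] by simp
  also have "\<dots> \<longleftrightarrow> (\<exists>X\<in>conditions x. X \<subseteq> cantor M - ?A)"
  proof
    assume n: "\<not> (\<exists>X\<in>conditions x. X \<subseteq> ?A)"
    \<comment> \<open>With a constant sequence, \<open>random_decides\<close> yields a condition
      included in the set or disjoint from it.\<close>
    have "sets_code (\<lambda>n. ?A) \<in> M" by (intro seqcI dft_const coded_M Ac)
    from random_decides[OF x Ac this] obtain X where X: "X \<in> conditions x"
      "X \<inter> (\<Union>n :: nat. ?A) = {} \<or> (\<exists>n :: nat. X \<subseteq> ?A)" by (elim bexE)
    then have "X \<inter> ?A = {}" using n by blast
    then have "X \<subseteq> cantor M - ?A" using coded_sub[OF nonnull_coded[OF conditions_nonnull[OF X(1)]]] by blast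
    then show "\<exists>X\<in>conditions x. X \<subseteq> cantor M - ?A" using X(1) by blast
  next
    assume "\<exists>X\<in>conditions x. X \<subseteq> cantor M - ?A"
    then obtain X where X: "X \<in> conditions x" "X \<subseteq> cantor M - ?A" by blast
    show "\<not> (\<exists>X\<in>conditions x. X \<subseteq> ?A)"
    proof
      assume "\<exists>X\<in>conditions x. X \<subseteq> ?A"
      then obtain Y where Y: "Y \<in> conditions x" "Y \<subseteq> ?A" by blast
      show False using random_not_disjoint[OF x X(1) Y(1)] X(2) Y(2) by blast
    qed
  qed
  finally show ?case unfolding eq .
next
  case (BUnion f)
  let ?A = "\<lambda>n. pull \<phi> (interp (cantor M) (f n))"
  have fc: "f n \<in> borel_codes M" for n by (rule BUnion_codesD[OF BUnion.prems])
  have Ac: "?A n \<in> coded" for n using pull_coded[OF p] fc unfolding coded_def by blast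
  have AM: "sets_code ?A \<in> M"
  proof (rule seqcI)
    have "dft (\<lambda>e. set_code (interp (cantor M) (f (unnum (e 0)))))"
      by (rule seqcD[OF interp_seq_M[OF BUnion.prems] dft_num_unnum[OF dft_var]])
    from dft_pull[OF p this] show "dft (\<lambda>e. set_code (?A (unnum (e 0))))"
      by (simp only: unset_set_code[OF countable_interp])
  qed
  have eq: "pull \<phi> (interp (cantor M) (BUnion f)) = (\<Union>n. ?A n)" unfolding pull_def by auto
  have IH: "(\<lambda>i. x (\<phi> i)) \<in> interp UNIV (f n) \<longleftrightarrow> (\<exists>X\<in>conditions x. X \<subseteq> ?A n)" for n
    using BUnion.IH[of "f n"] fc[of n] by blast
  have "(\<lambda>n. x (\<phi> n)) \<in> interp UNIV (BUnion f) \<longleftrightarrow> (\<exists>n. \<exists>X\<in>conditions x. X \<subseteq> ?A n)"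
    unfolding interp.simps UN_iff IH by blast
  also have "\<dots> \<longleftrightarrow> (\<exists>X\<in>conditions x. X \<subseteq> (\<Union>n. ?A n))"
  proof
    assume "\<exists>X\<in>conditions x. X \<subseteq> (\<Union>n. ?A n)"
    then obtain X where X: "X \<in> conditions x" "X \<subseteq> (\<Union>n. ?A n)" by blast
    obtain Y where Y: "Y \<in> conditions x" "Y \<inter> (\<Union>n. ?A n) = {} \<or> (\<exists>n. Y \<subseteq> ?A n)"
      using random_decides[OF x Ac AM] by blast
    have "X \<inter> Y \<noteq> {}" by (rule random_not_disjoint[OF x X(1) Y(1)])
    then have "\<exists>n. Y \<subseteq> ?A n" using Y(2) X(2) by blast
    then show "\<exists>n. \<exists>X\<in>conditions x. X \<subseteq> ?A n" using Y(1) by blast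
  qed blast
  finally show ?case unfolding eq .
qed

text \<open>The automorphism carries one filter to the other. \<open>random_mem_iff\<close> gives a
  condition of \<open>x\<close> below \<open>pull \<phi> Y\<close>, and the filter is closed
  upwards.\<close>

lemma conditions_perm:
  assumes p: "perm_in \<phi> \<psi>" and x: "x \<in> random_reals M"
  shows "Y \<in> conditions (\<lambda>n. x (\<phi> n)) \<longleftrightarrow> Y \<in> nonnull \<and> pull \<phi> Y \<in> conditions x"
proof -
  have "(\<exists>c\<in>borel_codes M. interp (cantor M) c = Y \<and> (\<lambda>n. x (\<phi> n)) \<in> interp UNIV c) \<longleftrightarrow>
      pull \<phi> Y \<in> conditions x" if Y: "Y \<in> nonnull"
  proof
    assume "\<exists>c\<in>borel_codes M. interp (cantor M) c = Y \<and> (\<lambda>n. x (\<phi> n)) \<in> interp UNIV c"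
    then obtain X where "X \<in> conditions x" "X \<subseteq> pull \<phi> Y" using random_mem_iff[OF p x] by blast
    then show "pull \<phi> Y \<in> conditions x" using random_up[OF x] pull_nonnull[OF p Y] by blast
  next
    assume a: "pull \<phi> Y \<in> conditions x"
    obtain c where "c \<in> borel_codes M" "interp (cantor M) c = Y"
      using nonnull_coded[OF Y] unfolding coded_def by blast
    then show "\<exists>c\<in>borel_codes M. interp (cantor M) c = Y \<and> (\<lambda>n. x (\<phi> n)) \<in> interp UNIV c"
      using random_mem_iff[OF p x] a by blast
  qed
  then show ?thesis unfolding conditions_def[of "\<lambda>n. x (\<phi> n)"] by blast
qed

text \<open>The automorphism carries a dense set of M to a dense set of M: density of the image is
  tested by moving the given condition with the inverse permutation first.\<close>

lemma random_reals_perm: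
  assumes p: "perm_in \<phi> \<psi>" and x: "x \<in> random_reals M"
  shows "(\<lambda>n. x (\<phi> n)) \<in> random_reals M"
  unfolding random_reals_iff
proof (intro conjI ballI allI impI)
  note p' = perm_in_sym[OF p]
  let ?x = "\<lambda>n. x (\<phi> n)"
  have sub: "X \<subseteq> cantor M" if "X \<in> nonnull" for X using coded_sub[OF nonnull_coded[OF that]] .
  have bk: "pull \<psi> Z \<in> conditions ?x" if "Z \<in> conditions x" for Z
  proof -
    have Z: "Z \<in> nonnull" by (rule conditions_nonnull[OF that])
    then show ?thesis
      unfolding conditions_perm[OF p x] using pull_nonnull[OF p' Z] pull_pull[OF p sub[OF Z]] that by simp
  qed
  obtain X where "X \<in> conditions x" using x unfolding random_reals_iff by blast
  then show "conditions ?x \<noteq> {}" using bk by blast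
  {
    fix X Y assume "X \<in> conditions ?x" "Y \<in> nonnull" "X \<subseteq> Y"
    then show "Y \<in> conditions ?x"
      unfolding conditions_perm[OF p x] using random_up[OF x] pull_mono pull_nonnull[OF p] by blast
  next
    fix X Y assume "X \<in> conditions ?x" "Y \<in> conditions ?x"
    then have XY: "X \<in> nonnull" "Y \<in> nonnull" "pull \<phi> X \<in> conditions x" "pull \<phi> Y \<in> conditions x"
      unfolding conditions_perm[OF p x] by blast+
    obtain Z where Z: "Z \<in> conditions x" "Z \<subseteq> pull \<phi> X" "Z \<subseteq> pull \<phi> Y"
      using random_compatible[OF x XY(3,4)] by blast
    have Zs: "Z \<subseteq> cantor M" by (rule sub[OF conditions_nonnull[OF Z(1)]])
    have "pull \<psi> Z \<subseteq> X" "pull \<psi> Z \<subseteq> Y"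
      using Z pull_le_iff[OF p Zs sub[OF XY(1)]] pull_le_iff[OF p Zs sub[OF XY(2)]] by blast+
    then show "\<exists>Z\<in>conditions ?x. Z \<subseteq> X \<and> Z \<subseteq> Y" using bk[OF Z(1)] by blast
  next
    fix D assume D: "dense_in D"
    have DP: "D \<subseteq> nonnull" and DM: "hset (set_code ` D) \<in> M"
      and dense: "\<And>X. X \<in> nonnull \<Longrightarrow> \<exists>Y\<in>D. Y \<subseteq> X"
      using D unfolding dense_in_def by blast+
    have "set_code ` D \<subseteq> M" using DP nonnull_coded coded_M by blast
    then have e: "elts (hset (set_code ` D)) = set_code ` D" by (intro elts_hset countable_in_M)
    have "dense_in (pull \<phi> ` D)"
      unfolding dense_in_def
    proof (intro conjI ballI)
      show "pull \<phi> ` D \<subseteq> nonnull" using DP pull_nonnull[OF p] by blast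
      have "unset (set_code X) = X" if "X \<in> D" for X
        using that DP nonnull_coded countable_coded unset_set_code by blast
      then have "set_code ` pull \<phi> ` D = (\<lambda>z. set_code (pull \<phi> (unset z))) ` elts (hset (set_code ` D))"
        unfolding e image_image by (intro image_cong refl) simp
      then have "hset (set_code ` pull \<phi> ` D) = hset ((\<lambda>z. set_code (pull \<phi> (unset z))) ` elts (hset (set_code ` D)))"
        by (rule arg_cong)
      also have "\<dots> \<in> M"
        by (rule dft_comp[where F = "\<lambda>a. hset ((\<lambda>z. set_code (pull \<phi> (unset z))) ` elts a)", OF _ DM])
          (intro dfi dft_pull[OF p])
      finally show "hset (set_code ` pull \<phi> ` D) \<in> M" .
      fix X assume X: "X \<in> nonnull"
      obtain Y where Y: "Y \<in> D" "Y \<subseteq> pull \<psi> X" using dense[OF pull_nonnull[OF p' X]] by blast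
      have "pull \<phi> Y \<subseteq> X"
        using Y DP pull_le_iff[OF p' sub sub[OF X], of Y] by blast
      then show "\<exists>Y\<in>pull \<phi> ` D. Y \<subseteq> X" using Y(1) by blast
    qed
    then obtain Y where "Y \<in> D" "pull \<phi> Y \<in> conditions x" using x unfolding random_reals_iff by blast
    then show "D \<inter> conditions ?x \<noteq> {}" using DP conditions_perm[OF p x, of Y] by blast
  }
qed

section \<open>The action on names and on generic extensions\<close>

definition domain_of :: "hc \<Rightarrow> hc" where
  "domain_of t = hset (hfst ` elts (hset {z \<in> elts t. z = kpair (hfst z) (hsnd z)}))"

lemma elts_domain_of: "elts (domain_of t) = {s. \<exists>p. kpair s p \<in> elts t}"
proof -
  have "elts (domain_of t) = hfst ` {z \<in> elts t. z = kpair (hfst z) (hsnd z)}"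
    by (simp add: domain_of_def elts_hset countable_elts)
  also have "\<dots> = {s. \<exists>p. kpair s p \<in> elts t}"
  proof (intro equalityI subsetI)
    fix s assume "s \<in> hfst ` {z \<in> elts t. z = kpair (hfst z) (hsnd z)}"
    then obtain z where "s = hfst z" "z \<in> elts t" "z = kpair (hfst z) (hsnd z)" by blast
    then show "s \<in> {s. \<exists>p. kpair s p \<in> elts t}" by (metis mem_Collect_eq)
  next
    fix s assume "s \<in> {s. \<exists>p. kpair s p \<in> elts t}"
    then obtain p where p: "kpair s p \<in> elts t" by blast
    then have "kpair s p \<in> {z \<in> elts t. z = kpair (hfst z) (hsnd z)}" by simp
    then have "hfst (kpair s p) \<in> hfst ` {z \<in> elts t. z = kpair (hfst z) (hsnd z)}" by (rule imageI)
    then show "s \<in> hfst ` {z \<in> elts t. z = kpair (hfst z) (hsnd z)}" by simp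
  qed
  finally show ?thesis .
qed

lemma wf_domain_of: "wf {(y, x). y \<in> elts (domain_of x)}"
  by (rule wf_trancl_mem) (auto simp: elts_domain_of intro: fst_kpair_trancl)

definition condition_map :: "(nat \<Rightarrow> nat) \<Rightarrow> hc \<Rightarrow> hc" where
  "condition_map \<phi> z = set_code (pull \<phi> (unset z))"

definition name_step :: "(nat \<Rightarrow> nat) \<Rightarrow> hc \<Rightarrow> hc \<Rightarrow> hc" where
  "name_step \<phi> t g = hset ((\<lambda>z. kpair (app g (hfst z)) (condition_map \<phi> (hsnd z))) `
    elts (hset {z \<in> elts t. z = kpair (hfst z) (hsnd z)}))"

text \<open>The action on names induced by an automorphism of the poset: it is applied hereditarily
  to all conditions. The recursion runs along the domain of a name, which lets \<open>wf_rec\<close>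
  show that the image of a name of M is in M.\<close>

definition name_map :: "(nat \<Rightarrow> nat) \<Rightarrow> hc \<Rightarrow> hc" where
  "name_map \<phi> = rec_along domain_of (name_step \<phi>)"

lemma elts_name_map:
  "elts (name_map \<phi> t) = {kpair (name_map \<phi> s) (condition_map \<phi> p) | s p. kpair s p \<in> elts t}"
proof -
  let ?g = "hset ((\<lambda>y. kpair y (name_map \<phi> y)) ` elts (domain_of t))"
  let ?f = "\<lambda>z. kpair (app ?g (hfst z)) (condition_map \<phi> (hsnd z))"
  have g: "app ?g s = name_map \<phi> s" if "kpair s p \<in> elts t" for s p
    by (rule app_graph) (use that in \<open>auto simp: elts_domain_of\<close>)
  have "name_map \<phi> t = name_step \<phi> t ?g"
    unfolding name_map_def by (rule rec_along[OF wf_domain_of])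
  then have "elts (name_map \<phi> t) = ?f ` {z \<in> elts t. z = kpair (hfst z) (hsnd z)}"
    by (simp only: name_step_def) (simp add: elts_hset countable_elts)
  also have "\<dots> = {kpair (name_map \<phi> s) (condition_map \<phi> p) | s p. kpair s p \<in> elts t}"
  proof (intro equalityI subsetI)
    fix w assume "w \<in> ?f ` {z \<in> elts t. z = kpair (hfst z) (hsnd z)}"
    then obtain z where z: "w = ?f z" "z \<in> elts t" "z = kpair (hfst z) (hsnd z)" by blast
    then have "kpair (hfst z) (hsnd z) \<in> elts t" by metis
    moreover from this have "w = kpair (name_map \<phi> (hfst z)) (condition_map \<phi> (hsnd z))"
      unfolding z(1) by (simp only: g)
    ultimately show "w \<in> {kpair (name_map \<phi> s) (condition_map \<phi> p) | s p. kpair s p \<in> elts t}" by blast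
  next
    fix w assume "w \<in> {kpair (name_map \<phi> s) (condition_map \<phi> p) | s p. kpair s p \<in> elts t}"
    then obtain s p where sp: "kpair s p \<in> elts t" "w = kpair (name_map \<phi> s) (condition_map \<phi> p)" by blast
    have "w = ?f (kpair s p)" unfolding sp(2) hfst_kpair hsnd_kpair g[OF sp(1)] ..
    moreover have "kpair s p \<in> {z \<in> elts t. z = kpair (hfst z) (hsnd z)}" using sp(1) by simp
    ultimately show "w \<in> ?f ` {z \<in> elts t. z = kpair (hfst z) (hsnd z)}" by (rule image_eqI)
  qed
  finally show ?thesis .
qed

lemma name_map_M:
  assumes p: "perm_in \<phi> \<psi>" and t: "t \<in> M"
  shows "name_map \<phi> t \<in> M"
proof -
  interpret wf_rec M domain_of "name_step \<phi>" "name_map \<phi>"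
  proof
    show "wf {(y, x). y \<in> elts (domain_of x)}" by (rule wf_domain_of)
    show "name_map \<phi> x = name_step \<phi> x (hset ((\<lambda>y. kpair y (name_map \<phi> y)) ` elts (domain_of x)))" for x
      unfolding name_map_def by (rule rec_along[OF wf_domain_of])
    show "dft (\<lambda>e. domain_of (e 0))" unfolding domain_of_def by (intro dfi)
    show "dft (\<lambda>e. name_step \<phi> (e 0) (e 1))"
      unfolding name_step_def condition_map_def by (intro dfi dft_pull[OF p])
  qed
  show ?thesis using full_M[OF t] by blast
qed

lemma condition_map_poset:
  assumes p: "perm_in \<phi> \<psi>" and z: "z \<in> random_poset M"
  shows "condition_map \<phi> z \<in> random_poset M"
proof -
  obtain X where X: "X \<in> nonnull" "z = set_code X" using z unfolding random_poset_nonnull by blast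
  then have "condition_map \<phi> z = set_code (pull \<phi> X)"
    unfolding condition_map_def using unset_set_code[OF countable_coded[OF nonnull_coded]] by simp
  then show ?thesis unfolding random_poset_nonnull using pull_nonnull[OF p X(1)] by blast
qed

lemma condition_map_filter:
  assumes p: "perm_in \<phi> \<psi>" and x: "x \<in> random_reals M" and z: "z \<in> random_poset M"
  shows "z \<in> random_filter M (\<lambda>n. x (\<phi> n)) \<longleftrightarrow> condition_map \<phi> z \<in> random_filter M x"
proof -
  obtain X where X: "X \<in> nonnull" "z = set_code X" using z unfolding random_poset_nonnull by blast
  then have c: "condition_map \<phi> (set_code X) = set_code (pull \<phi> X)"
    unfolding condition_map_def using unset_set_code[OF countable_coded[OF nonnull_coded]] by simp
  have *: "set_code Y \<in> random_filter M y \<longleftrightarrow> Y \<in> conditions y" if Y: "Y \<in> nonnull" for Y y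
  proof
    assume "set_code Y \<in> random_filter M y"
    then obtain Z where Z: "Z \<in> conditions y" "set_code Y = set_code Z"
      unfolding random_filter_conditions by blast
    then have "Y = Z"
      using set_code_inject[OF nonnull_coded[OF Y] nonnull_coded[OF conditions_nonnull[OF Z(1)]]] by blast
    then show "Y \<in> conditions y" using Z(1) by simp
  qed (simp add: random_filter_conditions)
  show ?thesis
    unfolding X(2) c *[OF X(1)] *[OF pull_nonnull[OF p X(1)]] conditions_perm[OF p x] using X(1) by blast
qed

lemma forcing_name_map:
  assumes p: "perm_in \<phi> \<psi>"
  shows "forcing_name (random_poset M) t \<Longrightarrow> forcing_name (random_poset M) (name_map \<phi> t)"
proof (induction t rule: forcing_name.induct)
  case (1 t)
  show ?case
  proof (rule forcing_name.intros)
    fix z assume "z \<in> elts (name_map \<phi> t)"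
    then obtain s q where sq: "z = kpair (name_map \<phi> s) (condition_map \<phi> q)" "kpair s q \<in> elts t"
      unfolding elts_name_map by blast
    then have "forcing_name (random_poset M) (name_map \<phi> s)" "q \<in> random_poset M"
      using 1[OF sq(2)] unfolding kpair_inject by blast+
    then show "\<exists>s p. z = kpair s p \<and> forcing_name (random_poset M) s \<and> p \<in> random_poset M"
      using sq(1) condition_map_poset[OF p] by blast
  qed
qed

text \<open>Induction on names: a condition belongs to the filter of the permuted real exactly if
  its image belongs to the filter of \<open>x\<close>, so corresponding members of the two names are
  selected.\<close>

lemma val_name_map:
  assumes p: "perm_in \<phi> \<psi>" and x: "x \<in> random_reals M"
  shows "forcing_name (random_poset M) t \<Longrightarrow>
    val (random_filter M x) (name_map \<phi> t) = val (random_filter M (\<lambda>n. x (\<phi> n))) t"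
proof (induction t rule: forcing_name.induct)
  case (1 t)
  let ?G = "random_filter M x" and ?H = "random_filter M (\<lambda>n. x (\<phi> n))"
  have mem: "q \<in> ?H \<longleftrightarrow> condition_map \<phi> q \<in> ?G"
    and IH: "val ?G (name_map \<phi> s) = val ?H s" if "kpair s q \<in> elts t" for s q
    using 1[OF that] condition_map_filter[OF p x] unfolding kpair_inject by blast+
  have "{s'. \<exists>q\<in>?G. kpair s' q \<in> elts (name_map \<phi> t)} = name_map \<phi> ` {s. \<exists>q\<in>?H. kpair s q \<in> elts t}"
  proof (intro equalityI subsetI)
    fix s' assume "s' \<in> {s'. \<exists>q\<in>?G. kpair s' q \<in> elts (name_map \<phi> t)}"
    then obtain s q where "s' = name_map \<phi> s" "condition_map \<phi> q \<in> ?G" "kpair s q \<in> elts t"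
      unfolding elts_name_map kpair_inject mem_Collect_eq by metis
    then show "s' \<in> name_map \<phi> ` {s. \<exists>q\<in>?H. kpair s q \<in> elts t}" using mem by blast
  next
    fix s' assume "s' \<in> name_map \<phi> ` {s. \<exists>q\<in>?H. kpair s q \<in> elts t}"
    then obtain s q where sq: "s' = name_map \<phi> s" "q \<in> ?H" "kpair s q \<in> elts t" by blast
    then have "condition_map \<phi> q \<in> ?G" using mem by blast
    then show "s' \<in> {s'. \<exists>q\<in>?G. kpair s' q \<in> elts (name_map \<phi> t)}"
      unfolding elts_name_map using sq by blast
  qed
  then have "val ?G ` {s'. \<exists>q\<in>?G. kpair s' q \<in> elts (name_map \<phi> t)} =
      (\<lambda>s. val ?G (name_map \<phi> s)) ` {s. \<exists>q\<in>?H. kpair s q \<in> elts t}" by (simp only: image_image)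
  also have "\<dots> = val ?H ` {s. \<exists>q\<in>?H. kpair s q \<in> elts t}"
    by (rule image_cong) (use IH in blast)+
  finally show ?case by (simp only: val.simps[of ?G "name_map \<phi> t"] val.simps[of ?H t])
qed

lemma random_ext_perm_subset:
  assumes p: "perm_in \<phi> \<psi>" and x: "x \<in> random_reals M"
  shows "random_ext M (\<lambda>n. x (\<phi> n)) \<subseteq> random_ext M x"
proof
  fix v assume "v \<in> random_ext M (\<lambda>n. x (\<phi> n))"
  then obtain t where t: "t \<in> M" "forcing_name (random_poset M) t"
    "v = val (random_filter M (\<lambda>n. x (\<phi> n))) t"
    unfolding random_ext_def generic_ext_def by blast
  then have "v = val (random_filter M x) (name_map \<phi> t)" using val_name_map[OF p x] by simp
  then show "v \<in> random_ext M x"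
    unfolding random_ext_def generic_ext_def using name_map_M[OF p t(1)] forcing_name_map[OF p t(2)] by blast
qed

lemma random_ext_perm:
  assumes p: "perm_in \<phi> \<psi>" and x: "x \<in> random_reals M"
  shows "random_ext M (\<lambda>n. x (\<phi> n)) = random_ext M x"
proof
  have "(\<lambda>n. (\<lambda>n. x (\<phi> n)) (\<psi> n)) = x" using p unfolding perm_in_def by simp
  then show "random_ext M x \<subseteq> random_ext M (\<lambda>n. x (\<phi> n))"
    using random_ext_perm_subset[OF perm_in_sym[OF p] random_reals_perm[OF p x]] by simp
qed (rule random_ext_perm_subset[OF p x])

section \<open>Permutations without fixed points\<close>

text \<open>On the \<open>2 * card I\<close> coordinates in \<open>I\<close> and its image, a real
  of this kind is determined by the set \<open>S\<close> of places in \<open>I\<close> where it is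
  true. There are \<open>2 ^ card I\<close> such patterns, each of measure
  \<open>(1 / 2) ^ (card I + card I)\<close>.\<close>

lemma emeasure_fixed_le:
  assumes fin: "finite I" and inj: "inj_on \<phi> I" and dis: "I \<inter> \<phi> ` I = {}"
  shows "clopen {x :: nat \<Rightarrow> bool. \<forall>i\<in>I. x i = x (\<phi> i)}"
    "emeasure cantor_measure {x. \<forall>i\<in>I. x i = x (\<phi> i)} \<le> ennreal ((1 / 2) ^ card I)"
proof -
  define K where "K = {x :: nat \<Rightarrow> bool. \<forall>i\<in>I. x i = x (\<phi> i)}"
  define L where "L S = {x :: nat \<Rightarrow> bool. \<forall>j\<in>I \<union> \<phi> ` I. x j = (j \<in> S \<union> \<phi> ` S)}" for S
  show "clopen {x :: nat \<Rightarrow> bool. \<forall>i\<in>I. x i = x (\<phi> i)}"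
    unfolding clopen_def
  proof (intro exI allI impI)
    fix x y :: "nat \<Rightarrow> bool"
    assume *: "\<forall>j<Suc (\<Sum>j\<in>I \<union> \<phi> ` I. j). x j = y j" "x \<in> {x. \<forall>i\<in>I. x i = x (\<phi> i)}"
    have "j < Suc (\<Sum>j\<in>I \<union> \<phi> ` I. j)" if "j \<in> I \<union> \<phi> ` I" for j
      using member_le_sum[OF that, of "\<lambda>j. j"] fin by (simp add: le_imp_less_Suc)
    then have "x j = y j" if "j \<in> I \<union> \<phi> ` I" for j using * that by blast
    then show "y \<in> {x. \<forall>i\<in>I. x i = x (\<phi> i)}" using *(2) by auto
  qed
  have card: "card (I \<union> \<phi> ` I) = card I + card I"
    using card_Un_disjoint[OF fin finite_imageI[OF fin] dis] card_image[OF inj] by simp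
  have "K \<subseteq> (\<Union>S\<in>Pow I. L S)"
  proof
    fix x assume x: "x \<in> K"
    define S where "S = {i \<in> I. x i}"
    have "x j = (j \<in> S \<union> \<phi> ` S)" if "j \<in> I \<union> \<phi> ` I" for j
      using that
    proof
      assume j: "j \<in> I"
      then have "j \<notin> \<phi> ` S" using dis unfolding S_def by blast
      then show ?thesis using j unfolding S_def by simp
    next
      assume "j \<in> \<phi> ` I"
      then obtain i where i: "i \<in> I" "j = \<phi> i" by blast
      then have "j \<notin> S" using dis unfolding S_def by blast
      moreover have "\<phi> i \<in> \<phi> ` S \<longleftrightarrow> i \<in> S"
        using inj i(1) unfolding S_def inj_on_def by blast
      moreover have "x (\<phi> i) = x i" using x i(1) unfolding K_def by auto
      moreover have "i \<in> S \<longleftrightarrow> x i" using i(1) unfolding S_def by simp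
      ultimately show ?thesis using i(2) by simp
    qed
    then have "x \<in> L S" unfolding L_def by blast
    moreover have "S \<in> Pow I" unfolding S_def by blast
    ultimately show "x \<in> (\<Union>S\<in>Pow I. L S)" by (rule UN_I[rotated])
  qed
  moreover have LS: "L S \<in> sets cantor_measure" for S
    unfolding L_def by (rule sets_coordinates) (simp add: fin)
  ultimately have "emeasure cantor_measure K \<le> emeasure cantor_measure (\<Union>S\<in>Pow I. L S)"
    using fin by (intro emeasure_mono) auto
  also have "\<dots> \<le> (\<Sum>S\<in>Pow I. emeasure cantor_measure (L S))"
    using fin LS by (intro emeasure_subadditive_finite) auto
  also have "\<dots> = (\<Sum>S\<in>Pow I. ennreal ((1 / 2) ^ (card I + card I)))"
    unfolding L_def using fin by (intro sum.cong refl) (subst emeasure_coordinates, simp_all only: finite_Un finite_imageI card simp_thms)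
  also have "\<dots> = ennreal (2 ^ card I * (1 / 2) ^ (card I + card I))"
    using fin by (simp add: card_Pow ennreal_mult flip: ennreal_of_nat_eq_real_of_nat)
      (simp add: ennreal_of_nat_eq_real_of_nat flip: ennreal_power)
  also have "(2 :: real) ^ card I * (1 / 2) ^ (card I + card I) = (1 / 2) ^ card I"
    by (simp add: power_add power_one_over)
  finally show "emeasure cantor_measure {x. \<forall>i\<in>I. x i = x (\<phi> i)} \<le> ennreal ((1 / 2) ^ card I)"
    unfolding K_def .
qed

text \<open>Some condition \<open>X\<close> decides the sets of reals of M that are moved at place
  \<open>n\<close>. If it lies in one of them, \<open>x\<close> is moved there as well, by agreement
  on finitely many places. Otherwise \<open>X\<close> consists of fixed reals and would be
  null.\<close>

lemma random_moved:
  assumes p: "perm_in \<phi> \<psi>" and nofix: "\<And>n. \<phi> n \<noteq> n" and x: "x \<in> random_reals M"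
  shows "(\<lambda>n. x (\<phi> n)) \<noteq> x"
proof -
  define A where "A n = {y \<in> cantor M. y n \<noteq> y (\<phi> n)}" for n
  have \<phi>M: "seqc (\<lambda>n. num (\<phi> n)) \<in> M" using p unfolding perm_in_def by blast
  note d\<phi> = seqcD[OF \<phi>M]
  have AM: "sets_code A \<in> M"
    unfolding A_def by (intro seqcI dfi d\<phi>)
  have Ac: "A n \<in> coded" for n
  proof (rule open_in_coded, unfold open_in_def, intro conjI ballI)
    show "A n \<in> sets_in M" unfolding sets_in_iff using seqc_M[OF AM, of n] unfolding A_def by blast
    fix y assume "y \<in> A n"
    then show "\<exists>m. \<forall>z\<in>cantor M. (\<forall>i<m. z i = y i) \<longrightarrow> z \<in> A n"
      unfolding A_def by (intro exI[of _ "Suc (n + \<phi> n)"]) simp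
  qed
  obtain X where X: "X \<in> conditions x" "X \<inter> (\<Union>n. A n) = {} \<or> (\<exists>n. X \<subseteq> A n)"
    using random_decides[OF x Ac AM] by blast
  have Xn: "X \<in> nonnull" by (rule conditions_nonnull[OF X(1)])
  from X(2) show ?thesis
  proof
    assume "\<exists>n. X \<subseteq> A n"
    then obtain n where n: "X \<subseteq> A n" by blast
    obtain y where y: "y \<in> X" "\<forall>i<Suc (n + \<phi> n). y i = x i" using random_agree[OF x X(1)] by blast
    have "y n \<noteq> y (\<phi> n)" using n y(1) unfolding A_def by blast
    then have "x n \<noteq> x (\<phi> n)" using y(2) by simp
    then show ?thesis by metis
  next
    assume dis: "X \<inter> (\<Union>n. A n) = {}"
    have inj: "inj \<phi>" using p unfolding perm_in_def inj_def by metis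
    have ex: "\<exists>I. finite I \<and> card I = k \<and> I \<inter> \<phi> ` I = {}" for k
    proof (induction k)
      case 0
      show ?case by (intro exI[of _ "{}"]) simp
    next
      case (Suc k)
      then obtain I where I: "finite I" "card I = k" "I \<inter> \<phi> ` I = {}" by blast
      have "finite (I \<union> \<phi> ` I \<union> \<psi> ` I)" using I(1) by simp
      from ex_new_if_finite[OF infinite_UNIV_nat this]
      obtain i where i: "i \<notin> I \<union> \<phi> ` I \<union> \<psi> ` I" by (elim exE)
      have "\<phi> i \<notin> I"
      proof
        assume "\<phi> i \<in> I"
        then have "\<psi> (\<phi> i) \<in> \<psi> ` I" by (rule imageI)
        then show False using i p unfolding perm_in_def by simp
      qed
      then have "insert i I \<inter> \<phi> ` insert i I = {}" using I(3) i nofix[of i] by auto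
      then show ?case using I i by (intro exI[of _ "insert i I"]) simp
    qed
    have "measure_in M X \<le> 0 + ennreal ((1 / 2) ^ k)" for k
    proof -
      obtain I where I: "finite I" "card I = k" "I \<inter> \<phi> ` I = {}" using ex by blast
      have inj': "inj_on \<phi> I" using inj by (rule inj_on_subset) simp
      have "X \<subseteq> {y. \<forall>i\<in>I. y i = y (\<phi> i)} \<inter> cantor M"
        using dis coded_sub[OF nonnull_coded[OF Xn]] unfolding A_def by blast
      then have "measure_in M X \<le> measure_in M ({y. \<forall>i\<in>I. y i = y (\<phi> i)} \<inter> cantor M)"
        by (rule measure_in_mono)
      also have "\<dots> \<le> ennreal ((1 / 2) ^ k)"
        using measure_in_clopen[OF emeasure_fixed_le(1)[OF I(1) inj' I(3)]]
          emeasure_fixed_le(2)[OF I(1) inj' I(3)] I(2) by simp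
      finally show ?thesis by simp
    qed
    then have "measure_in M X \<le> 0" by (rule ennreal_small_le)
    then show ?thesis using Xn unfolding nonnull_def by simp
  qed
qed

end

section \<open>The Bernoulli shift\<close>

locale ctm_group = ctm +
  fixes \<Gamma> :: "hc monoid" and enum :: "hc \<Rightarrow> nat"
  assumes group: "group_in M \<Gamma>" and enum: "enumeration_in M \<Gamma> enum"
begin

interpretation G: group \<Gamma>
  using group by (simp add: group_in_def)

lemma bij_enum: "bij_betw enum (carrier \<Gamma>) UNIV"
  using enum by (simp add: enumeration_in_def)

definition elem :: "nat \<Rightarrow> hc" where "elem = inv_into (carrier \<Gamma>) enum"

lemma elem_carrier [simp]: "elem n \<in> carrier \<Gamma>"
  unfolding elem_def using bij_betw_imp_surj_on[OF bij_enum] by (intro inv_into_into) simp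

lemma enum_elem [simp]: "enum (elem n) = n"
  unfolding elem_def using bij_betw_imp_surj_on[OF bij_enum] by (intro f_inv_into_f) simp

lemma elem_enum: "a \<in> carrier \<Gamma> \<Longrightarrow> elem (enum a) = a"
  unfolding elem_def using bij_betw_imp_inj_on[OF bij_enum] by (rule inv_into_f_f)

lemma translation_M:
  assumes g: "g \<in> carrier \<Gamma>"
  shows "seqc (\<lambda>n. num (enum (g \<otimes>\<^bsub>\<Gamma>\<^esub> elem n))) \<in> M"
proof -
  obtain c where c: "c \<in> M" "elts c = carrier \<Gamma>" using group unfolding group_in_def in_model_def by blast
  obtain m where m: "m \<in> M"
    "elts m = {kpair (kpair a b) (a \<otimes>\<^bsub>\<Gamma>\<^esub> b) | a b. a \<in> carrier \<Gamma> \<and> b \<in> carrier \<Gamma>}"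
    using group unfolding group_in_def in_model_def by blast
  obtain E where E: "E \<in> M" "elts E = {kpair a (num (enum a)) | a. a \<in> carrier \<Gamma>}"
    using enum unfolding enumeration_in_def in_model_def by blast
  have gM: "g \<in> M" using trans_M[OF c(1)] c(2) g by blast
  have appm: "app m (kpair a b) = a \<otimes>\<^bsub>\<Gamma>\<^esub> b" if "a \<in> carrier \<Gamma>" "b \<in> carrier \<Gamma>" for a b
  proof (rule app_eq)
    show "kpair (kpair a b) (a \<otimes>\<^bsub>\<Gamma>\<^esub> b) \<in> elts m" unfolding m(2) using that by blast
  qed (auto simp: m(2) kpair_inject)
  have appE: "app E a = num (enum a)" if "a \<in> carrier \<Gamma>" for a
  proof (rule app_eq)
    show "kpair a (num (enum a)) \<in> elts E" unfolding E(2) using that by blast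
  qed (auto simp: E(2) kpair_inject)
  \<comment> \<open>The element with number \<open>n\<close> as a term over M: the union of the
    singleton separated from the carrier by the graph of the enumeration.\<close>
  have el: "elem n = hset (\<Union>a\<in>elts (hset {a \<in> elts c. kpair a (num n) \<in> elts E}). elts a)" for n
  proof -
    have "kpair a (num n) \<in> elts E \<longleftrightarrow> a = elem n" if "a \<in> carrier \<Gamma>" for a
    proof -
      have "kpair a (num n) \<in> elts E \<longleftrightarrow> n = enum a" unfolding E(2) using that by (auto simp: kpair_inject)
      then show ?thesis using elem_enum[OF that] enum_elem by metis
    qed
    then have "{a \<in> elts c. kpair a (num n) \<in> elts E} = {elem n}" unfolding c(2) by auto
    then show ?thesis by (simp add: elts_hset hset_elts)
  qed
  have del: "dft (\<lambda>e. elem (unnum (e 0)))"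
    unfolding el by (intro dfi c(1) E(1))
  have "num (enum (g \<otimes>\<^bsub>\<Gamma>\<^esub> elem n)) = app E (app m (kpair g (elem n)))" for n
    using g by (simp add: appm appE)
  then show ?thesis by (simp only:) (intro seqcI dfi E(1) m(1) gM del)
qed

text \<open>Under the enumeration the shift by \<open>g\<close> becomes precomposition with this
  permutation, see \<open>shift_transfer\<close>, so the results about permutations in M apply to
  the group action.\<close>

lemma perm_in_translation:
  assumes g: "g \<in> carrier \<Gamma>"
  shows "perm_in (\<lambda>n. enum (m_inv \<Gamma> g \<otimes>\<^bsub>\<Gamma>\<^esub> elem n)) (\<lambda>n. enum (g \<otimes>\<^bsub>\<Gamma>\<^esub> elem n))"
proof -
  have "m_inv \<Gamma> g \<otimes>\<^bsub>\<Gamma>\<^esub> (g \<otimes>\<^bsub>\<Gamma>\<^esub> elem n) = elem n" "g \<otimes>\<^bsub>\<Gamma>\<^esub> (m_inv \<Gamma> g \<otimes>\<^bsub>\<Gamma>\<^esub> elem n) = elem n" for n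
    using g by (simp_all flip: G.m_assoc)
  then show ?thesis
    unfolding perm_in_def using g by (simp add: elem_enum translation_M)
qed

abbreviation transfer :: "(nat \<Rightarrow> bool) \<Rightarrow> hc \<Rightarrow> bool" where
  "transfer \<equiv> transfer_real \<Gamma> enum"

lemma transfer_inject: "transfer x = transfer y \<longleftrightarrow> x = y"
proof
  assume eq: "transfer x = transfer y"
  have "transfer x (elem n) = x n" for x n by (simp add: transfer_real_def)
  then show "x = y" using eq by (intro ext) metis
qed simp

lemma transfer_shift_space: "transfer x \<in> shift_space \<Gamma>"
  by (simp add: transfer_real_def shift_space_def)

lemma transfer_surj:
  assumes y: "y \<in> shift_space \<Gamma>"
  shows "transfer (\<lambda>n. y (elem n)) = y"
proof
  fix g show "transfer (\<lambda>n. y (elem n)) g = y g"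
    using PiE_arb[OF y[unfolded shift_space_def], of g]
    by (cases "g \<in> carrier \<Gamma>") (simp_all add: transfer_real_def elem_enum)
qed

lemma shift_transfer:
  assumes g: "g \<in> carrier \<Gamma>"
  shows "shift \<Gamma> g (transfer x) = transfer (\<lambda>n. x (enum (m_inv \<Gamma> g \<otimes>\<^bsub>\<Gamma>\<^esub> elem n)))"
proof
  fix d show "shift \<Gamma> g (transfer x) d = transfer (\<lambda>n. x (enum (m_inv \<Gamma> g \<otimes>\<^bsub>\<Gamma>\<^esub> elem n))) d"
    using g by (cases "d \<in> carrier \<Gamma>") (simp_all add: shift_def transfer_real_def elem_enum)
qed

section \<open>Transport of Borel sets and measure to the group\<close>

text \<open>Formulated for any \<sigma>-algebra with measurable coordinates, since it is applied to
  two of them: the one generated by the open sets and the one carried by the product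
  measure.\<close>

lemma transfer_sets:
  assumes S: "sigma_algebra (shift_space \<Gamma>) S"
    and gen: "\<And>a B. a \<in> carrier \<Gamma> \<Longrightarrow> {y \<in> shift_space \<Gamma>. y a \<in> B} \<in> S"
    and A: "A \<in> sets cantor_measure"
  shows "transfer ` A \<in> S"
proof -
  interpret sigma_algebra "shift_space \<Gamma>" S by (rule S)
  have "A \<in> sigma_sets UNIV {{f. f i \<in> B} | i B. True}"
    using A unfolding cantor_measure_def sets_PiM_single by (simp add: PiE_UNIV_domain)
  then show ?thesis
  proof (induction rule: sigma_sets.induct)
    case (Basic A)
    then obtain i B where A: "A = {f. f i \<in> B}" by blast
    have "transfer ` A = {y \<in> shift_space \<Gamma>. y (elem i) \<in> B}"
    proof (intro equalityI subsetI)
      fix y assume "y \<in> {y \<in> shift_space \<Gamma>. y (elem i) \<in> B}"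
      then show "y \<in> transfer ` A"
        unfolding A using transfer_surj[of y] by (intro image_eqI[of _ _ "\<lambda>n. y (elem n)"]) auto
    next
      fix y assume "y \<in> transfer ` A"
      then obtain x where "x i \<in> B" "y = transfer x" unfolding A by blast
      then show "y \<in> {y \<in> shift_space \<Gamma>. y (elem i) \<in> B}"
        using transfer_shift_space[of x] by (simp add: transfer_real_def)
    qed
    then show ?case using gen by simp
  next
    case Empty
    show ?case by simp
  next
    case (Compl A)
    have "transfer ` (UNIV - A) = shift_space \<Gamma> - transfer ` A"
    proof (intro equalityI subsetI)
      fix y assume y: "y \<in> shift_space \<Gamma> - transfer ` A"
      then have "(\<lambda>n. y (elem n)) \<in> UNIV - A" using transfer_surj[of y] by (metis DiffE DiffI UNIV_I imageI)
      then show "y \<in> transfer ` (UNIV - A)" using y transfer_surj[of y] by (metis DiffD1 imageI)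
    qed (auto simp: transfer_shift_space transfer_inject)
    then show ?case using Compl by (simp add: compl_sets)
  next
    case (Union A)
    then show ?case by (auto simp: image_UN)
  qed
qed

lemma transfer_shift_borel:
  assumes "A \<in> sets cantor_measure" shows "transfer ` A \<in> shift_borel \<Gamma>"
proof (rule transfer_sets[OF _ _ assms])
  let ?X = "product_topology (\<lambda>_. discrete_topology (UNIV :: bool set)) (carrier \<Gamma>)"
  have top: "topspace ?X = shift_space \<Gamma>" by (simp add: shift_space_def)
  show "sigma_algebra (shift_space \<Gamma>) (shift_borel \<Gamma>)"
    unfolding shift_borel_def
    by (rule sigma_algebra_sigma_sets) (use openin_subset[of ?X] top in auto)
  fix a and B :: "bool set" assume "a \<in> carrier \<Gamma>"
  then have "continuous_map ?X (discrete_topology UNIV) (\<lambda>y. y a)"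
    by (rule continuous_map_product_projection)
  then have "openin ?X {y \<in> topspace ?X. y a \<in> B}"
    by (rule openin_continuous_map_preimage) simp
  then show "{y \<in> shift_space \<Gamma>. y a \<in> B} \<in> shift_borel \<Gamma>"
    unfolding shift_borel_def top by (intro sigma_sets.Basic) simp
qed

lemma shift_measure_eq: "shift_measure \<Gamma> = PiM (carrier \<Gamma>) (\<lambda>_. coin)"
  by (simp add: shift_measure_def coin_def)

lemma space_shift_measure: "space (shift_measure \<Gamma>) = shift_space \<Gamma>"
  by (simp add: shift_measure_eq space_PiM shift_space_def)

lemma transfer_measurable_sets:
  assumes "A \<in> sets cantor_measure" shows "transfer ` A \<in> sets (shift_measure \<Gamma>)"
proof (rule transfer_sets[OF _ _ assms])
  show "sigma_algebra (shift_space \<Gamma>) (sets (shift_measure \<Gamma>))"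
    unfolding space_shift_measure[symmetric] by (rule sets.sigma_algebra_axioms)
  fix a and B :: "bool set" assume "a \<in> carrier \<Gamma>"
  then have "(\<lambda>y. y a) \<in> measurable (shift_measure \<Gamma>) coin"
    unfolding shift_measure_eq by (rule measurable_component_singleton)
  from measurable_sets[OF this, of B]
  show "{y \<in> shift_space \<Gamma>. y a \<in> B} \<in> sets (shift_measure \<Gamma>)"
    by (simp add: vimage_def Int_def space_shift_measure conj_commute)
qed

text \<open>Reindexing the independent coins along the bijection carries one product measure to the
  other, and \<open>transfer\<close> is injective, so the complement of the image pulls back to the
  complement of \<open>A\<close>.\<close>

lemma transfer_null:
  assumes "- A \<in> null_sets cantor_measure" "A \<in> sets cantor_measure"
  shows "shift_space \<Gamma> - transfer ` A \<in> null_sets (shift_measure \<Gamma>)"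
proof (rule null_setsI)
  have d: "distr cantor_measure (shift_measure \<Gamma>) transfer = shift_measure \<Gamma>"
  proof -
    have "distr (PiM UNIV (\<lambda>_. coin)) (PiM (carrier \<Gamma>) (\<lambda>_. coin)) (\<lambda>\<omega>. \<lambda>g\<in>carrier \<Gamma>. \<omega> (enum g)) =
        PiM (carrier \<Gamma>) (\<lambda>_. coin)"
      using bij_betw_imp_inj_on[OF bij_enum]
      by (intro distr_PiM_reindex[where M = "\<lambda>_. coin"] prob_space_coin) auto
    moreover have "transfer = (\<lambda>\<omega>. \<lambda>g\<in>carrier \<Gamma>. \<omega> (enum g))" by (intro ext) (simp add: transfer_real_def)
    ultimately show ?thesis by (simp only: shift_measure_eq cantor_measure_def)
  qed
  show S: "shift_space \<Gamma> - transfer ` A \<in> sets (shift_measure \<Gamma>)"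
    using sets.compl_sets[OF transfer_measurable_sets[OF assms(2)]] unfolding space_shift_measure .
  have m: "transfer \<in> measurable cantor_measure (shift_measure \<Gamma>)"
    unfolding shift_measure_eq cantor_measure_def transfer_real_def
    by (intro measurable_restrict measurable_component_singleton) simp
  have "emeasure (shift_measure \<Gamma>) (shift_space \<Gamma> - transfer ` A) =
      emeasure (distr cantor_measure (shift_measure \<Gamma>) transfer) (shift_space \<Gamma> - transfer ` A)"
    by (simp only: d)
  also have "\<dots> = emeasure cantor_measure (transfer -` (shift_space \<Gamma> - transfer ` A) \<inter> space cantor_measure)"
    by (rule emeasure_distr[OF m S])
  also have "transfer -` (shift_space \<Gamma> - transfer ` A) \<inter> space cantor_measure = - A"
    by (auto simp: transfer_shift_space transfer_inject)
  also have "emeasure cantor_measure (- A) = 0" using assms(1) by blast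
  finally show "emeasure (shift_measure \<Gamma>) (shift_space \<Gamma> - transfer ` A) = 0" .
qed

text \<open>By cancellation, translation by a group element other than the identity fixes no element
  of the group, so the corresponding permutation moves every random real.\<close>

lemma random_reals_on_free: "random_reals_on M \<Gamma> enum \<subseteq> free_part \<Gamma>"
proof
  fix y assume "y \<in> random_reals_on M \<Gamma> enum"
  then obtain x where x: "x \<in> random_reals M" "y = transfer x" unfolding random_reals_on_def by blast
  have "shift \<Gamma> g y \<noteq> y" if g: "g \<in> carrier \<Gamma>" "g \<noteq> \<one>\<^bsub>\<Gamma>\<^esub>" for g
  proof -
    have "enum (m_inv \<Gamma> g \<otimes>\<^bsub>\<Gamma>\<^esub> elem n) \<noteq> n" for n
    proof
      assume "enum (m_inv \<Gamma> g \<otimes>\<^bsub>\<Gamma>\<^esub> elem n) = n"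
      then have "m_inv \<Gamma> g \<otimes>\<^bsub>\<Gamma>\<^esub> elem n = elem n"
        using elem_enum[of "m_inv \<Gamma> g \<otimes>\<^bsub>\<Gamma>\<^esub> elem n"] g(1) by simp
      then have "m_inv \<Gamma> g = \<one>\<^bsub>\<Gamma>\<^esub>" using g(1) by simp
      then show False using g by simp
    qed
    from random_moved[OF perm_in_translation[OF g(1)] this x(1)]
    show ?thesis unfolding x(2) shift_transfer[OF g(1)] transfer_inject .
  qed
  then show "y \<in> free_part \<Gamma>" unfolding free_part_def using transfer_shift_space x(2) by blast
qed

lemma shift_random_reals_on:
  assumes g: "g \<in> carrier \<Gamma>"
  shows "shift \<Gamma> g ` random_reals_on M \<Gamma> enum = random_reals_on M \<Gamma> enum"
proof (intro equalityI subsetI)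
  let ?\<phi> = "\<lambda>n. enum (m_inv \<Gamma> g \<otimes>\<^bsub>\<Gamma>\<^esub> elem n)" and ?\<psi> = "\<lambda>n. enum (g \<otimes>\<^bsub>\<Gamma>\<^esub> elem n)"
  note p = perm_in_translation[OF g]
  {
    fix y assume "y \<in> shift \<Gamma> g ` random_reals_on M \<Gamma> enum"
    then obtain x where x: "x \<in> random_reals M" "y = shift \<Gamma> g (transfer x)" unfolding random_reals_on_def by blast
    then show "y \<in> random_reals_on M \<Gamma> enum"
      unfolding shift_transfer[OF g] random_reals_on_def using random_reals_perm[OF p] by blast
  next
    fix y assume "y \<in> random_reals_on M \<Gamma> enum"
    then obtain x where x: "x \<in> random_reals M" "y = transfer x" unfolding random_reals_on_def by blast
    have "?\<psi> (?\<phi> n) = n" for n using p unfolding perm_in_def by blast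
    then have "shift \<Gamma> g (transfer (\<lambda>n. x (?\<psi> n))) = y"
      unfolding shift_transfer[OF g] x(2) by simp
    then show "y \<in> shift \<Gamma> g ` random_reals_on M \<Gamma> enum"
      unfolding random_reals_on_def using random_reals_perm[OF perm_in_sym[OF p] x(1)] by blast
  }
qed

lemma shift_orbit_random_equiv:
  "shift_orbit_equiv \<Gamma> \<inter> (random_reals_on M \<Gamma> enum \<times> random_reals_on M \<Gamma> enum) \<subseteq> random_equiv_on M \<Gamma> enum"
proof
  fix z assume z: "z \<in> shift_orbit_equiv \<Gamma> \<inter> (random_reals_on M \<Gamma> enum \<times> random_reals_on M \<Gamma> enum)"
  then obtain x y where xy: "x \<in> random_reals M" "y \<in> random_reals M" "z = (transfer x, transfer y)"
    unfolding random_reals_on_def by blast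
  obtain g where g: "g \<in> carrier \<Gamma>" "transfer y = shift \<Gamma> g (transfer x)"
    using z unfolding xy(3) shift_orbit_equiv_def by blast
  then have "y = (\<lambda>n. x (enum (m_inv \<Gamma> g \<otimes>\<^bsub>\<Gamma>\<^esub> elem n)))"
    unfolding shift_transfer[OF g(1)] transfer_inject by blast
  then have "random_ext M x = random_ext M y"
    using random_ext_perm[OF perm_in_translation[OF g(1)] xy(1)] by simp
  then have "(x, y) \<in> random_equiv M" using xy unfolding random_equiv_def by blast
  then show "z \<in> random_equiv_on M \<Gamma> enum"
    unfolding random_equiv_on_def xy(3) by (rule rev_image_eqI) simp
qed

end

theorem theorem4p3:
  fixes M :: "hc set" and \<Gamma> :: "hc monoid" and e :: "hc \<Rightarrow> nat"
  assumes "ctm_ZFC M"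
    and "countably_infinite_group_in M \<Gamma>"
    and "enumeration_in M \<Gamma> e"
  shows "random_reals_on M \<Gamma> e \<subseteq> free_part \<Gamma> \<and>
    (\<forall>g\<in>carrier \<Gamma>. shift \<Gamma> g ` random_reals_on M \<Gamma> e = random_reals_on M \<Gamma> e) \<and>
    random_reals_on M \<Gamma> e \<in> shift_borel \<Gamma> \<and>
    shift_space \<Gamma> - random_reals_on M \<Gamma> e \<in> null_sets (shift_measure \<Gamma>) \<and>
    shift_orbit_equiv \<Gamma> \<inter> (random_reals_on M \<Gamma> e \<times> random_reals_on M \<Gamma> e)
      \<subseteq> random_equiv_on M \<Gamma> e"
proof -
  interpret ctm_group M \<Gamma> e
    using assms by unfold_locales (auto simp: countably_infinite_group_in_def)
  show ?thesis
    using random_reals_on_free shift_random_reals_on shift_orbit_random_equiv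
      transfer_shift_borel[OF random_reals_sets]
      transfer_null[OF random_reals_conull random_reals_sets]
    unfolding random_reals_on_def by blast
qed

end
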